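(* For each of the simple symmetric matrix singularities $\mathrm I_\tau$ $(\tau\ge2)$ and $\mathrm{II}_\tau$ $(\tau=4,5,6)$, the Lyashko--Looijenga type map $\mathcal L:\Lambda\to\Pi_\tau$ is a proper holomorphic map. Its restriction to $\Lambda\setminus\Theta$ is a finite order unramified covering of the complement $\Pi_\tau\setminus\Xi$.
   Context: The simple corank 3 symmetric matrix families $M:(\mathbb C^4_{x,y,z,w},0)\to\mathrm{Sym}_3$ (complex symmetric $3\times3$ matrices) and their quasi-homogeneous $\mathrm{SL}$-miniversal deformations $M_\lambda$, $\lambda\in\Lambda=\mathbb C^\tau$ ($\lambda=0$ giving $M$), are: - $\mathrm I_{\tau}$, $\tau=k+1$, $k\ge1$: $M_\lambda=\begin{pmatrix}x&\lambda_k&z\\ \lambda_k&y+x^k+\lambda_{k-1}x^{k-1}+\dots+\lambda_1x+\lambda_0&w\\ z&w&y\end{pmatrix}$. - $\mathrm{II}_\tau$: $M_\lambda=\begin{pmatrix}x&p(w)&y+q(w)\\ p(w)&y&z\\ y+q(w)&z&w\end{pmatrix}$, where for $\mathrm{II}_4$: $p=w^2+\lambda_1w+\lambda_0$, $q=\lambda_3w+\lambda_2$; for $\mathrm{II}_5$: $p=\lambda_2w^2+\lambda_1w+\lambda_0$, $q=w^2+\lambda_4w+\lambda_3$; for $\mathrm{II}_6$: $p=w^3+\lambda_2w^2+\lambda_1w+\lambda_0$, $q=\lambda_5w^2+\lambda_4w+\lambda_3$. ($\mathrm{SL}$-miniversality is with respect to the equivalence $M_1\circ\varphi=A^\top M_2A$,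 $\varphi$ a biholomorphism of the source and $A$ a holomorphic $\mathrm{SL}_3(\mathbb C)$-valued map.) The singular Milnor number $\mu_\Delta(M)$, i.e. the number of $3$-spheres in the wedge homotopy equivalent, for generic small $\lambda$, to the local set of points where $M_\lambda$ is degenerate, equals $\tau$ for these singularities. The full bifurcation diagram $\Theta\subset\Lambda$ is the set of all $\lambda$ for which the function $\det\circ M_\lambda$ has fewer than $\mu_\Delta(M)=\tau$ distinct non-zero critical values. $\Pi_\tau\simeq\mathbb C^\tau$ is the space of monic degree $\tau$ polynomials in one variable, and $\Xi\subset\Pi_\tau$ is the set of all polynomials having a multiple root or a zero root. For $\lambda\in\Lambda\setminus\Theta$, $\mathcal L(\lambda)\in\Pi_\tau$ is the polynomial whose roots are all the non-zero critical values of $\det\circ M_\lambda$; by continuity $\mathcal L$ extends to a holomorphic map $\mathcal L:\Lambda\to\Pi_\tau$ sending $\Theta$ to $\Xi$. By quasi-homogeneity all objects are considered globally on the complex coordinate spaces. *)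

theory Defs
  imports "HOL-Analysis.Analysis" "HOL-Computational_Algebra.Polynomial"
begin

section \<open>The matrix families\<close>

text \<open>\<open>TypeI k\<close> stands for \<open>I\<^sub>\<tau>\<close> with \<open>\<tau> = k + 1\<close>, where \<open>k \<ge> 1\<close>.\<close>

datatype sym_singularity = TypeI nat | TypeII4 | TypeII5 | TypeII6

fun tau :: "sym_singularity \<Rightarrow> nat" where
  "tau (TypeI k) = k + 1"
| "tau TypeII4 = 4"
| "tau TypeII5 = 5"
| "tau TypeII6 = 6"

definition matrix_I :: "nat \<Rightarrow> (nat \<Rightarrow> complex) \<Rightarrow> complex^4 \<Rightarrow> complex^3^3" where
  "matrix_I k l v =
     (let x = v $ 1; y = v $ 2; z = v $ 3; w = v $ 4 in
      vector [vector [x, l k, z],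
              vector [l k, y + x ^ k + (\<Sum>i<k. l i * x ^ i), w],
              vector [z, w, y]])"

definition matrix_II :: "(complex \<Rightarrow> complex) \<Rightarrow> (complex \<Rightarrow> complex) \<Rightarrow> complex^4 \<Rightarrow> complex^3^3" where
  "matrix_II p q v =
     (let x = v $ 1; y = v $ 2; z = v $ 3; w = v $ 4 in
      vector [vector [x, p w, y + q w],
              vector [p w, y, z],
              vector [y + q w, z, w]])"

text \<open>The family \<open>M\<^sub>\<lambda>\<close>; only the parameters \<open>l i\<close> with \<open>i < tau S\<close> occur in it.\<close>

fun matrix_family :: "sym_singularity \<Rightarrow> (nat \<Rightarrow> complex) \<Rightarrow> complex^4 \<Rightarrow> complex^3^3" where
  "matrix_family (TypeI k) l = matrix_I k l"
| "matrix_family TypeII4 l =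
     matrix_II (\<lambda>w. w^2 + l 1 * w + l 0) (\<lambda>w. l 3 * w + l 2)"
| "matrix_family TypeII5 l =
     matrix_II (\<lambda>w. l 2 * w^2 + l 1 * w + l 0) (\<lambda>w. w^2 + l 4 * w + l 3)"
| "matrix_family TypeII6 l =
     matrix_II (\<lambda>w. w^3 + l 2 * w^2 + l 1 * w + l 0) (\<lambda>w. l 5 * w^2 + l 4 * w + l 3)"

section \<open>Critical values and the full bifurcation diagram\<close>

definition critical_values :: "('a::real_normed_vector \<Rightarrow> 'b::real_normed_vector) \<Rightarrow> 'b set" where
  "critical_values f = f ` {v. (f has_derivative (\<lambda>_. 0)) (at v)}"

text \<open>
  The parameter space is \<^typ>\<open>complex^'n\<close> with \<open>CARD('n) = tau S\<close>. Its coordinates, numbered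
  \<open>0, \<dots>, tau S - 1\<close>, are addressed through a labelling \<open>ix\<close>, a bijection
  from \<open>{..<tau S}\<close> onto \<^typ>\<open>'n\<close>: the parameter \<open>\<lambda>\<^sub>i\<close> at the point \<open>t\<close> is \<open>t $ ix i\<close>.
\<close>

definition nonzero_critical_values ::
    "sym_singularity \<Rightarrow> (nat \<Rightarrow> 'n::finite) \<Rightarrow> complex^'n \<Rightarrow> complex set" where
  "nonzero_critical_values S ix t =
     critical_values (\<lambda>v. det (matrix_family S (\<lambda>i. t $ ix i) v)) - {0}"

text \<open>Finiteness is required explicitly because \<^const>\<open>card\<close> is \<open>0\<close> on infinite sets.\<close>

definition bifurcation_diagram :: "sym_singularity \<Rightarrow> (nat \<Rightarrow> 'n::finite) \<Rightarrow> (complex^'n) set" where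
  "bifurcation_diagram S ix =
     {t. finite (nonzero_critical_values S ix t) \<and> card (nonzero_critical_values S ix t) < tau S}"

section \<open>Monic polynomials\<close>

text \<open>
  The space of monic polynomials of degree \<open>CARD('n)\<close> is identified with \<^typ>\<open>complex^'n\<close> by means
  of the non-leading coefficients.
\<close>

definition monic_poly :: "(nat \<Rightarrow> 'n::finite) \<Rightarrow> complex^'n \<Rightarrow> complex poly" where
  "monic_poly ix a = monom 1 CARD('n) + (\<Sum>i<CARD('n). monom (a $ ix i) i)"

definition discriminant_set :: "(nat \<Rightarrow> 'n::finite) \<Rightarrow> (complex^'n) set" where
  "discriminant_set ix =
     {a. (\<exists>r. order r (monic_poly ix a) \<ge> 2) \<or> poly (monic_poly ix a) 0 = 0}"

section \<open>The Lyashko--Looijenga type map\<close>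

definition LL_generic :: "sym_singularity \<Rightarrow> (nat \<Rightarrow> 'n::finite) \<Rightarrow> complex^'n \<Rightarrow> complex^'n" where
  "LL_generic S ix t =
     (THE a. {c. poly (monic_poly ix a) c = 0} = nonzero_critical_values S ix t)"

text \<open>The extension by continuity from the complement of the bifurcation diagram.\<close>

definition LL :: "sym_singularity \<Rightarrow> (nat \<Rightarrow> 'n::finite) \<Rightarrow> complex^'n \<Rightarrow> complex^'n" where
  "LL S ix t =
     (if t \<in> bifurcation_diagram S ix
      then Lim (at t within - bifurcation_diagram S ix) (LL_generic S ix)
      else LL_generic S ix t)"

text \<open>Holomorphy in several variables: existence of a complex-linear Frechet derivative.\<close>

definition holomorphic_map_on :: "(complex^'n \<Rightarrow> complex^'m) \<Rightarrow> (complex^'n) set \<Rightarrow> bool" where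
  "holomorphic_map_on f U \<longleftrightarrow>
     open U \<and> (\<forall>x\<in>U. \<exists>D. (f has_derivative D) (at x) \<and> Vector_Spaces.linear (*s) (*s) D)"

end

theory Submission
  imports Defs "HOL-Computational_Algebra.Fundamental_Theorem_Algebra"
begin

text \<open>
  The Lyashko--Looijenga map turns out to be a polynomial map, given by the coefficients of a characteristic polynomial. The theorem then follows from three facts:
  the map is proper, it is locally injective outside the bifurcation diagram, and the complement of the discriminant is connected.

  For type II the critical points with non-zero value are described by two
  coordinates \<open>w, z\<close> with \<open>p + 2 w p' = 2 z q'\<close> and \<open>3 z\<^sup>2 = - w q\<close> (\<open>critical_values_II\<close>); substituting \<open>w = \<alpha>\<^sup>2\<close> and \<open>z = \<alpha> \<beta>\<close>, these are
  the critical points, up to sign, of the odd function \<open>\<phi> = \<alpha> p(\<alpha>\<^sup>2) - \<beta> q(\<alpha>\<^sup>2) - \<beta>\<^sup>3\<close>, and the critical value is \<open>- \<phi>\<^sup>2\<close>. For type I they are the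
  roots of one polynomial of degree \<open>k + 1\<close> in \<open>x\<close> (\<open>critical_values_I\<close>). In each case the algebra of functions on these
  points has a basis of \<open>\<tau>\<close> monomials that does not depend on \<open>\<lambda>\<close>, so multiplication by the critical value is a matrix polynomial in \<open>\<lambda>\<close>. Its
  characteristic polynomial is monic of degree \<open>\<tau>\<close>, and its non-zero roots are the non-zero critical values (\<open>pol_root_iff\<close>). The
  coefficients of this polynomial extend the map over the bifurcation diagram.

  For properness, by quasi-homogeneity with positive weights, it suffices that all critical values vanish for \<open>\<lambda> = 0\<close> only
  (\<open>compact_preimage_LLmap\<close>). This is a count of multiplicities (\<open>nilpotent_imp_discriminant_monomial\<close>): the discriminant
  \<open>27 X p\<^sup>2 + 4 q\<^sup>3\<close> of \<open>\<phi>\<close> with respect to \<open>\<beta>\<close>, up to sign, has degree \<open>\<tau> + 1\<close>, and the polynomial for the \<open>w\<close>-coordinates of the critical points has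
  degree \<open>\<tau>\<close>. If all critical values are zero, then at every root of the second polynomial the first one vanishes to higher order. Counted with
  multiplicity it has just one more root, so the second polynomial has only one root, which must be \<open>0\<close>, and a discriminant that is a monomial forces \<open>\<lambda> = 0\<close>.

  Local injectivity is infinitesimal. Outside the bifurcation diagram the characteristic polynomial has simple roots. If its coefficients are stationary in a
  direction \<open>h\<close>, so are all critical values. Now every critical point can be followed along a curve of parameters with tangent \<open>h\<close>, and the
  derivative of its critical value is the derivative of the function in the direction \<open>h\<close> at the critical point
  (\<open>stationary_direction\<close>). Thus this derivative, a combination of finitely many monomials, vanishes at \<open>\<tau>\<close> points, which separate the basis
  of the algebra (\<open>points_separate_basis\<close>); this gives \<open>h = 0\<close>.

  The rest is topology. Over a connected open set, a proper locally injective map between spaces of equal dimension is a finite covering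
  (\<open>proper_locally_injective_covering\<close>). The complement of the discriminant is connected because two of its points lie on a complex line
  that meets the discriminant in finitely many points (\<open>complement_zeros_line_polynomial\<close>). The locale \<open>critical_value_family\<close> contains exactly
  the algebraic input that this part needs.
\<close>

section \<open>Polynomial functions of the parameters\<close>

inductive polyfun :: "nat \<Rightarrow> ((nat \<Rightarrow> complex) \<Rightarrow> complex) \<Rightarrow> bool" for n where
  const [intro, simp]: "polyfun n (\<lambda>_. c)"
| coord [intro]: "i < n \<Longrightarrow> polyfun n (\<lambda>l. l i)"
| add [intro]: "polyfun n f \<Longrightarrow> polyfun n g \<Longrightarrow> polyfun n (\<lambda>l. f l + g l)"
| mult [intro]: "polyfun n f \<Longrightarrow> polyfun n g \<Longrightarrow> polyfun n (\<lambda>l. f l * g l)"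

lemma polyfun_uminus [intro]: "polyfun n f \<Longrightarrow> polyfun n (\<lambda>l. - f l)"
  using polyfun.mult[OF polyfun.const[of n "-1"], of f] by simp

lemma polyfun_diff [intro]: "polyfun n f \<Longrightarrow> polyfun n g \<Longrightarrow> polyfun n (\<lambda>l. f l - g l)"
  using polyfun.add[OF _ polyfun_uminus, of n f g] by simp

lemma polyfun_divide [intro]: "polyfun n f \<Longrightarrow> polyfun n (\<lambda>l. f l / c)"
  using polyfun.mult[OF _ polyfun.const[of n "inverse c"], of f] by (simp add: field_simps)

lemma polyfun_power [intro]: "polyfun n f \<Longrightarrow> polyfun n (\<lambda>l. f l ^ k)"
  by (induction k) auto

lemma polyfun_sum [intro]: "(\<And>i. i \<in> A \<Longrightarrow> polyfun n (f i)) \<Longrightarrow> polyfun n (\<lambda>l. \<Sum>i\<in>A. f i l)"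
  by (induction A rule: infinite_finite_induct) auto

lemma polyfun_prod [intro]: "(\<And>i. i \<in> A \<Longrightarrow> polyfun n (f i)) \<Longrightarrow> polyfun n (\<lambda>l. \<Prod>i\<in>A. f i l)"
  by (induction A rule: infinite_finite_induct) auto

lemma polyfun_if [intro]:
  "(b \<Longrightarrow> polyfun n f) \<Longrightarrow> (\<not> b \<Longrightarrow> polyfun n g) \<Longrightarrow> polyfun n (\<lambda>l. if b then f l else g l)"
  by (cases b) simp_all

lemma polyfun_cong: "polyfun n f \<Longrightarrow> (\<And>i. i < n \<Longrightarrow> l i = l' i) \<Longrightarrow> f l = f l'"
  by (induction rule: polyfun.induct) auto

lemma polyfun_compose:
  assumes "polyfun m f" "\<And>i. i < m \<Longrightarrow> polyfun n (g i)"
  shows "polyfun n (\<lambda>l. f (\<lambda>i. g i l))"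
  using assms(1) by (induction rule: polyfun.induct) (use assms(2) in auto)

text \<open>
  Restriction to complex lines turns statements about hypersurfaces into statements about the finitely many roots of
  a polynomial in one variable.
\<close>

lemma polyfun_line:
  assumes "polyfun n f"
  shows "\<exists>P. \<forall>s. f (\<lambda>i. a i + s * b i) = poly P s"
  using assms
proof (induction rule: polyfun.induct)
  case (const c)
  show ?case by (rule exI[of _ "[:c:]"]) simp
next
  case (coord i)
  show ?case by (rule exI[of _ "[:a i, b i:]"]) (simp add: algebra_simps)
next
  case (add f g)
  then show ?case by (metis poly_add)
next
  case (mult f g)
  then show ?case by (metis poly_mult)
qed

definition partial :: "((nat \<Rightarrow> complex) \<Rightarrow> complex) \<Rightarrow> nat \<Rightarrow> (nat \<Rightarrow> complex) \<Rightarrow> complex" where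
  "partial f i l = deriv (\<lambda>s. f (l(i := s))) (l i)"

text \<open>
  That the partial derivative is again polynomial is what later yields its continuity, and thereby the hypothesis of the
  inverse function theorem.
\<close>

lemma polyfun_partial_aux:
  assumes "polyfun n f"
  shows "\<exists>d. polyfun n d \<and> (\<forall>l. ((\<lambda>s. f (l(i := s))) has_field_derivative d l) (at (l i)))"
  using assms
proof (induction rule: polyfun.induct)
  case (const c)
  show ?case by (rule exI[of _ "\<lambda>_. 0"]) auto
next
  case (coord j)
  show ?case by (rule exI[of _ "\<lambda>_. if i = j then 1 else 0"]) auto
next
  case (add f g)
  then obtain d e where "polyfun n d" "polyfun n e"
    "\<And>l. ((\<lambda>s. f (l(i := s))) has_field_derivative d l) (at (l i))"
    "\<And>l. ((\<lambda>s. g (l(i := s))) has_field_derivative e l) (at (l i))" by blast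
  then show ?case
    by (intro exI[of _ "\<lambda>l. d l + e l"] conjI allI polyfun.add DERIV_add)
next
  case (mult f g)
  then obtain d e where de: "polyfun n d" "polyfun n e"
    "\<And>l. ((\<lambda>s. f (l(i := s))) has_field_derivative d l) (at (l i))"
    "\<And>l. ((\<lambda>s. g (l(i := s))) has_field_derivative e l) (at (l i))" by blast
  show ?case
  proof (intro exI[of _ "\<lambda>l. f l * e l + d l * g l"] conjI allI)
    fix l
    show "((\<lambda>s. f (l(i := s)) * g (l(i := s))) has_field_derivative f l * e l + d l * g l) (at (l i))"
      by (rule DERIV_cong[OF DERIV_mult[OF de(3) de(4)]]) (simp add: fun_upd_triv)
  qed (use mult de in auto)
qed

lemma polyfun_has_partial:
  assumes "polyfun n f"
  shows "((\<lambda>s. f (l(i := s))) has_field_derivative partial f i l) (at (l i))"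
  using polyfun_partial_aux[OF assms, of i] unfolding partial_def by (metis DERIV_imp_deriv)

lemma polyfun_partial [intro]: "polyfun n f \<Longrightarrow> polyfun n (partial f i)"
proof -
  assume f: "polyfun n f"
  from polyfun_partial_aux[OF f, of i] obtain d where d: "polyfun n d"
    "\<And>l. ((\<lambda>s. f (l(i := s))) has_field_derivative d l) (at (l i))" by blast
  have "partial f i = d" using d(2) unfolding partial_def by (intro ext DERIV_imp_deriv)
  with d show ?thesis by simp
qed

lemma polyfun_has_derivative:
  fixes \<gamma> :: "'a::real_normed_vector \<Rightarrow> nat \<Rightarrow> complex"
  assumes "polyfun n f" "\<And>i. i < n \<Longrightarrow> ((\<lambda>x. \<gamma> x i) has_derivative g i) (at x)"
  shows "((\<lambda>x. f (\<gamma> x)) has_derivative (\<lambda>h. \<Sum>i<n. partial f i (\<gamma> x) * g i h)) (at x)"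
  using assms(1)
proof (induction rule: polyfun.induct)
  case (const c)
  have "partial (\<lambda>_. c) = (\<lambda>_ _. 0)" unfolding partial_def by simp
  then show ?case by simp
next
  case (coord j)
  have "partial (\<lambda>l. l j) i l = (if i = j then 1 else 0)" for i l unfolding partial_def
    by (cases "i = j") auto
  hence "(\<Sum>i<n. partial (\<lambda>l. l j) i (\<gamma> x) * g i h) = g j h" for h
    using coord by (subst sum.remove[of _ j]) auto
  then show ?case using assms(2)[OF coord] by simp
next
  case (add f1 f2)
  have "partial (\<lambda>l. f1 l + f2 l) i l = partial f1 i l + partial f2 i l" for i l
    using DERIV_imp_deriv[OF DERIV_add[OF polyfun_has_partial[OF add(1), of l i] polyfun_has_partial[OF add(2), of l i]]]
    unfolding partial_def by simp
  then show ?case using has_derivative_add[OF add.IH] by (simp add: algebra_simps sum.distrib)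
next
  case (mult f1 f2)
  have "partial (\<lambda>l. f1 l * f2 l) i l = f1 l * partial f2 i l + partial f1 i l * f2 l" for i l
    using DERIV_imp_deriv[OF DERIV_mult[OF polyfun_has_partial[OF mult(1), of l i] polyfun_has_partial[OF mult(2), of l i]]]
    unfolding partial_def by simp
  then show ?case using has_derivative_mult[OF mult.IH]
    by (simp add: algebra_simps sum.distrib sum_distrib_left)
qed

lemma polyfun_has_field_derivative:
  assumes "polyfun n f" "\<And>i. i < n \<Longrightarrow> ((\<lambda>s. \<gamma> s i) has_field_derivative g i) (at s)"
  shows "((\<lambda>s. f (\<gamma> s)) has_field_derivative (\<Sum>i<n. partial f i (\<gamma> s) * g i)) (at s)"
proof -
  have "(\<lambda>h. \<Sum>i<n. partial f i (\<gamma> s) * (g i * h)) = (*) (\<Sum>i<n. partial f i (\<gamma> s) * g i)"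
    by (simp add: fun_eq_iff sum_distrib_right mult.assoc)
  with polyfun_has_derivative[OF assms(1), of \<gamma> "\<lambda>i. (*) (g i)" s] assms(2)
  show ?thesis unfolding has_field_derivative_def by simp
qed

definition polyfun_coeffs :: "nat \<Rightarrow> ((nat \<Rightarrow> complex) \<Rightarrow> complex poly) \<Rightarrow> bool" where
  "polyfun_coeffs n P \<longleftrightarrow> (\<forall>i. polyfun n (\<lambda>l. coeff (P l) i))"

lemma polyfun_coeffs_const [intro,simp]: "polyfun_coeffs n (\<lambda>_. p)"
  by (simp add: polyfun_coeffs_def)
lemma polyfun_coeffs_pCons [intro]:
  "polyfun n f \<Longrightarrow> polyfun_coeffs n P \<Longrightarrow> polyfun_coeffs n (\<lambda>l. pCons (f l) (P l))"
  unfolding polyfun_coeffs_def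
proof (intro allI)
  fix i assume "polyfun n f" "\<forall>i. polyfun n (\<lambda>l. coeff (P l) i)"
  then show "polyfun n (\<lambda>l. coeff (pCons (f l) (P l)) i)" by (cases i) simp_all
qed
lemma polyfun_coeffs_add [intro]:
  "polyfun_coeffs n P \<Longrightarrow> polyfun_coeffs n Q \<Longrightarrow> polyfun_coeffs n (\<lambda>l. P l + Q l)"
  unfolding polyfun_coeffs_def by (auto)
lemma polyfun_coeffs_mult [intro]:
  "polyfun_coeffs n P \<Longrightarrow> polyfun_coeffs n Q \<Longrightarrow> polyfun_coeffs n (\<lambda>l. P l * Q l)"
  unfolding polyfun_coeffs_def coeff_mult by (auto intro!: polyfun_sum polyfun.mult)
lemma polyfun_coeffs_sum [intro]:
  "(\<And>i. i \<in> A \<Longrightarrow> polyfun_coeffs n (f i)) \<Longrightarrow> polyfun_coeffs n (\<lambda>l. \<Sum>i\<in>A. f i l)"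
  by (induction A rule: infinite_finite_induct) auto
lemma polyfun_coeffs_prod [intro]:
  "(\<And>i. i \<in> A \<Longrightarrow> polyfun_coeffs n (f i)) \<Longrightarrow> polyfun_coeffs n (\<lambda>l. \<Prod>i\<in>A. f i l)"
  by (induction A rule: infinite_finite_induct) auto
section \<open>Characteristic polynomials\<close>

definition charpoly :: "complex^'n^'n \<Rightarrow> complex poly" where
  "charpoly T = det (\<chi> i j. if i = j then [:- T$i$j, 1:] else [:- T$i$j:])"

lemma poly_charpoly: "poly (charpoly T) c = det (mat c - T)"
  unfolding charpoly_def det_def poly_sum
  by (intro sum.cong refl) (auto simp: poly_prod mat_def intro!: arg_cong2[of _ _ _ _ "(*)"] prod.cong)

lemma charpoly_root_iff:
  "poly (charpoly T) c = 0 \<longleftrightarrow> (\<exists>u. u \<noteq> 0 \<and> T *v u = c *s u)"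
proof -
  have "poly (charpoly T) c = 0 \<longleftrightarrow> (\<exists>u. u \<noteq> 0 \<and> (mat c - T) *v u = 0)"
    unfolding poly_charpoly using invertible_det_nz[of "mat c - T"]
      matrix_left_invertible_ker[of "mat c - T"] invertible_left_inverse[of "mat c - T"] by metis
  also have "(\<lambda>u. (mat c - T) *v u) = (\<lambda>u. c *s u - T *v u)"
    by (auto simp: matrix_vector_mult_def vec_eq_iff mat_def fun_eq_iff left_diff_distrib sum_subtractf
        if_distrib[of "\<lambda>x. x * _"] cong: if_cong)
  then have "(mat c - T) *v u = c *s u - T *v u" for u by metis
  ultimately show ?thesis by (metis right_minus_eq)
qed

text \<open>
  In the Leibniz expansion only the identity permutation reaches full degree: any other permutation misses a diagonal
  entry, and the entries off the diagonal are constants.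
\<close>

lemma monic_charpoly:
  fixes T :: "complex^'n^'n"
  shows "degree (charpoly T) = CARD('n)" "lead_coeff (charpoly T) = 1"
proof -
  let ?A = "(\<chi> i j. if i = j then [:- T$i$j, 1:] else [:- T$i$j:]) :: complex poly^'n^'n"
  let ?t = "\<lambda>p. of_int (sign p) * (\<Prod>i\<in>UNIV. ?A $ i $ p i)"
  let ?d = "\<Prod>i\<in>UNIV. [:- T$i$i, 1:]"
  have fin: "finite {p. p permutes (UNIV::'n set)}" by (simp add: finite_permutations)
  have split: "charpoly T = ?d + (\<Sum>p\<in>{p. p permutes UNIV} - {id}. ?t p)"
    unfolding charpoly_def det_def
    by (subst sum.remove[OF fin, of id]) (auto simp: permutes_id sign_id)
  have dd: "degree ?d = CARD('n)" by (subst degree_prod_sum_eq) auto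
  have ld: "lead_coeff ?d = 1" by (simp add: lead_coeff_prod)
  have small: "degree (?t p) < CARD('n)" if p: "p \<in> {p. p permutes UNIV} - {id}" for p
  proof -
    obtain i where i: "i \<noteq> p i" using p by (auto simp: fun_eq_iff) metis
    have "degree (?t p) \<le> degree (\<Prod>i\<in>UNIV. ?A $ i $ p i)"
      by (rule sign_cases[of p]) simp_all
    also have "\<dots> \<le> (\<Sum>i\<in>UNIV. degree (?A $ i $ p i))"
      using degree_prod_sum_le[of "UNIV::'n set" "\<lambda>i. ?A $ i $ p i"] by (simp only: o_def finite)
    also have "\<dots> < (\<Sum>i\<in>(UNIV::'n set). 1)"
      by (rule sum_strict_mono_ex1) (use i in \<open>auto\<close>)
    finally show ?thesis by simp
  qed
  have "degree (\<Sum>p\<in>{p. p permutes UNIV} - {id}. ?t p) < CARD('n)"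
  proof (cases "{p. p permutes (UNIV::'n set)} - {id} = {}")
    case False
    then show ?thesis using small fin by (intro degree_sum_less) auto
  next
    case True
    show ?thesis by (simp only: True sum.empty) simp
  qed
  then show "degree (charpoly T) = CARD('n)" "lead_coeff (charpoly T) = 1"
    using dd ld unfolding split by (simp_all add: degree_add_eq_left lead_coeff_add_le coeff_eq_0)
qed

lemma polyfun_charpoly:
  assumes T: "\<And>i j. polyfun n (\<lambda>l. T l $ i $ j)"
  shows "polyfun_coeffs n (\<lambda>l. charpoly (T l))"
proof -
  have "polyfun_coeffs n (\<lambda>l. if i = j then [:- T l $ i $ j, 1:] else [:- T l $ i $ j:])" for i j
    using T by (cases "i = j") (auto intro!: polyfun_coeffs_pCons polyfun_uminus)
  then show ?thesis
    unfolding charpoly_def det_def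
    by (intro polyfun_coeffs_sum polyfun_coeffs_mult polyfun_coeffs_const polyfun_coeffs_prod)
      (simp only: vec_lambda_beta)
qed

lemma polyfun_det:
  assumes "\<And>i j. polyfun n (\<lambda>l. T l $ i $ j)"
  shows "polyfun n (\<lambda>l. det (T l))"
  unfolding det_def by (intro polyfun_sum polyfun.mult polyfun_prod polyfun.const assms)

section \<open>Complements of hypersurfaces, and proper local homeomorphisms\<close>

text \<open>
  Two points off the zero set are joined inside the complex line through them: this line meets the zero set in the roots
  of a non-zero polynomial, and the complex plane minus a countable set is path connected. Density follows in the
  same way from a line through a point where \<open>f\<close> does not vanish.
\<close>

lemma complement_zeros_line_polynomial:
  fixes f :: "complex^'n \<Rightarrow> complex"
  assumes line: "\<And>x y. \<exists>P. \<forall>s. f (x + s *s y) = poly P s" and x0: "f x0 \<noteq> 0"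
  shows "connected {x. f x \<noteq> 0}" "closure {x. f x \<noteq> 0} = UNIV"
proof -
  have cont: "continuous_on S (\<lambda>s. a + s *s y)" for a y :: "complex^'n" and S
  proof -
    have "(\<lambda>s. a + s *s y) = (\<lambda>s. \<chi> i. a $ i + s * y $ i)" by (simp add: vec_eq_iff fun_eq_iff)
    then show ?thesis by (simp only:) (intro continuous_intros)
  qed
  have "path_connected {x. f x \<noteq> 0}"
    unfolding path_connected_component
  proof (intro ballI)
    fix a b assume ab: "a \<in> {x. f x \<noteq> 0}" "b \<in> {x. f x \<noteq> 0}"
    obtain P where P: "\<And>s. f (a + s *s (b - a)) = poly P s" using line by blast
    let ?g = "\<lambda>s. a + s *s (b - a)"
    have g01: "?g 0 = a" "?g 1 = b" by (simp_all add: vec_eq_iff)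
    have "P \<noteq> 0" using P[of 0] ab g01 by auto
    then have "countable {s. poly P s = 0}" by (simp add: poly_roots_finite countable_finite)
    then have "path_connected (?g ` (- {s. poly P s = 0}))"
      by (intro path_connected_continuous_image[OF cont] path_connected_complement_countable) auto
    moreover have "?g ` (- {s. poly P s = 0}) \<subseteq> {x. f x \<noteq> 0}" using P by auto
    moreover have "a \<in> ?g ` (- {s. poly P s = 0})" "b \<in> ?g ` (- {s. poly P s = 0})"
      using P[of 0] P[of 1] g01 ab by (metis (mono_tags, lifting) ComplI image_eqI mem_Collect_eq)+
    ultimately show "path_component {x. f x \<noteq> 0} a b"
      by (meson path_component_of_subset path_connected_component)
  qed
  then show "connected {x. f x \<noteq> 0}" by (rule path_connected_imp_connected)
  show "closure {x. f x \<noteq> 0} = UNIV"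
  proof -
    have "x \<in> closure {x. f x \<noteq> 0}" for x
    proof -
      obtain P where P: "\<And>s. f (x + s *s (x0 - x)) = poly P s" using line by blast
      have g1: "x + 1 *s (x0 - x) = x0" by (simp add: vec_eq_iff)
      have "P \<noteq> 0" using P[of 1] x0 g1 by auto
      then have fin: "finite {s. poly P s = 0}" by (rule poly_roots_finite)
      have tend: "((\<lambda>s. x + s *s (x0 - x)) \<longlongrightarrow> x + 0 *s (x0 - x)) (at 0)"
        using cont[of UNIV x "x0 - x"] unfolding continuous_on_def by blast
      have "\<forall>\<^sub>F s in at 0. s \<notin> {s. poly P s = 0}"
        using islimpt_finite[OF fin] by (simp add: islimpt_iff_eventually)
      then have "\<forall>\<^sub>F s in at (0::complex). x + s *s (x0 - x) \<in> closure {x. f x \<noteq> 0}"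
        by eventually_elim (use P in \<open>auto intro: subsetD[OF closure_subset]\<close>)
      then have "x + 0 *s (x0 - x) \<in> closure {x. f x \<noteq> 0}"
        by (intro Lim_in_closed_set[OF closed_closure _ _ tend]) auto
      then show ?thesis by (simp add: vec_eq_iff)
    qed
    then show ?thesis by auto
  qed
qed

text \<open>
  Compactness of preimages gives the topological notion (closed map with compact fibres) because a Euclidean space is
  locally compact and Hausdorff.
\<close>

lemma compact_preimages_imp_proper_map:
  fixes f :: "'a::euclidean_space \<Rightarrow> 'b::euclidean_space"
  assumes "continuous_on UNIV f" "\<And>K. compact K \<Longrightarrow> compact (f -` K)"
  shows "proper_map euclidean euclidean f"
proof (rule compact_imp_proper_map)
  show "k_space (euclidean :: 'b topology)"
    by (intro locally_compact_imp_k_space locally_compact_space_euclidean)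
  show "kc_space (euclidean :: 'b topology)"
    by (intro Hausdorff_imp_kc_space Hausdorff_space_euclidean)
qed (use assms in \<open>auto simp: vimage_def\<close>)

text \<open>
  Local injectivity makes \<open>f\<close> open over \<open>D\<close>, by invariance of domain, and its fibres discrete; by properness they
  are finite. Small disjoint balls around the points of the fibre over \<open>a\<close> are mapped homeomorphically onto open sets, and as
  \<open>f\<close> is a closed map, a neighbourhood of \<open>a\<close> has no preimages outside these balls. Hence it is evenly covered, and the number
  of sheets is locally constant, so constant on the connected set \<open>D\<close>.
\<close>

lemma proper_locally_injective_covering:
  fixes f :: "'a::euclidean_space \<Rightarrow> 'a"
  assumes cont: "continuous_on UNIV f"
    and proper: "\<And>K. compact K \<Longrightarrow> compact (f -` K)"
    and D: "open D" "connected D" and ne: "f -` D \<noteq> {}"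
    and inj: "\<And>t. f t \<in> D \<Longrightarrow> \<exists>r>0. inj_on f (ball t r)"
  shows "covering_space (f -` D) f D \<and>
    (\<exists>N::nat. \<forall>a\<in>D. finite (f -` {a}) \<and> card (f -` {a}) = N)"
proof -
  have closed_map: "closed (f ` C)" if "closed C" for C
  proof -
    have "proper_map euclidean euclidean f"
      using compact_preimages_imp_proper_map[OF cont proper] .
    then show ?thesis using that by (auto simp: proper_map_def closed_map_def)
  qed
  have openA: "open (f -` D)" using D cont by (simp add: open_vimage)
  have local: "\<exists>V v. a \<in> V \<and> open V \<and> V \<subseteq> D \<and> \<Union>v = f -` V \<and> (\<forall>u\<in>v. open u) \<and> pairwise disjnt v
      \<and> (\<forall>u\<in>v. \<exists>q. homeomorphism u V f q)
      \<and> (\<forall>b\<in>V. finite (f -` {b}) \<and> card (f -` {b}) = card (f -` {a}))" if a: "a \<in> D" for a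
  proof -
    let ?F = "f -` {a}"
    have cF: "compact ?F" using proper by simp
    obtain r where r: "\<And>t. t \<in> ?F \<Longrightarrow> r t > 0 \<and> inj_on f (ball t (r t))"
      using inj a by (metis vimage_singleton_eq)
    have "?F \<subseteq> (\<Union>t\<in>?F. ball t (r t))" using r by fastforce
    then obtain T where T: "T \<subseteq> ?F" "finite T" "?F \<subseteq> (\<Union>t\<in>T. ball t (r t))"
      using compactE_image[OF cF, of ?F "\<lambda>t. ball t (r t)"] by auto
    \<comment> \<open>A ball on which \<open>f\<close> is injective contains at most one point of the fibre, so the centres of a finite subcover exhaust it.\<close>
    have "?F \<subseteq> T"
    proof
      fix s assume s: "s \<in> ?F"
      then obtain t where t: "t \<in> T" "s \<in> ball t (r t)" using T by blast
      then have "t \<in> ?F" using T by blast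
      then have "s = t" using r[of t] t s by (auto simp: inj_on_def)
      with t show "s \<in> T" by simp
    qed
    then have finF: "finite ?F" using T finite_subset by blast
    have "\<exists>e>0. \<forall>t\<in>?F. e \<le> r t \<and> ball t e \<subseteq> f -` D \<and> (\<forall>s\<in>?F. s \<noteq> t \<longrightarrow> 2 * e \<le> dist s t)"
    proof -
      have "\<exists>e>0. e \<le> r t \<and> ball t e \<subseteq> f -` D \<and> (\<forall>s\<in>?F. s \<noteq> t \<longrightarrow> 2 * e \<le> dist s t)" if t: "t \<in> ?F" for t
      proof -
        obtain d where d: "d > 0" "\<forall>s\<in>?F. s \<noteq> t \<longrightarrow> d \<le> dist t s"
          using finite_set_avoid[OF finF, of t] by blast
        obtain e where e: "e > 0" "ball t e \<subseteq> f -` D"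
          using openA t a by (metis open_contains_ball vimage_singleton_eq vimageI)
        show ?thesis
          by (rule exI[of _ "min (r t) (min e (d/2))"]) (use d e r[OF t] in \<open>auto simp: dist_commute\<close>)
      qed
      then obtain e where e: "\<And>t. t \<in> ?F \<Longrightarrow> e t > 0 \<and> e t \<le> r t \<and> ball t (e t) \<subseteq> f -` D \<and> (\<forall>s\<in>?F. s \<noteq> t \<longrightarrow> 2 * e t \<le> dist s t)"
        by metis
      define E where "E = Min (insert 1 (e ` ?F))"
      have "E > 0" unfolding E_def using finF e by (subst Min_gr_iff) auto
      moreover have "E \<le> e t" if "t \<in> ?F" for t unfolding E_def using finF that by (intro Min_le) auto
      ultimately show ?thesis using e
        by (intro exI[of _ E]) (smt (verit, best) subset_ball subset_trans)
    qed
    then obtain e where e: "e > 0" "\<And>t. t \<in> ?F \<Longrightarrow> e \<le> r t" "\<And>t. t \<in> ?F \<Longrightarrow> ball t e \<subseteq> f -` D"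
      "\<And>s t. t \<in> ?F \<Longrightarrow> s \<in> ?F \<Longrightarrow> s \<noteq> t \<Longrightarrow> 2 * e \<le> dist s t" by blast
    have inje: "inj_on f (ball t e)" if "t \<in> ?F" for t
      using r[OF that] e(2)[OF that] by (meson inj_on_subset subset_ball)
    \<comment> \<open>\<open>C\<close> is closed, as \<open>f\<close> is a closed map, and does not contain \<open>a\<close>;
      over its complement all preimages lie in the balls.\<close>
    define C where "C = f ` (- (\<Union>t\<in>?F. ball t e))"
    define V where "V = D \<inter> (\<Inter>t\<in>?F. f ` ball t e) \<inter> - C"
    have "closed C" unfolding C_def by (intro closed_map) auto
    moreover have "open (f ` ball t e)" if "t \<in> ?F" for t
      using inje[OF that] cont by (intro invariance_of_domain) (auto intro: continuous_on_subset)
    ultimately have openV: "open V" unfolding V_def using finF D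
      by (intro open_Int open_INT open_Compl) auto
    have aV: "a \<in> V" unfolding V_def C_def using a e(1) by force
    have VD: "V \<subseteq> D" by (auto simp: V_def)
    let ?u = "\<lambda>t. ball t e \<inter> f -` V"
    have img: "f ` ?u t = V" if "t \<in> ?F" for t using that unfolding V_def by blast
    have cov: "f -` V = (\<Union>t\<in>?F. ?u t)" unfolding V_def C_def by blast
    have disj: "?u s \<inter> ?u t = {}" if "s \<in> ?F" "t \<in> ?F" "s \<noteq> t" for s t
    proof -
      have "False" if "x \<in> ball s e" "x \<in> ball t e" for x
        using that e(4)[OF \<open>t \<in> ?F\<close> \<open>s \<in> ?F\<close> \<open>s \<noteq> t\<close>] dist_triangle2[of s t x] by (auto simp: dist_commute)
      then show ?thesis by blast
    qed
    have openu: "open (?u t)" for t using openV cont by (intro open_Int open_vimage) auto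
    have homeo: "\<exists>q. homeomorphism (?u t) V f q" if "t \<in> ?F" for t
    proof -
      have "inj_on f (?u t)" using inje[OF that] by (meson inf_le1 inj_on_subset)
      moreover have "continuous_on (?u t) f" using cont by (auto intro: continuous_on_subset)
      ultimately obtain q where "homeomorphism (?u t) (f ` ?u t) f q"
        using invariance_of_domain_homeomorphism[of "?u t" f] openu[of t] by auto
      then show ?thesis using img[OF that] by auto
    qed
    have cards: "finite (f -` {b}) \<and> card (f -` {b}) = card ?F" if b: "b \<in> V" for b
    proof -
      have "\<exists>s. s \<in> ?u t \<and> f s = b" if "t \<in> ?F" for t
      proof -
        have "b \<in> f ` ?u t" using img[OF that] b by simp
        then show ?thesis by (elim imageE) auto
      qed
      then have "\<exists>g. \<forall>t\<in>?F. g t \<in> ?u t \<and> f (g t) = b" by (intro bchoice) simp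
      then obtain g where "\<forall>t\<in>?F. g t \<in> ?u t \<and> f (g t) = b" ..
      then have g: "\<And>t. t \<in> ?F \<Longrightarrow> g t \<in> ?u t \<and> f (g t) = b" by (rule bspec)
      have "bij_betw g ?F (f -` {b})"
        unfolding bij_betw_def
      proof
        show "inj_on g ?F"
        proof (rule inj_onI, rule ccontr)
          fix s t assume "s \<in> ?F" "t \<in> ?F" "g s = g t" "s \<noteq> t"
          then show False using g[of s] g[of t] disj[of s t] by (metis disjoint_iff)
        qed
        show "g ` ?F = f -` {b}"
        proof
          show "f -` {b} \<subseteq> g ` ?F"
          proof
            fix s assume s: "s \<in> f -` {b}"
            then have "s \<in> (\<Union>t\<in>?F. ?u t)" using b cov by simp
            then obtain t where t: "t \<in> ?F" "s \<in> ?u t" by (elim UN_E)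
            then have "s = g t" using inje[OF t(1)] g[OF t(1)] s by (auto simp: inj_on_def)
            then show "s \<in> g ` ?F" using t by blast
          qed
        qed (use g in auto)
      qed
      then show ?thesis using finF bij_betw_same_card bij_betw_finite by metis
    qed
    have "pairwise disjnt (?u ` ?F)"
      unfolding pairwise_def disjnt_def using disj by (smt (verit) imageE)
    moreover have "\<forall>u\<in>?u ` ?F. open u" unfolding ball_simps using openu by (intro ballI)
    moreover have "\<forall>u\<in>?u ` ?F. \<exists>q. homeomorphism u V f q"
      unfolding ball_simps using homeo by (intro ballI)
    moreover have "\<Union>(?u ` ?F) = f -` V" using cov by simp
    moreover have "\<forall>b\<in>V. finite (f -` {b}) \<and> card (f -` {b}) = card (f -` {a})"
      using cards by (intro ballI)
    ultimately show ?thesis using aV openV VD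
      by - (rule exI[of _ V], rule exI[of _ "?u ` ?F"], intro conjI; assumption)
  qed
  have "\<exists>N. \<forall>a\<in>D. card (f -` {a}) = N"
  proof -
    have "(\<lambda>a. card (f -` {a})) constant_on D"
    proof (rule locally_constant_imp_constant[OF D(2)])
      fix a assume "a \<in> D"
      show "\<exists>T. openin (top_of_set D) T \<and> a \<in> T \<and> (\<forall>x\<in>T. card (f -` {x}) = card (f -` {a}))"
        using local[OF \<open>a \<in> D\<close>]
      proof (elim exE conjE)
        fix V assume V: "a \<in> V" "open V" "V \<subseteq> D"
          "\<forall>b\<in>V. finite (f -` {b}) \<and> card (f -` {b}) = card (f -` {a})"
        have "openin (top_of_set D) V" using V D(1) by (simp add: openin_open_eq)
        then show ?thesis using V by blast
      qed
    qed
    then show ?thesis by (auto simp: constant_on_def)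
  qed
  then obtain N where N: "\<And>a. a \<in> D \<Longrightarrow> card (f -` {a}) = N" by blast
  have fin: "finite (f -` {a})" if "a \<in> D" for a
    using local[OF that] by (elim exE conjE ballE[of _ _ a]) simp_all
  have surj: "f ` (f -` D) = D"
  proof -
    obtain t where t: "f t \<in> D" using ne by auto
    then have "card (f -` {f t}) > 0" using fin[OF t] by (auto simp: card_gt_0_iff)
    then have "card (f -` {a}) > 0" if "a \<in> D" for a using N[OF that] N[OF t] by simp
    then have "f -` {a} \<noteq> {}" if "a \<in> D" for a using that by (metis card.empty less_numeral_extra(3))
    then show ?thesis by auto
  qed
  have "covering_space (f -` D) f D"
  proof (rule covering_spaceI)
    show "continuous_on (f -` D) f" using cont continuous_on_subset by blast
    show "f ` (f -` D) = D" by (rule surj)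
    fix a assume "a \<in> D"
    show "\<exists>T. a \<in> T \<and> openin (top_of_set D) T \<and> (\<exists>v. \<Union>v = f -` D \<inter> f -` T \<and>
       (\<forall>u\<in>v. openin (top_of_set (f -` D)) u) \<and> pairwise disjnt v \<and> (\<forall>u\<in>v. \<exists>q. homeomorphism u T f q))"
      using local[OF \<open>a \<in> D\<close>]
    proof (elim exE conjE)
      fix V v assume V: "a \<in> V" "open V" "V \<subseteq> D" "\<Union>v = f -` V" "\<forall>u\<in>v. open u"
        "pairwise disjnt v" "\<forall>u\<in>v. \<exists>q. homeomorphism u V f q"
      have "openin (top_of_set D) V" using V D(1) by (simp add: openin_open_eq)
      moreover have VD: "f -` V \<subseteq> f -` D" using V(3) by auto
      moreover have "\<forall>u\<in>v. openin (top_of_set (f -` D)) u"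
      proof
        fix u assume "u \<in> v"
        then have "u \<subseteq> f -` V" using V(4) by (metis Union_upper)
        then show "openin (top_of_set (f -` D)) u"
          using VD V(5) \<open>u \<in> v\<close> openA by (simp add: openin_open_eq)
      qed
      moreover have "\<Union>v = f -` D \<inter> f -` V" using V(4) VD by (simp add: Int_absorb1)
      ultimately show ?thesis using V by (intro exI[of _ V] conjI exI[of _ v])
    qed
  qed
  then show ?thesis using N fin by blast
qed

section \<open>Polynomials in a matrix, and common eigenvectors\<close>

definition matpoly :: "complex poly \<Rightarrow> complex^'n^'n \<Rightarrow> complex^'n^'n" where
  "matpoly p W = foldr (\<lambda>a M. mat a + W ** M) (coeffs p) 0"

lemma matpoly_0 [simp]: "matpoly 0 W = 0"
  by (simp add: matpoly_def)

lemma matrix_mult_add_left: "(A + B) ** C = A ** C + B ** (C :: complex^'n^'n)"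
  by (simp add: matrix_matrix_mult_def vec_eq_iff distrib_right sum.distrib)

lemma matpoly_pCons [simp]: "matpoly (pCons a p) W = mat a + W ** matpoly p W"
proof (cases "a = 0 \<and> p = 0")
  case True
  then show ?thesis by simp
next
  case False
  then have "coeffs (pCons a p) = a # coeffs p" by (auto simp: cCons_def)
  then show ?thesis by (simp only: matpoly_def foldr.simps o_apply)
qed

lemma mat_mult_vec: "mat a *v (v :: complex^'n) = a *s v"
proof -
  have "mat a $ i $ k * v $ k = (if k = i then a * v $ k else 0)" for i k
    by (simp add: mat_def)
  then show ?thesis by (simp add: matrix_vector_mult_def vec_eq_iff)
qed

lemma mat_mult_left: "(mat a ** A) $ i $ j = a * (A :: complex^'n^'n) $ i $ j"
proof -
  have "mat a $ i $ k * A $ k $ j = (if k = i then a * A $ k $ j else 0)" for k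
    by (simp add: mat_def)
  then show ?thesis by (simp add: matrix_matrix_mult_def)
qed

lemma mat_mult_right: "(A ** mat a) $ i $ j = a * (A :: complex^'n^'n) $ i $ j"
proof -
  have "A $ i $ k * mat a $ k $ j = (if k = j then a * A $ i $ k else 0)" for k
    by (simp add: mat_def)
  then show ?thesis by (simp add: matrix_matrix_mult_def)
qed

lemma mat_commute: "A ** mat a = mat a ** (A :: complex^'n^'n)"
  by (simp add: vec_eq_iff mat_mult_left mat_mult_right)

lemma matpoly_add:
  fixes W :: "complex^'n^'n"
  shows "matpoly (p + q) W = matpoly p W + matpoly q W"
proof (induction p q rule: poly_induct2)
  case (pCons a p b q)
  have "mat (a + b) = mat a + (mat b :: complex^'n^'n)" by (simp add: mat_def vec_eq_iff)
  moreover have "matpoly (pCons a p + pCons b q) W = mat (a + b) + W ** matpoly (p + q) W"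
    unfolding add_pCons by (rule matpoly_pCons)
  ultimately show ?case using pCons.IH by (simp add: matrix_add_ldistrib add_ac)
qed simp

lemma matpoly_smult:
  fixes W :: "complex^'n^'n"
  shows "matpoly (smult c p) W = mat c ** matpoly p W"
proof (induction p)
  case (pCons a p)
  have "mat (c * a) = mat c ** (mat a :: complex^'n^'n)"
    unfolding vec_eq_iff mat_mult_left by (simp add: mat_def)
  moreover have "W ** (mat c ** matpoly p W) = mat c ** (W ** matpoly p W)"
  proof -
    have "W ** (mat c ** matpoly p W) = (W ** mat c) ** matpoly p W" by (rule matrix_mul_assoc)
    also have "\<dots> = mat c ** (W ** matpoly p W)" unfolding mat_commute by (rule matrix_mul_assoc[symmetric])
    finally show ?thesis .
  qed
  ultimately show ?case using pCons by (simp add: matrix_add_ldistrib)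
qed simp

lemma matpoly_commute:
  fixes W :: "complex^'n^'n"
  assumes "A ** W = W ** A"
  shows "A ** matpoly p W = matpoly p W ** A"
proof (induction p)
  case (pCons a p)
  have "A ** (W ** matpoly p W) = (W ** matpoly p W) ** A"
    using pCons.IH assms by (simp only: matrix_mul_assoc) (simp only: matrix_mul_assoc[symmetric])
  then show ?case by (simp add: matrix_add_ldistrib matrix_mult_add_left mat_commute)
qed simp

lemma matpoly_eigen:
  fixes W :: "complex^'n^'n"
  assumes "W *v v = w *s v"
  shows "matpoly p W *v v = poly p w *s v"
proof (induction p)
  case (pCons a p)
  then have "matpoly (pCons a p) W *v v = a *s v + W *v (poly p w *s v)"
    by (simp add: matrix_vector_mult_add_rdistrib mat_mult_vec flip: matrix_vector_mul_assoc)
  also have "W *v (poly p w *s v) = poly p w *s (w *s v)"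
    using assms by (metis vector_scalar_commute)
  finally show ?case by (simp add: vec_eq_iff algebra_simps)
qed (simp add: vec_eq_iff)

lemma poly_eq_pCons_shift: "p = pCons (coeff p 0) (poly_shift 1 p)"
  by (rule poly_eqI) (auto simp: coeff_pCons coeff_poly_shift split: nat.splits)

text \<open>
  The bound \<open>N\<close> on the degree is uniform in the parameters, so that the same number of Horner steps evaluates the polynomial
  at every parameter, even where its leading coefficient vanishes.
\<close>

lemma polyfun_matpoly:
  fixes W :: "_ \<Rightarrow> complex^'n^'n"
  assumes "polyfun_coeffs n P" "\<And>i j. polyfun n (\<lambda>l. W l $ i $ j)" "\<And>l. degree (P l) \<le> N"
  shows "polyfun n (\<lambda>l. matpoly (P l) (W l) $ i $ j)"
  using assms(1,3)
proof (induction N arbitrary: P i j)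
  case 0
  have entry: "matpoly [:a:] M $ i $ j = (if i = j then a else 0)" for a and M :: "complex^'n^'n"
    by (simp add: mat_def)
  have "P l = [:coeff (P l) 0:]" for l using 0(2)[of l] by (metis degree_eq_zeroE coeff_pCons_0 le_zero_eq)
  then have "matpoly (P l) (W l) $ i $ j = (if i = j then coeff (P l) 0 else 0)" for l
    by (metis (no_types, lifting) entry)
  then show ?case using 0 by (auto simp: polyfun_coeffs_def)
next
  case (Suc N)
  have eq: "matpoly (P l) (W l) $ i $ j = (if i = j then coeff (P l) 0 else 0)
      + (\<Sum>k\<in>UNIV. W l $ i $ k * matpoly (poly_shift 1 (P l)) (W l) $ k $ j)" for l
    by (subst poly_eq_pCons_shift) (simp add: mat_def matrix_matrix_mult_def)
  have deg: "degree (poly_shift 1 (P l)) \<le> N" for l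
    using Suc.prems(2)[of l] by (intro degree_le) (auto simp: coeff_poly_shift intro!: coeff_eq_0)
  have "polyfun_coeffs n (\<lambda>l. poly_shift 1 (P l))"
    using Suc.prems(1) by (simp add: polyfun_coeffs_def coeff_poly_shift)
  note IH = Suc.IH[OF this deg]
  show ?case unfolding eq
    using Suc.prems(1) by (intro polyfun.add polyfun_sum polyfun.mult polyfun_if assms(2) IH polyfun.const)
      (auto simp: polyfun_coeffs_def)
qed

text \<open>
  The vectors \<open>W\<^sup>i u\<close> with \<open>i\<close> up to the dimension are too many to be linearly independent.
\<close>

lemma matpoly_annihilates:
  fixes W :: "complex^'n^'n"
  shows "\<exists>p. p \<noteq> 0 \<and> matpoly p W *v u = 0"
proof -
  let ?g = "\<lambda>i. matpoly (monom 1 i) W *v u"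
  let ?N = "DIM(complex^'n)"
  have diff: "matpoly (p - q) W *v u = matpoly p W *v u - matpoly q W *v u" for p q
    by (metis matpoly_add diff_add_cancel add_diff_cancel_right' matrix_vector_mult_add_rdistrib)
  show ?thesis
  proof (cases "inj_on ?g {..?N}")
    case False
    then obtain i j where ij: "i \<noteq> j" "?g i = ?g j" by (auto simp: inj_on_def)
    then have "monom 1 i - monom 1 j \<noteq> (0 :: complex poly)" by (simp add: monom_eq_iff')
    then show ?thesis using diff ij by (metis diff_self)
  next
    case True
    then have "card (?g ` {..?N}) = Suc ?N" by (simp add: card_image)
    then have "dependent (?g ` {..?N})" by (intro dependent_biggerset) auto
    then obtain c where c: "\<exists>v\<in>?g ` {..?N}. c v \<noteq> 0" "(\<Sum>v\<in>?g ` {..?N}. c v *\<^sub>R v) = 0"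
      by (auto simp: dependent_finite)
    define p where "p = (\<Sum>i\<le>?N. monom (complex_of_real (c (?g i))) i)"
    have "p \<noteq> 0"
    proof -
      obtain i where i: "i \<le> ?N" "c (?g i) \<noteq> 0" using c(1) by auto
      have "coeff p i = c (?g i)" unfolding p_def coeff_sum using i
        by (subst sum.remove[of _ i]) (auto intro!: sum.neutral)
      with i show ?thesis by auto
    qed
    moreover have "matpoly p W *v u = 0"
    proof -
      have "matpoly (\<Sum>i\<in>A. f i) W *v u = (\<Sum>i\<in>A. matpoly (f i) W *v u)" if "finite A" for A :: "nat set" and f
        using that by (induction A rule: finite_induct)
          (auto simp: matpoly_add matrix_vector_mult_add_rdistrib)
      then have "matpoly p W *v u = (\<Sum>i\<le>?N. matpoly (monom (complex_of_real (c (?g i))) i) W *v u)"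
        unfolding p_def by simp
      also have "\<dots> = (\<Sum>i\<le>?N. c (?g i) *\<^sub>R ?g i)"
      proof (intro sum.cong refl)
        fix i
        have "matpoly (monom (complex_of_real r) i) W *v u = r *\<^sub>R ?g i" for r
        proof -
          have "monom (complex_of_real r) i = smult r (monom 1 i)" by (simp add: smult_monom)
          then have "matpoly (monom (complex_of_real r) i) W *v u = complex_of_real r *s ?g i"
            by (simp add: matpoly_smult mat_mult_vec flip: matrix_vector_mul_assoc)
          also have "\<dots> = r *\<^sub>R ?g i" by (simp add: vec_eq_iff) (simp add: scaleR_conv_of_real)
          finally show ?thesis .
        qed
        then show "matpoly (monom (complex_of_real (c (?g i))) i) W *v u = c (?g i) *\<^sub>R ?g i" .
      qed
      also have "\<dots> = (\<Sum>v\<in>?g ` {..?N}. c v *\<^sub>R v)" using True by (simp add: sum.reindex)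
      finally show ?thesis using c(2) by simp
    qed
    ultimately show ?thesis by blast
  qed
qed

text \<open>
  \<open>S\<close> plays the role of a subspace that is mapped into itself by \<open>W - w\<close> for all numbers \<open>w\<close>. A polynomial that annihilates \<open>u\<close> splits into linear factors;
  applying them to \<open>u\<close> one after the other, all vectors stay in \<open>S\<close>, and the last non-zero one is an eigenvector.
\<close>

lemma eigenvector_in_invariant_subspace:
  fixes W :: "complex^'n^'n"
  assumes u: "S u" "u \<noteq> 0" and inv: "\<And>v w. S v \<Longrightarrow> S (W *v v - w *s v)"
  shows "\<exists>v w. S v \<and> v \<noteq> 0 \<and> W *v v = w *s v"
proof -
  have "\<exists>v w. S v \<and> v \<noteq> 0 \<and> W *v v = w *s v"
    if "p \<noteq> 0" "matpoly p W *v u = 0" "S u" "u \<noteq> 0" for p u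
    using that
  proof (induction "degree p" arbitrary: p u)
    case 0
    then obtain a where "p = [:a:]" "a \<noteq> 0" by (metis degree_eq_zeroE pCons_0_0)
    with 0 show ?case by (auto simp: mat_mult_vec vec_eq_iff)
  next
    case (Suc k)
    then obtain w where "poly p w = 0" using alg_closed_imp_poly_has_root[of p] by auto
    then obtain q where q: "p = [:-w, 1:] * q" by (auto simp: poly_eq_0_iff_dvd)
    have q0: "q \<noteq> 0" using q Suc.prems by auto
    then have "degree p = Suc (degree q)" unfolding q by (subst degree_mult_eq) auto
    then have dq: "degree q = k" using Suc by simp
    let ?v = "W *v u - w *s u"
    have "matpoly q W *v ?v = matpoly p W *v u"
    proof -
      have "p = pCons 0 q + smult (-w) q" unfolding q by simp
      then have "matpoly p W = W ** matpoly q W + mat (-w) ** matpoly q W"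
        by (simp only: matpoly_add matpoly_smult matpoly_pCons mat_0 add_0)
      also have "\<dots> = matpoly q W ** W + matpoly q W ** mat (-w)"
        by (simp only: matpoly_commute[OF refl, of W q] mat_commute[of "matpoly q W" "-w"])
      also have "\<dots> *v u = matpoly q W *v (W *v u) + matpoly q W *v ((-w) *s u)"
        by (simp only: matrix_vector_mult_add_rdistrib mat_mult_vec matrix_vector_mul_assoc[symmetric])
      also have "\<dots> = matpoly q W *v (W *v u + (-w) *s u)"
        by (simp only: matrix_vector_right_distrib)
      also have "W *v u + (-w) *s u = ?v" by (simp add: vec_eq_iff)
      finally show ?thesis ..
    qed
    then have "matpoly q W *v ?v = 0" using Suc.prems by simp
    then show ?case
      using Suc.hyps(1)[of q ?v] dq q0 inv[OF Suc.prems(3), of w] Suc.prems by (cases "?v = 0") auto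
  qed
  with matpoly_annihilates[of W u] u show ?thesis by blast
qed

section \<open>Vectors and matrices with numbered coordinates\<close>

text \<open>
  The function \<open>ix\<close> numbers the coordinates from \<open>0\<close>; \<open>vector_of\<close> and \<open>matrix_of\<close> turn entries given by such numbers into vectors
  and matrices over the index type.
\<close>

definition vector_of :: "(nat \<Rightarrow> 'n::finite) \<Rightarrow> (nat \<Rightarrow> complex) \<Rightarrow> complex^'n" where
  "vector_of ix b = (\<chi> i. b (inv_into {..<CARD('n)} ix i))"

definition matrix_of :: "(nat \<Rightarrow> 'n::finite) \<Rightarrow> (nat \<Rightarrow> nat \<Rightarrow> complex) \<Rightarrow> complex^'n^'n" where
  "matrix_of ix A = (\<chi> i j. A (inv_into {..<CARD('n)} ix i) (inv_into {..<CARD('n)} ix j))"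

locale numbering =
  fixes ix :: "nat \<Rightarrow> 'n::finite" and n :: nat
  assumes bij: "bij_betw ix {..<n} UNIV"
begin

lemma card_n: "CARD('n) = n"
  using bij_betw_same_card[OF bij] by simp

lemma inv_ix: "i < n \<Longrightarrow> inv_into {..<CARD('n)} ix (ix i) = i"
  unfolding card_n using bij by (simp add: bij_betw_inv_into_left)

lemma ix_cases: obtains i where "i < n" "j = ix i"
  using bij by (metis bij_betw_imp_surj_on imageE lessThan_iff UNIV_I)

lemma all_ix: "(\<forall>j. P j) \<longleftrightarrow> (\<forall>i<n. P (ix i))"
  by (metis ix_cases)

lemma sum_ix: "(\<Sum>j\<in>UNIV. f j) = (\<Sum>i<n. f (ix i))"
  using sum.reindex_bij_betw[OF bij, of f] by simp

lemma vector_of_nth [simp]: "i < n \<Longrightarrow> vector_of ix b $ ix i = b i"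
  by (simp add: vector_of_def inv_ix)

lemma matrix_of_nth [simp]: "i < n \<Longrightarrow> j < n \<Longrightarrow> matrix_of ix A $ ix i $ ix j = A i j"
  by (simp add: matrix_of_def inv_ix)

lemma vector_of_eq_iff: "u = vector_of ix b \<longleftrightarrow> (\<forall>i<n. u $ ix i = b i)"
  by (simp add: vec_eq_iff all_ix)

lemma matrix_of_mult_vec:
  "matrix_of ix A *v u = vector_of ix (\<lambda>i. \<Sum>j<n. A i j * u $ ix j)"
  by (simp add: vector_of_eq_iff matrix_vector_mult_def sum_ix)

lemma matrix_of_commute:
  assumes "\<And>i j. i < n \<Longrightarrow> j < n \<Longrightarrow> (\<Sum>k<n. A i k * B k j) = (\<Sum>k<n. B i k * A k j)"
  shows "matrix_of ix A ** matrix_of ix B = matrix_of ix B ** matrix_of ix A"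
  using assms by (simp add: vec_eq_iff all_ix matrix_matrix_mult_def sum_ix)

lemma polyfun_matrix_of:
  assumes "\<And>i j. i < n \<Longrightarrow> j < n \<Longrightarrow> polyfun m (\<lambda>l. A l i j)"
  shows "polyfun m (\<lambda>l. matrix_of ix (A l) $ i $ j)"
proof -
  obtain a b where "a < n" "i = ix a" "b < n" "j = ix b" using ix_cases by metis
  with assms show ?thesis by simp
qed

end

section \<open>The discriminant of a monic polynomial\<close>

text \<open>
  Applying \<open>T - c a\<close> to a linear relation removes the vector \<open>b a\<close> and multiplies the other coefficients by non-zero numbers.
\<close>

lemma eigenvectors_independent:
  fixes b :: "'i \<Rightarrow> complex^'n"
  assumes "finite A" "\<And>i. i \<in> A \<Longrightarrow> T *v b i = c i *s b i" "inj_on c A"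
    "\<And>i. i \<in> A \<Longrightarrow> b i \<noteq> 0" "(\<Sum>i\<in>A. k i *s b i) = 0"
  shows "\<forall>i\<in>A. k i = 0"
  using assms
proof (induction A arbitrary: k rule: finite_induct)
  case (insert a A)
  have "(\<Sum>i\<in>insert a A. (k i * (c i - c a)) *s b i) = T *v (\<Sum>i\<in>insert a A. k i *s b i) - c a *s (\<Sum>i\<in>insert a A. k i *s b i)"
  proof -
    have "T *v (\<Sum>i\<in>insert a A. k i *s b i) = (\<Sum>i\<in>insert a A. k i *s (c i *s b i))"
      unfolding vec.sum using insert.prems(1) by (intro sum.cong refl) (simp add: vector_scalar_commute)
    then show ?thesis
      by (simp add: vec.scale_sum_right sum_subtractf[symmetric] vec_eq_iff algebra_simps)
  qed
  then have "(\<Sum>i\<in>A. (k i * (c i - c a)) *s b i) = 0"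
    using insert by (simp add: matrix_vector_mult_0_right)
  then have "\<forall>i\<in>A. k i * (c i - c a) = 0"
    using insert.IH[of "\<lambda>i. k i * (c i - c a)"] insert.prems by (auto simp: inj_on_def)
  moreover have "c i \<noteq> c a" if "i \<in> A" for i using insert.prems(2) insert.hyps that by (auto simp: inj_on_def)
  ultimately have kA: "\<forall>i\<in>A. k i = 0" by auto
  then have "k a *s b a = 0" using insert by simp
  then have "k a = 0" using insert.prems(3)[of a] by (auto simp: vec_eq_iff)
  with kA show ?case by simp
qed simp

definition monic_of :: "nat \<Rightarrow> (nat \<Rightarrow> complex) \<Rightarrow> complex poly" where
  "monic_of n a = monom 1 n + (\<Sum>i<n. monom (a i) i)"

lemma coeff_monic_of: "coeff (monic_of n a) i = (if i < n then a i else if i = n then 1 else 0)"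
proof -
  have "coeff (\<Sum>i<n. monom (a i) i) i = (if i < n then a i else 0)"
    by (simp add: coeff_sum)
  then show ?thesis by (auto simp: monic_of_def)
qed

lemma degree_monic_of: "degree (monic_of n a) = n" and lead_coeff_monic_of: "lead_coeff (monic_of n a) = 1"
proof -
  show "degree (monic_of n a) = n"
    by (rule antisym) (auto intro!: degree_le le_degree simp: coeff_monic_of)
  then show "lead_coeff (monic_of n a) = 1" by (simp add: coeff_monic_of)
qed

lemma monic_of_coeffs: "degree p = n \<Longrightarrow> lead_coeff p = 1 \<Longrightarrow> monic_of n (coeff p) = p"
  by (auto simp: poly_eq_iff coeff_monic_of coeff_eq_0)

lemma poly_monic_of: "poly (monic_of n a) x = x ^ n + (\<Sum>i<n. a i * x ^ i)"
  by (simp add: monic_of_def poly_monom poly_sum)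

lemma sum_order_roots:
  assumes "p \<noteq> (0 :: complex poly)"
  shows "(\<Sum>x | poly p x = 0. order x p) = degree p"
proof -
  have "degree p = size (proots p)" by (simp add: size_proots_complex)
  also have "\<dots> = (\<Sum>x\<in>set_mset (proots p). count (proots p) x)" by (simp add: size_multiset_overloaded_eq)
  finally show ?thesis using assms by simp
qed

text \<open>
  The degree is the sum of the multiplicities of the roots, and each of them is at least one.
\<close>

lemma card_roots_eq_degree_iff:
  fixes p :: "complex poly"
  assumes "p \<noteq> 0"
  shows "card {x. poly p x = 0} = degree p \<longleftrightarrow> (\<forall>x. poly p x = 0 \<longrightarrow> order x p = 1)"
proof -
  have fin: "finite {x. poly p x = 0}" using assms by (rule poly_roots_finite)
  note deg = sum_order_roots[OF assms, symmetric]
  have pos: "order x p \<ge> 1" if "poly p x = 0" for x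
    using that assms by (simp add: order_root Suc_le_eq)
  show ?thesis
  proof
    assume "card {x. poly p x = 0} = degree p"
    then have "(\<Sum>x | poly p x = 0. 1) = (\<Sum>x | poly p x = 0. order x p)" using deg by simp
    then have "(\<Sum>x | poly p x = 0. order x p - 1) = 0"
      using pos by (subst sum_subtractf_nat) auto
    then show "\<forall>x. poly p x = 0 \<longrightarrow> order x p = 1" using fin pos by (fastforce simp: le_antisym)
  next
    assume "\<forall>x. poly p x = 0 \<longrightarrow> order x p = 1"
    then show "card {x. poly p x = 0} = degree p" using deg by simp
  qed
qed

lemma card_roots_eq_degree_iff_pderiv:
  fixes p :: "complex poly"
  assumes "p \<noteq> 0"
  shows "card {x. poly p x = 0} = degree p \<longleftrightarrow> (\<forall>x. \<not> (poly p x = 0 \<and> poly (pderiv p) x = 0))"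
proof -
  have "(order x p = 0 \<or> order x p = 1) \<longleftrightarrow> (poly p x = 0 \<longrightarrow> order x p = 1)" for x
    using assms order_root[of p x] by auto
  then show ?thesis
    unfolding card_roots_eq_degree_iff[OF assms] rsquarefree_roots[symmetric] rsquarefree_def
    using assms by simp
qed

text \<open>
  Row \<open>i\<close> expresses \<open>x * x ^ i\<close> in the basis \<open>1, x, \<dots>, x ^ (n - 1)\<close> modulo the monic polynomial with lower coefficients \<open>a\<close>.
  With this orientation the eigenvectors are the columns of powers of the roots.
\<close>

definition companion :: "nat \<Rightarrow> (nat \<Rightarrow> complex) \<Rightarrow> nat \<Rightarrow> nat \<Rightarrow> complex" where
  "companion n a i j = (if Suc i < n then (if j = Suc i then 1 else 0) else - a j)"

context numbering begin

lemma n_pos: "n > 0"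
proof -
  obtain i where "i < n" by (rule ix_cases)
  then show ?thesis by simp
qed

lemma companion_eigen:
  assumes "poly (monic_of n a) x = 0"
  shows "matrix_of ix (companion n a) *v vector_of ix (\<lambda>i. x ^ i) = x *s vector_of ix (\<lambda>i. x ^ i)"
proof -
  have "(\<Sum>j<n. companion n a i j * x ^ j) = x * x ^ i" if "i < n" for i
  proof (cases "Suc i < n")
    case True
    then have "(\<Sum>j<n. companion n a i j * x ^ j) = (\<Sum>j<n. if j = Suc i then x ^ Suc i else 0)"
      by (intro sum.cong) (auto simp: companion_def)
    then show ?thesis using True by simp
  next
    case False
    then have "n = Suc i" using that by simp
    have "(\<Sum>j<n. companion n a i j * x ^ j) = - (\<Sum>j<n. a j * x ^ j)"
      using False by (simp add: companion_def sum_negf)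
    also have "\<dots> = x ^ n" using assms by (simp add: poly_monic_of add_eq_0_iff2)
    finally show ?thesis using \<open>n = Suc i\<close> by simp
  qed
  then show ?thesis by (simp add: matrix_of_mult_vec vec_eq_iff all_ix)
qed

lemma companion_eigenD:
  assumes eig: "matrix_of ix (companion n a) *v u = x *s u" and "u \<noteq> 0"
  shows "poly (monic_of n a) x = 0" "\<And>i. i < n \<Longrightarrow> u $ ix i = u $ ix 0 * x ^ i"
proof -
  have row: "(\<Sum>j<n. companion n a i j * u $ ix j) = x * u $ ix i" if "i < n" for i
    using arg_cong[OF eig, of "\<lambda>v. v $ ix i"] that by (simp add: matrix_of_mult_vec)
  show ui: "u $ ix i = u $ ix 0 * x ^ i" if "i < n" for i
    using that
  proof (induction i)
    case (Suc i)
    have "x * u $ ix i = (\<Sum>j<n. if j = Suc i then u $ ix j else 0)"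
      unfolding row[OF Suc_lessD[OF Suc.prems], symmetric] using Suc.prems
      by (intro sum.cong) (auto simp: companion_def)
    then show ?case using Suc by (simp add: mult_ac)
  qed simp
  obtain m where m: "n = Suc m" using n_pos gr0_conv_Suc by auto
  have u0: "u $ ix 0 \<noteq> 0"
  proof
    assume "u $ ix 0 = 0"
    then have "u $ ix i = 0" if "i < n" for i using ui[OF that] by simp
    then show False using \<open>u \<noteq> 0\<close> by (simp add: vec_eq_iff all_ix)
  qed
  have "- (\<Sum>j<n. a j * x ^ j) * u $ ix 0 = (\<Sum>j<n. - a j * u $ ix j)"
    unfolding sum_negf[symmetric] sum_distrib_right using ui
    by (intro sum.cong refl) (metis lessThan_iff mult.assoc mult.commute mult_minus_left)
  also have "\<dots> = x * u $ ix m" using row[of m] m by (simp add: companion_def)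
  also have "u $ ix m = u $ ix 0 * x ^ m" using ui[of m] m by blast
  also have "x * (u $ ix 0 * x ^ m) = x ^ n * u $ ix 0" using m by simp
  finally have "- (\<Sum>j<n. a j * x ^ j) * u $ ix 0 = x ^ n * u $ ix 0" .
  then have "- (\<Sum>j<n. a j * x ^ j) = x ^ n" using u0 by (simp only: mult_right_cancel[OF u0])
  then show "poly (monic_of n a) x = 0" by (simp add: poly_monic_of add_eq_0_iff2)
qed

text \<open>
  The determinant is the product of the values of the derivative at the roots, the usual discriminant up to sign; the factor
  \<open>a 0\<close> is the value of the polynomial at zero.
\<close>

definition discr :: "(nat \<Rightarrow> complex) \<Rightarrow> complex" where
  "discr a = det (matpoly (pderiv (monic_of n a)) (matrix_of ix (companion n a))) * a 0"

lemma polyfun_discr: "polyfun n discr"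
proof -
  have mono: "polyfun n (\<lambda>a. coeff (monic_of n a) i)" for i
    by (auto simp: coeff_monic_of if_distrib intro!: polyfun_if)
  show ?thesis
    unfolding discr_def
    by (intro polyfun.mult polyfun_det polyfun_matpoly[where N = n] polyfun.coord n_pos polyfun_matrix_of)
      (auto simp: polyfun_coeffs_def coeff_pderiv companion_def degree_pderiv degree_monic_of
        intro!: mono polyfun.mult polyfun_if)
qed

text \<open>
  If \<open>p'(C)\<close> is singular, its kernel is mapped to itself by the companion matrix \<open>C\<close> and so contains an eigenvector of \<open>C\<close>. The
  eigenvalue is then a root both of \<open>p\<close> and of \<open>p'\<close>. Conversely, the vector of powers of a common root lies in the kernel.
\<close>

lemma discr_nonzero_iff:
  "discr a \<noteq> 0 \<longleftrightarrow> card {c. poly (monic_of n a) c = 0} = n \<and> poly (monic_of n a) 0 \<noteq> 0"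
proof -
  let ?p = "monic_of n a" and ?C = "matrix_of ix (companion n a)"
  have p0: "?p \<noteq> 0" using lead_coeff_monic_of[of n a] by auto
  have "det (matpoly (pderiv ?p) ?C) = 0 \<longleftrightarrow> (\<exists>u. u \<noteq> 0 \<and> matpoly (pderiv ?p) ?C *v u = 0)"
    using invertible_det_nz matrix_left_invertible_ker invertible_left_inverse by metis
  also have "\<dots> \<longleftrightarrow> (\<exists>x. poly ?p x = 0 \<and> poly (pderiv ?p) x = 0)"
  proof
    assume "\<exists>u. u \<noteq> 0 \<and> matpoly (pderiv ?p) ?C *v u = 0"
    then obtain u where u: "matpoly (pderiv ?p) ?C *v u = 0" "u \<noteq> 0" by blast
    have "matpoly (pderiv ?p) ?C *v (?C *v v - w *s v) = 0" if "matpoly (pderiv ?p) ?C *v v = 0" for v w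
    proof -
      have "matpoly (pderiv ?p) ?C *v (?C *v v) = ?C *v (matpoly (pderiv ?p) ?C *v v)"
        by (simp only: matrix_vector_mul_assoc matpoly_commute[OF refl])
      then show ?thesis using that
        by (simp add: vec.diff vector_scalar_commute)
    qed
    then obtain v w where v: "matpoly (pderiv ?p) ?C *v v = 0" "v \<noteq> 0" "?C *v v = w *s v"
      using eigenvector_in_invariant_subspace[of "\<lambda>v. matpoly (pderiv ?p) ?C *v v = 0" u ?C] u by blast
    then have "poly (pderiv ?p) w *s v = 0" using matpoly_eigen[OF v(3), of "pderiv ?p"] by simp
    then have "poly (pderiv ?p) w = 0" using v(2) by (auto simp: vec_eq_iff)
    then show "\<exists>x. poly ?p x = 0 \<and> poly (pderiv ?p) x = 0" using companion_eigenD(1)[OF v(3,2)] by blast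
  next
    assume "\<exists>x. poly ?p x = 0 \<and> poly (pderiv ?p) x = 0"
    then obtain x where x: "poly ?p x = 0" "poly (pderiv ?p) x = 0" by blast
    let ?b = "vector_of ix (\<lambda>i. x ^ i)"
    have "matpoly (pderiv ?p) ?C *v ?b = 0"
      using matpoly_eigen[OF companion_eigen[OF x(1)], of "pderiv ?p"] x(2) by simp
    moreover have "?b $ ix 0 = 1" using n_pos by simp
    then have "?b \<noteq> 0" by (metis zero_index zero_neq_one)
    ultimately show "\<exists>u. u \<noteq> 0 \<and> matpoly (pderiv ?p) ?C *v u = 0" by blast
  qed
  finally have "det (matpoly (pderiv ?p) ?C) \<noteq> 0 \<longleftrightarrow> card {c. poly ?p c = 0} = n"
    using card_roots_eq_degree_iff_pderiv[OF p0] by (simp add: degree_monic_of)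
  moreover have "poly ?p 0 = a 0"
    using n_pos coeff_monic_of[of n a 0] by (simp add: poly_0_coeff_0)
  ultimately show ?thesis by (simp add: discr_def)
qed

end

section \<open>Families whose critical values are the roots of a polynomial\<close>

text \<open>
  The lower coefficients of a monic polynomial are symmetric functions of positive degree in its roots, so they tend to zero
  with the roots.
\<close>

lemma small_roots_small_coeffs:
  fixes A :: "complex multiset"
  assumes "\<And>r. r \<in># A \<Longrightarrow> norm r \<le> \<delta>" "0 \<le> \<delta>" "\<delta> \<le> 1"
  shows "norm (coeff (\<Prod>r\<in>#A. [:-r, 1:]) i) \<le> (if i < size A then \<delta> else 1) * 2 ^ size A"
  using assms(1)
proof (induction A arbitrary: i)
  case empty
  show ?case by (cases i) (auto simp: coeff_eq_0)
next
  case (add r A)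
  let ?q = "\<Prod>r\<in>#A. [:-r, 1:]"
  have IH: "norm (coeff ?q j) \<le> (if j < size A then \<delta> else 1) * 2 ^ size A" for j
    using add by simp
  have IH1: "norm (coeff ?q j) \<le> 2 ^ size A" for j
    using order_trans[OF IH[of j] mult_right_mono[of "if j < size A then \<delta> else 1" 1 "2 ^ size A"]] assms(3)
    by simp
  have r: "norm r \<le> \<delta>" using add.prems by simp
  have "norm (r * coeff ?q i) \<le> \<delta> * 2 ^ size A"
    unfolding norm_mult using r IH1 assms by (intro mult_mono) auto
  moreover have "norm (coeff (pCons 0 ?q) i) \<le> (if i < Suc (size A) then \<delta> else 1) * 2 ^ size A"
    using IH assms(2) by (cases i) auto
  moreover have "\<delta> * 2 ^ size A \<le> (if i < Suc (size A) then \<delta> else 1) * 2 ^ size A"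
    using assms by (intro mult_right_mono) auto
  ultimately have "norm (coeff (pCons 0 ?q) i - r * coeff ?q i)
      \<le> 2 * ((if i < Suc (size A) then \<delta> else 1) * 2 ^ size A)"
    using norm_triangle_ineq4[of "coeff (pCons 0 ?q) i" "r * coeff ?q i"] by linarith
  moreover have "coeff (\<Prod>r\<in>#add_mset r A. [:-r, 1:]) i = coeff (pCons 0 ?q) i - r * coeff ?q i"
    by simp
  ultimately show ?case by simp
qed

text \<open>
  The interface between singularity theory and topology. The polynomial \<open>pol l\<close> has degree \<open>n\<close> and its non-zero roots are to be the
  non-zero critical values at the parameter \<open>l\<close>. The assumption \<open>nilpotent_fibre\<close> (all roots are zero only at the origin)
  and the quasi-homogeneity \<open>homogeneous\<close> with positive weights make the map proper, \<open>immersive\<close> makes it locally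
  injective outside the bifurcation diagram, and \<open>generic_exists\<close> guarantees that the complement of the diagram is not empty.
\<close>

locale critical_value_family = numbering ix n
  for ix :: "nat \<Rightarrow> 'n::finite" and n :: nat +
  fixes pol :: "(nat \<Rightarrow> complex) \<Rightarrow> complex poly" and wt :: "nat \<Rightarrow> nat" and d :: nat
  assumes monic: "degree (pol l) = n" "lead_coeff (pol l) = 1"
    and polyfun_pol: "polyfun_coeffs n pol"
    and nilpotent_fibre: "(\<And>c. poly (pol l) c = 0 \<Longrightarrow> c = 0) \<Longrightarrow> i < n \<Longrightarrow> l i = 0"
    and weights: "i < n \<Longrightarrow> wt i > 0" "d > 0"
    and homogeneous: "s > 0 \<Longrightarrow> poly (pol l) c = 0 \<Longrightarrow> c \<noteq> 0 \<Longrightarrow>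
          poly (pol (\<lambda>i. of_real s ^ wt i * l i)) (of_real s ^ d * c) = 0"
    and generic_exists: "\<exists>l. card {c. poly (pol l) c = 0} = n \<and> poly (pol l) 0 \<noteq> 0"
    and immersive: "card {c. poly (pol l) c = 0} = n \<Longrightarrow> poly (pol l) 0 \<noteq> 0 \<Longrightarrow>
          (\<And>j. j < n \<Longrightarrow> (\<Sum>i<n. partial (\<lambda>l. coeff (pol l) j) i l * h i) = 0) \<Longrightarrow> i < n \<Longrightarrow> h i = 0"
begin

abbreviation params :: "complex^'n \<Rightarrow> nat \<Rightarrow> complex" where
  "params t \<equiv> (\<lambda>i. t $ ix i)"

definition LLmap :: "complex^'n \<Rightarrow> complex^'n" where
  "LLmap t = vector_of ix (coeff (pol (params t)))"

definition disc :: "complex^'n \<Rightarrow> complex" where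
  "disc a = discr (params a)"

lemma monic_poly_LLmap: "monic_poly ix (LLmap t) = pol (params t)"
proof -
  have "monic_poly ix (LLmap t) = monic_of n (coeff (pol (params t)))"
    unfolding monic_poly_def monic_of_def card_n LLmap_def by simp
  then show ?thesis using monic_of_coeffs[OF monic] by simp
qed

lemma monic_poly_eq: "monic_poly ix a = monic_of n (params a)"
  unfolding monic_poly_def monic_of_def card_n ..

lemma disc_iff: "disc a \<noteq> 0 \<longleftrightarrow> card {c. poly (monic_poly ix a) c = 0} = n \<and> poly (monic_poly ix a) 0 \<noteq> 0"
  unfolding disc_def discr_nonzero_iff monic_poly_eq ..

lemma discriminant_set_eq: "discriminant_set ix = {a. disc a = 0}"
proof -
  have "(\<exists>r. order r p \<ge> 2) \<longleftrightarrow> card {x. poly p x = 0} \<noteq> n" if "degree p = n" "p \<noteq> 0" for p :: "complex poly"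
  proof -
    have "order r p \<ge> 2 \<longleftrightarrow> \<not> (poly p r = 0 \<longrightarrow> order r p = 1)" for r
      using order_root[of p r] that by auto
    then show ?thesis using card_roots_eq_degree_iff[OF that(2)] that(1) by auto
  qed
  note * = this[OF degree_monic_of, of "params a" for a]
  have "monic_of n a \<noteq> 0" for a using lead_coeff_monic_of[of n a] by auto
  then show ?thesis unfolding discriminant_set_def using disc_iff * by (auto simp: monic_poly_eq)
qed

lemma polyfun_comp_params_has_derivative:
  assumes "polyfun n f"
  shows "((\<lambda>t. f (params t)) has_derivative (\<lambda>h. \<Sum>i<n. partial f i (params t) * params h i)) (at t)"
  by (rule polyfun_has_derivative[OF assms])
     (intro bounded_linear_imp_has_derivative bounded_linear_vec_nth)

lemma polyfun_params_continuous:
  assumes "polyfun n f" shows "continuous_on S (\<lambda>t. f (params t))"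
  by (rule has_derivative_continuous_on[OF has_derivative_at_withinI[OF polyfun_comp_params_has_derivative[OF assms]]])

lemma polyfun_params_line:
  assumes "polyfun n f" shows "\<exists>P. \<forall>s. f (params (x + s *s y)) = poly P s"
  using polyfun_line[OF assms, of "params x" "params y"] by simp

definition dLL :: "complex^'n \<Rightarrow> complex^'n \<Rightarrow> complex^'n" where
  "dLL t h = vector_of ix (\<lambda>j. \<Sum>i<n. partial (\<lambda>l. coeff (pol l) j) i (params t) * params h i)"

lemma polyfun_coeff: "polyfun n (\<lambda>l. coeff (pol l) j)"
  using polyfun_pol by (simp add: polyfun_coeffs_def)

lemma LLmap_has_derivative: "(LLmap has_derivative dLL t) (at t)"
proof -
  have "((\<lambda>t. LLmap t $ i) has_derivative (\<lambda>h. dLL t h $ i)) (at t)" for i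
  proof -
    obtain j where "j < n" "i = ix j" using ix_cases by metis
    then show ?thesis unfolding LLmap_def dLL_def
      using polyfun_comp_params_has_derivative[OF polyfun_coeff, of j t] by simp
  qed
  then show ?thesis by (subst has_derivative_componentwise_within) (auto simp: Basis_vec_def inner_axis intro!: derivative_eq_intros)
qed

lemma dLL_linear: "Vector_Spaces.linear (*s) (*s) (dLL t)"
  unfolding dLL_def
  by unfold_locales
    (auto simp: vec_eq_iff all_ix algebra_simps sum.distrib sum_distrib_left)

lemma continuous_LLmap: "continuous_on S LLmap"
  by (rule has_derivative_continuous_on[OF has_derivative_at_withinI[OF LLmap_has_derivative]])

lemma disc_continuous: "continuous_on S disc"
  unfolding disc_def by (rule polyfun_params_continuous[OF polyfun_discr])

lemma polyfun_discr_pol: "polyfun n (\<lambda>l. discr (coeff (pol l)))"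
  by (rule polyfun_compose[OF polyfun_discr polyfun_coeff])

lemma disc_LLmap: "disc (LLmap t) = discr (coeff (pol (params t)))"
  unfolding disc_def LLmap_def by (rule polyfun_cong[OF polyfun_discr]) simp

lemma disc_LLmap_iff:
  "disc (LLmap t) \<noteq> 0 \<longleftrightarrow> card {c. poly (pol (params t)) c = 0} = n \<and> poly (pol (params t)) 0 \<noteq> 0"
  unfolding disc_iff monic_poly_LLmap ..

lemma pol_cong: "(\<And>i. i < n \<Longrightarrow> l i = l' i) \<Longrightarrow> pol l = pol l'"
  using polyfun_cong[OF polyfun_coeff] by (intro poly_eqI) blast

lemma generic_point: "\<exists>t. disc (LLmap t) \<noteq> 0"
proof -
  obtain l where l: "card {c. poly (pol l) c = 0} = n" "poly (pol l) 0 \<noteq> 0" using generic_exists by blast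
  have "pol (params (vector_of ix l)) = pol l" by (rule pol_cong) simp
  with l show ?thesis by (intro exI[of _ "vector_of ix l"]) (simp add: disc_LLmap_iff)
qed

text \<open>
  Density of the complement of the bifurcation diagram is what makes the limit in the definition of \<open>LL\<close> well defined.
\<close>

lemma generic_dense: "closure {t. disc (LLmap t) \<noteq> 0} = UNIV"
proof -
  obtain t where "disc (LLmap t) \<noteq> 0" using generic_point by blast
  then show ?thesis
    using complement_zeros_line_polynomial(2)[of "\<lambda>t. disc (LLmap t)"]
      polyfun_params_line[OF polyfun_discr_pol] unfolding disc_LLmap by blast
qed

lemma connected_disc: "connected {a. disc a \<noteq> 0}"
  using complement_zeros_line_polynomial(1)[of disc] polyfun_params_line[OF polyfun_discr]
    generic_point unfolding disc_def by blast

text \<open>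
  The inverse function theorem: the derivative at \<open>t\<close> is injective by \<open>immersive\<close>, and it depends continuously on the point
  in the operator norm because its entries are polynomial.
\<close>

lemma LLmap_locally_injective:
  assumes "disc (LLmap t) \<noteq> 0"
  shows "\<exists>r>0. inj_on LLmap (ball t r)"
proof -
  have bl: "bounded_linear (dLL u)" for u
    using LLmap_has_derivative has_derivative_bounded_linear by blast
  have "h = 0" if "dLL t h = 0" for h
  proof -
    have "params h i = 0" if "i < n" for i
    proof (rule immersive[of "params t"])
      show "card {c. poly (pol (params t)) c = 0} = n" "poly (pol (params t)) 0 \<noteq> 0"
        using assms by (auto simp: disc_LLmap_iff)
      fix j assume "j < n"
      then show "(\<Sum>i<n. partial (\<lambda>l. coeff (pol l) j) i (params t) * params h i) = 0"
        using arg_cong[OF \<open>dLL t h = 0\<close>, of "\<lambda>v. v $ ix j"] unfolding dLL_def by simp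
    qed (rule that)
    then show ?thesis by (simp add: vec_eq_iff all_ix)
  qed
  then have "inj (dLL t)" using bl[of t] by (simp add: linear_injective_0 bounded_linear.linear)
  then obtain g where g: "linear g" "g \<circ> dLL t = id"
    using linear_injective_left_inverse bl bounded_linear.linear by metis
  have cont: "\<exists>\<delta>>0. \<forall>u. dist t u < \<delta> \<longrightarrow> onorm (\<lambda>h. dLL u h - dLL t h) < e" if "e > 0" for e
  proof -
    let ?c = "\<lambda>u i j. partial (\<lambda>l. coeff (pol l) j) i (params u)"
    \<comment> \<open>The operator norm is bounded by the sum of the absolute values of the entries.\<close>
    define B where "B u = (\<Sum>j<n. \<Sum>i<n. norm (?c u i j - ?c t i j))" for u
    have "continuous_on UNIV B" unfolding B_def
      by (intro continuous_intros polyfun_params_continuous polyfun_partial polyfun_coeff)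
    then have "(B \<longlongrightarrow> B t) (at t)" by (simp add: continuous_on_def)
    moreover have "B t = 0" by (simp add: B_def)
    ultimately have "\<forall>\<^sub>F u in at t. dist (B u) 0 < e" using \<open>e > 0\<close> by (simp add: tendsto_iff)
    then obtain \<delta> where \<delta>: "\<delta> > 0" "\<And>u. u \<noteq> t \<Longrightarrow> dist u t < \<delta> \<Longrightarrow> dist (B u) 0 < e"
      unfolding eventually_at by auto
    have "onorm (\<lambda>h. dLL u h - dLL t h) \<le> B u" for u
    proof (rule onorm_le)
      fix h
      have "norm (dLL u h - dLL t h) \<le> (\<Sum>k\<in>UNIV. norm ((dLL u h - dLL t h) $ k))"
        unfolding norm_vec_def by (rule L2_set_le_sum) simp
      also have "\<dots> = (\<Sum>j<n. norm (\<Sum>i<n. (?c u i j - ?c t i j) * params h i))"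
        unfolding sum_ix dLL_def by (intro sum.cong refl) (simp add: sum_subtractf left_diff_distrib)
      also have "\<dots> \<le> (\<Sum>j<n. \<Sum>i<n. norm (?c u i j - ?c t i j) * norm h)"
        by (intro sum_mono order_trans[OF norm_sum])
           (simp add: norm_mult mult_left_mono Finite_Cartesian_Product.norm_nth_le)
      also have "\<dots> = B u * norm h" by (simp add: B_def sum_distrib_right)
      finally show "norm (dLL u h - dLL t h) \<le> B u * norm h" .
    qed
    then have "onorm (\<lambda>h. dLL u h - dLL t h) < e" if "dist t u < \<delta>" for u
      using \<delta>(2)[of u] that \<open>B t = 0\<close> \<open>e > 0\<close>
      by (cases "u = t") (auto simp: dist_commute onorm_zero intro: le_less_trans[of _ "B u"])
    then show ?thesis using \<delta>(1) by blast
  qed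
  show ?thesis
    by (rule has_derivative_locally_injective[of t UNIV g dLL LLmap])
       (use g LLmap_has_derivative cont in \<open>auto simp: linear_conv_bounded_linear\<close>)
qed

definition coeff_sum :: "complex^'n \<Rightarrow> real" where
  "coeff_sum t = (\<Sum>j<n. norm (coeff (pol (params t)) j))"

text \<open>
  Cauchy's bound for the roots of a monic polynomial.
\<close>

lemma root_le_coeff_sum:
  assumes "poly (pol (params t)) c = 0"
  shows "norm c \<le> max 1 (coeff_sum t)"
proof (cases "norm c \<le> 1")
  case False
  let ?p = "pol (params t)"
  have "c ^ n = - (\<Sum>j<n. coeff ?p j * c ^ j)"
  proof -
    have "poly ?p c = (\<Sum>j\<le>n. coeff ?p j * c ^ j)" using monic(1) poly_altdef by metis
    also have "\<dots> = (\<Sum>j<n. coeff ?p j * c ^ j) + c ^ n"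
      using monic[of "params t"] by (simp add: lessThan_Suc_atMost[symmetric])
    finally show ?thesis using assms by (simp add: eq_neg_iff_add_eq_0 add.commute)
  qed
  then have "norm c ^ n = norm (\<Sum>j<n. coeff ?p j * c ^ j)" by (metis norm_minus_cancel norm_power)
  also have "\<dots> \<le> (\<Sum>j<n. norm (coeff ?p j) * norm c ^ (n - 1))"
    by (rule sum_norm_le) (use False in \<open>auto simp: norm_mult norm_power intro!: mult_left_mono power_increasing\<close>)
  also have "\<dots> = coeff_sum t * norm c ^ (n - 1)" by (simp add: coeff_sum_def sum_distrib_right)
  finally have "norm c * norm c ^ (n - 1) \<le> coeff_sum t * norm c ^ (n - 1)"
    using n_pos by (metis power_eq_if less_numeral_extra(3))
  moreover have "norm c ^ (n - 1) > 0" using False by (intro zero_less_power) auto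
  ultimately have "norm c \<le> coeff_sum t" by (simp only: mult_le_cancel_right_pos)
  then show ?thesis by simp
qed simp

text \<open>
  On the compact set where the largest coordinate has absolute value one, the lower coefficients of \<open>pol\<close> do not vanish
  simultaneously, by \<open>nilpotent_fibre\<close>. Hence they are bounded away from zero together, and by
  \<open>small_roots_small_coeffs\<close> so is the largest root.
\<close>

lemma roots_away_from_zero:
  "\<exists>\<delta>>0. \<forall>t. (\<forall>i<n. norm (params t i) \<le> 1) \<longrightarrow> (\<exists>i<n. norm (params t i) = 1) \<longrightarrow>
     (\<exists>c. poly (pol (params t)) c = 0 \<and> \<delta> \<le> norm c)"
proof -
  define \<Sigma> where "\<Sigma> = {t. (\<forall>i<n. norm (params t i) \<le> 1) \<and> (\<exists>i<n. norm (params t i) = 1)}"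
  have "compact \<Sigma>"
  proof (rule compact_eq_bounded_closed[THEN iffD2], intro conjI)
    show "bounded \<Sigma>"
    proof (rule boundedI)
      fix t assume "t \<in> \<Sigma>"
      then have "(\<Sum>j\<in>UNIV. norm (t $ j)) \<le> (\<Sum>j\<in>(UNIV::'n set). 1)"
        by (intro sum_mono) (metis (mono_tags, lifting) \<Sigma>_def ix_cases mem_Collect_eq)
      then show "norm t \<le> real CARD('n)"
        using L2_set_le_sum[of UNIV "\<lambda>i. norm (t $ i)"] unfolding norm_vec_def by simp
    qed
    have "\<Sigma> = (\<Inter>i<n. {t. norm (params t i) \<le> 1}) \<inter> (\<Union>i<n. {t. norm (params t i) = 1})"
      unfolding \<Sigma>_def by auto
    moreover have "closed (\<Inter>i<n. {t. norm (params t i) \<le> 1})"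
      by (intro closed_INT ballI closed_Collect_le continuous_intros)
    moreover have "closed (\<Union>i<n. {t. norm (params t i) = 1})"
      by (intro closed_UN ballI closed_Collect_eq continuous_intros) auto
    ultimately show "closed \<Sigma>" by (simp only: closed_Int)
  qed
  have cont: "continuous_on \<Sigma> coeff_sum"
    unfolding coeff_sum_def by (intro continuous_intros polyfun_params_continuous polyfun_coeff)
  have pos: "coeff_sum t > 0" if "t \<in> \<Sigma>" for t
  proof -
    have "\<exists>j<n. coeff (pol (params t)) j \<noteq> 0"
    proof (rule ccontr)
      assume "\<not> ?thesis"
      then have "coeff (pol (params t)) j = coeff (monom 1 n) j" for j
        using monic[of "params t"] by (cases j n rule: linorder_cases) (auto simp: coeff_eq_0)
      then have "pol (params t) = monom 1 n" by (rule poly_eqI)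
      then have "params t i = 0" if "i < n" for i
        using nilpotent_fibre[of "params t" i] that n_pos by (simp add: poly_monom)
      then show False using that unfolding \<Sigma>_def by auto
    qed
    then show ?thesis unfolding coeff_sum_def by (auto intro: sum_pos2)
  qed
  obtain \<beta> where \<beta>: "\<beta> > 0" "\<And>t. t \<in> \<Sigma> \<Longrightarrow> \<beta> \<le> coeff_sum t"
  proof (cases "\<Sigma> = {}")
    case False
    then obtain t0 where "t0 \<in> \<Sigma>" "\<forall>t\<in>\<Sigma>. coeff_sum t0 \<le> coeff_sum t"
      using continuous_attains_inf[OF \<open>compact \<Sigma>\<close> False cont] by blast
    then show ?thesis using that pos by blast
  qed (use that[of 1] in auto)
  define \<delta> where "\<delta> = min 1 (\<beta> / (2 * real n * 2 ^ n))"
  have \<delta>: "\<delta> > 0" "\<delta> \<le> 1" using \<beta>(1) n_pos by (auto simp: \<delta>_def)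
  have "\<exists>c. poly (pol (params t)) c = 0 \<and> \<delta> \<le> norm c" if t: "t \<in> \<Sigma>" for t
  proof (rule ccontr)
    assume *: "\<not> ?thesis"
    let ?p = "pol (params t)"
    have p0: "?p \<noteq> 0" using monic[of "params t"] n_pos by auto
    have "?p = (\<Prod>r\<in>#proots ?p. [:-r, 1:])"
      using complex_poly_decompose_multiset[of ?p] monic(2)[of "params t"] by simp
    moreover have "size (proots ?p) = n" using monic(1) by (simp add: size_proots_complex)
    moreover have "norm r \<le> \<delta>" if "r \<in># proots ?p" for r using * that p0 by auto
    ultimately have "norm (coeff ?p j) \<le> \<delta> * 2 ^ n" if "j < n" for j
      using small_roots_small_coeffs[of "proots ?p" \<delta> j] \<delta> that by auto
    then have "coeff_sum t \<le> (\<Sum>j<n. \<delta> * 2 ^ n)" unfolding coeff_sum_def by (intro sum_mono) auto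
    also have "\<dots> = real n * 2 ^ n * \<delta>" by simp
    also have "\<dots> \<le> real n * 2 ^ n * (\<beta> / (2 * real n * 2 ^ n))"
      unfolding \<delta>_def by (intro mult_left_mono) auto
    also have "\<dots> = \<beta> / 2" using n_pos by simp
    finally show False using \<beta>(2)[OF t] \<beta>(1) by simp
  qed
  then show ?thesis using \<delta>(1) unfolding \<Sigma>_def by blast
qed

text \<open>
  Quasi-homogeneous rescaling by \<open>1/m\<close> brings a parameter of quasi-norm \<open>m\<close> to the set considered in \<open>roots_away_from_zero\<close>. Scaling
  back, a root of absolute value at least \<open>\<delta>\<close> there becomes a root of absolute value at least \<open>m ^ d * \<delta>\<close>. As the roots are bounded when the
  coefficients vary in a compact set, so is \<open>m\<close>.
\<close>

lemma compact_preimage_LLmap: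
  assumes "compact K"
  shows "compact (LLmap -` K)"
proof (rule compact_eq_bounded_closed[THEN iffD2], intro conjI)
  show "closed (LLmap -` K)"
    using assms continuous_LLmap by (intro closed_vimage) (auto intro: compact_imp_closed)
  obtain R where R: "\<And>a. a \<in> K \<Longrightarrow> norm a \<le> R"
    using assms compact_imp_bounded bounded_iff by metis
  obtain \<delta> where \<delta>: "\<delta> > 0" "\<And>t. (\<forall>i<n. norm (params t i) \<le> 1) \<Longrightarrow> (\<exists>i<n. norm (params t i) = 1) \<Longrightarrow>
     (\<exists>c. poly (pol (params t)) c = 0 \<and> \<delta> \<le> norm c)"
    using roots_away_from_zero by blast
  define B where "B = max 1 (real n * R) / \<delta>"
  have key: "norm (params t i) \<le> max 1 B ^ wt i" if t: "t \<in> LLmap -` K" and i: "i < n" for t i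
  proof -
    \<comment> \<open>\<open>f i\<close> is the scaling factor that moves the \<open>i\<close>-th coordinate to the unit circle, and \<open>m\<close> the quasi-norm.\<close>
    define f where "f i = norm (params t i) powr (1 / real (wt i))" for i
    define m where "m = Max (f ` {..<n})"
    have fm: "f i \<le> m" if "i < n" for i unfolding m_def using that by (intro Max_ge) auto
    have f0: "f i \<ge> 0" for i by (simp add: f_def)
    have fpow: "f i ^ wt i = norm (params t i)" if "i < n" for i
      using weights(1)[OF that] by (cases "params t i = 0") (simp_all add: f_def powr_powr powr_realpow[symmetric])
    have "m \<in> f ` {..<n}" unfolding m_def using n_pos by (intro Max_in) auto
    then obtain k where k: "k < n" "m = f k" by auto
    have m0: "m \<ge> 0" using k f0 by simp
    have "m \<le> max 1 B"
    proof (cases "m \<le> 1")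
      case False
      define \<sigma> where "\<sigma> = vector_of ix (\<lambda>i. of_real (1/m) ^ wt i * params t i)"
      have n\<sigma>: "norm (params \<sigma> i) = (f i / m) ^ wt i" if "i < n" for i
        using that fpow[OF that] False by (simp add: \<sigma>_def norm_mult norm_power norm_divide power_divide)
      have "\<forall>i<n. norm (params \<sigma> i) \<le> 1"
        using fm f0 False by (auto simp: n\<sigma> power_le_one)
      moreover have "norm (params \<sigma> k) = 1" using k False by (simp add: n\<sigma>)
      ultimately obtain c where c: "poly (pol (params \<sigma>)) c = 0" "\<delta> \<le> norm c"
        using \<delta>(2)[of \<sigma>] k by blast
      have "c \<noteq> 0" using c(2) \<delta>(1) by auto
      have "pol (\<lambda>i. of_real m ^ wt i * params \<sigma> i) = pol (params t)"
        using False by (intro pol_cong) (simp add: \<sigma>_def power_divide)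
      with \<open>c \<noteq> 0\<close> have "poly (pol (params t)) (of_real m ^ d * c) = 0"
        using homogeneous[of m "params \<sigma>" c] c(1) False \<open>c \<noteq> 0\<close> by auto
      then have "norm (of_real m ^ d * c) \<le> max 1 (coeff_sum t)" by (rule root_le_coeff_sum)
      also have "coeff_sum t \<le> (\<Sum>j<n. norm (LLmap t))" unfolding coeff_sum_def
      proof (intro sum_mono)
        fix j assume "j \<in> {..<n}"
        then show "norm (coeff (pol (params t)) j) \<le> norm (LLmap t)"
          using Finite_Cartesian_Product.norm_nth_le[of "LLmap t" "ix j"] by (simp add: LLmap_def)
      qed
      also have "\<dots> \<le> real n * R" using R[of "LLmap t"] t by (simp add: mult_left_mono)
      finally have "m ^ d * norm c \<le> max 1 (real n * R)" using m0 by (simp add: norm_mult norm_power)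
      moreover have "m * \<delta> \<le> m ^ d * norm c"
        using False weights(2) c(2) \<delta>(1) self_le_power[of m d] by (intro mult_mono) auto
      ultimately have "m \<le> B" unfolding B_def using \<delta>(1) by (simp add: le_divide_eq)
      then show ?thesis by simp
    qed simp
    then have "f i \<le> max 1 B" using fm[OF i] by linarith
    then show ?thesis using fpow[OF i] f0[of i] by (metis power_mono)
  qed
  show "bounded (LLmap -` K)"
  proof (rule boundedI)
    fix t assume t: "t \<in> LLmap -` K"
    have "norm t \<le> (\<Sum>j\<in>UNIV. norm (t $ j))" unfolding norm_vec_def by (rule L2_set_le_sum) simp
    also have "\<dots> \<le> (\<Sum>i<n. max 1 B ^ wt i)" unfolding sum_ix using key[OF t] by (intro sum_mono) auto
    finally show "norm t \<le> (\<Sum>i<n. max 1 B ^ wt i)" .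
  qed
qed

text \<open>
  It remains to identify \<open>LL\<close> with the polynomial map \<open>LLmap\<close>. Outside the bifurcation diagram a monic polynomial of degree \<open>n\<close> is
  determined by its \<open>n\<close> distinct roots; on the diagram both maps are limits from the dense complement.
\<close>

theorem LL_is_covering:
  assumes tau: "tau S = n"
    and cv: "\<And>t. nonzero_critical_values S ix t = {c. poly (pol (params t)) c = 0} - {0}"
  shows "holomorphic_map_on (LL S ix) UNIV
       \<and> proper_map euclidean euclidean (LL S ix)
       \<and> LL S ix ` bifurcation_diagram S ix \<subseteq> discriminant_set ix
       \<and> covering_space (- bifurcation_diagram S ix) (LL S ix) (- discriminant_set ix)
       \<and> (\<exists>N::nat. \<forall>a \<in> - discriminant_set ix.
            finite {t \<in> - bifurcation_diagram S ix. LL S ix t = a} \<and>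
            card {t \<in> - bifurcation_diagram S ix. LL S ix t = a} = N)"
proof -
  have fin: "finite {c. poly (pol l) c = 0}" and le: "card {c. poly (pol l) c = 0} \<le> n" for l
  proof -
    have "pol l \<noteq> 0" using monic[of l] by auto
    then show "finite {c. poly (pol l) c = 0}" "card {c. poly (pol l) c = 0} \<le> n"
      using poly_roots_finite card_poly_roots_bound monic(1) by metis+
  qed
  have bif: "bifurcation_diagram S ix = {t. disc (LLmap t) = 0}"
  proof -
    have "card ({c. poly (pol l) c = 0} - {0}) < n \<longleftrightarrow>
        \<not> (card {c. poly (pol l) c = 0} = n \<and> poly (pol l) 0 \<noteq> 0)" for l
      using fin[of l] le[of l] card_gt_0_iff[of "{c. poly (pol l) c = 0}"]
      by (cases "poly (pol l) 0 = 0") (auto simp: card_Diff_singleton_if)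
    then show ?thesis
      unfolding bifurcation_diagram_def cv tau using fin disc_LLmap_iff by auto
  qed
  have generic: "LL_generic S ix t = LLmap t" if "disc (LLmap t) \<noteq> 0" for t
  proof -
    let ?R = "{c. poly (pol (params t)) c = 0}"
    have c: "card ?R = n" "?R - {0} = ?R" using that by (auto simp: disc_LLmap_iff)
    \<comment> \<open>The difference of two monic polynomials of degree \<open>n\<close> with the same \<open>n\<close> roots has smaller degree and too many roots.\<close>
    have "a = LLmap t" if a: "{c. poly (monic_poly ix a) c = 0} = ?R" for a
    proof -
      let ?q = "monic_poly ix a - pol (params t)"
      have "?q = 0"
      proof (rule ccontr)
        assume q: "?q \<noteq> 0"
        have "?R \<subseteq> {c. poly ?q c = 0}" using a by auto
        then have "n \<le> card {c. poly ?q c = 0}"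
          using c(1) card_mono[OF poly_roots_finite[OF q]] by metis
        also have "\<dots> \<le> degree ?q" by (rule card_poly_roots_bound[OF q])
        also have "\<dots> < n"
        proof -
          have "coeff ?q n = 0" using monic[of "params t"] by (simp add: monic_poly_eq coeff_monic_of)
          moreover have "degree ?q \<le> n"
            using monic[of "params t"] by (intro degree_diff_le) (simp_all add: monic_poly_eq degree_monic_of)
          ultimately show ?thesis using q by (metis leading_coeff_0_iff le_neq_implies_less)
        qed
        finally show False by simp
      qed
      then have eq: "monic_poly ix a = pol (params t)" by simp
      have "a $ ix i = coeff (pol (params t)) i" if "i < n" for i
        using that unfolding eq[symmetric] monic_poly_eq by (simp add: coeff_monic_of)
      then show ?thesis unfolding LLmap_def vector_of_eq_iff by blast
    qed
    then show ?thesis unfolding LL_generic_def cv c(2)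
      by (intro the_equality) (simp_all add: monic_poly_LLmap)
  qed
  have LL_eq: "LL S ix = LLmap"
  proof
    fix t
    show "LL S ix t = LLmap t"
    proof (cases "disc (LLmap t) = 0")
      case True
      let ?G = "- bifurcation_diagram S ix"
      have G: "?G = {t. disc (LLmap t) \<noteq> 0}" unfolding bif by auto
      have "t islimpt ?G" using True generic_dense unfolding G by (auto simp: closure_def)
      then have "\<not> trivial_limit (at t within ?G)" by (simp add: trivial_limit_within)
      moreover have "(LL_generic S ix \<longlongrightarrow> LLmap t) (at t within ?G)"
      proof (rule Lim_transform_within[of LLmap _ _ _ 1])
        show "(LLmap \<longlongrightarrow> LLmap t) (at t within ?G)"
          using continuous_LLmap[of UNIV] by (meson UNIV_I continuous_on_def tendsto_within_subset top_greatest)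
      qed (use generic G in auto)
      ultimately have "Lim (at t within ?G) (LL_generic S ix) = LLmap t" by (intro tendsto_Lim)
      then show ?thesis using True by (simp add: LL_def bif)
    next
      case False
      then show ?thesis by (simp add: LL_def bif generic)
    qed
  qed
  have D: "- discriminant_set ix = {a. disc a \<noteq> 0}" unfolding discriminant_set_eq by auto
  have pre: "- bifurcation_diagram S ix = LLmap -` (- discriminant_set ix)"
    unfolding bif D by auto
  have "open {a. disc a \<noteq> 0}" using disc_continuous[of UNIV]
    by (intro open_Collect_neq) auto
  then have cov: "covering_space (LLmap -` (- discriminant_set ix)) LLmap (- discriminant_set ix) \<and>
    (\<exists>N::nat. \<forall>a\<in>- discriminant_set ix. finite (LLmap -` {a}) \<and> card (LLmap -` {a}) = N)"
    unfolding D using generic_point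
    by (intro proper_locally_injective_covering continuous_LLmap compact_preimage_LLmap
        connected_disc LLmap_locally_injective) auto
  have fibre: "{t \<in> - bifurcation_diagram S ix. LLmap t = a} = LLmap -` {a}" if "a \<in> - discriminant_set ix" for a
    using that unfolding pre by auto
  have "holomorphic_map_on LLmap UNIV"
    unfolding holomorphic_map_on_def using LLmap_has_derivative dLL_linear by blast
  moreover have "proper_map euclidean euclidean LLmap"
    by (rule compact_preimages_imp_proper_map[OF continuous_LLmap compact_preimage_LLmap])
  moreover have "LLmap ` bifurcation_diagram S ix \<subseteq> discriminant_set ix"
    unfolding bif discriminant_set_eq by auto
  moreover have "\<exists>N::nat. \<forall>a \<in> - discriminant_set ix.
            finite {t \<in> - bifurcation_diagram S ix. LLmap t = a} \<and>
            card {t \<in> - bifurcation_diagram S ix. LLmap t = a} = N"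
  proof -
    obtain N where "\<forall>a\<in>- discriminant_set ix. finite (LLmap -` {a}) \<and> card (LLmap -` {a}) = N"
      using cov by (elim conjE exE)
    then show ?thesis using fibre by (intro exI[of _ N] ballI) simp
  qed
  ultimately show ?thesis using cov unfolding LL_eq pre by blast
qed

end

section \<open>Algebras of points\<close>

context numbering begin

text \<open>
  \<open>n\<close> eigenvectors with different eigenvalues are the rows of an invertible matrix \<open>V\<close>. Invertibility of the transposed matrix says that
  they span, that of \<open>V\<close> that no non-zero linear form vanishes on all of them.
\<close>

lemma eigenbasis:
  fixes B :: "'i \<Rightarrow> complex^'n"
  assumes A: "card A = n" "\<And>i. i \<in> A \<Longrightarrow> T *v B i = c i *s B i" "inj_on c A" "\<And>i. i \<in> A \<Longrightarrow> B i \<noteq> 0"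
  shows eigenbasis_span: "\<exists>k. v = (\<Sum>i\<in>A. k i *s B i)"
    and eigenbasis_separates: "(\<And>i. i \<in> A \<Longrightarrow> (\<Sum>k<n. a k * B i $ ix k) = 0) \<Longrightarrow> k < n \<Longrightarrow> a k = 0"
proof -
  have fin: "finite A" using A(1) n_pos card.infinite by fastforce
  then obtain g where g: "bij_betw g (UNIV :: 'n set) A"
    using finite_same_card_bij[of "UNIV::'n set" A] A(1) card_n by auto
  define V :: "complex^'n^'n" where "V = (\<chi> i. B (g i))"
  have comb: "transpose V *v x = (\<Sum>i\<in>A. x $ inv_into UNIV g i *s B i)" for x
  proof -
    have "transpose V *v x = (\<Sum>j\<in>UNIV. x $ j *s B (g j))"
      by (simp add: V_def transpose_def matrix_vector_mult_def vec_eq_iff mult.commute)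
    also have "\<dots> = (\<Sum>j\<in>UNIV. x $ inv_into UNIV g (g j) *s B (g j))"
      using g by (intro sum.cong refl) (simp add: bij_betw_inv_into_left)
    finally show ?thesis using sum.reindex_bij_betw[OF g, of "\<lambda>i. x $ inv_into UNIV g i *s B i"] by simp
  qed
  have "x = 0" if "transpose V *v x = 0" for x
  proof -
    have "\<forall>i\<in>A. x $ inv_into UNIV g i = 0"
      using eigenvectors_independent[OF fin, of T B c "\<lambda>i. x $ inv_into UNIV g i"] A that
      unfolding comb by blast
    then have "x $ j = 0" for j using bij_betwE[OF g] bij_betw_inv_into_left[OF g] by (metis UNIV_I)
    then show ?thesis by (simp add: vec_eq_iff)
  qed
  then have inv: "invertible (transpose V)"
    unfolding invertible_left_inverse matrix_left_invertible_ker by blast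
  then obtain U where U: "transpose V ** U = mat 1" unfolding invertible_def by blast
  have "v = transpose V *v (U *v v)" by (simp add: matrix_vector_mul_assoc U)
  then show "\<exists>k. v = (\<Sum>i\<in>A. k i *s B i)"
    unfolding comb by (rule exI[of _ "\<lambda>i. (U *v v) $ inv_into UNIV g i"])
  show "a k = 0" if "\<And>i. i \<in> A \<Longrightarrow> (\<Sum>k<n. a k * B i $ ix k) = 0" "k < n"
  proof -
    have "V *v vector_of ix a = 0"
    proof -
      have "(V *v vector_of ix a) $ j = (\<Sum>k<n. a k * B (g j) $ ix k)" for j
        by (simp add: V_def matrix_vector_mult_def sum_ix mult.commute)
      then show ?thesis using that(1) bij_betwE[OF g] by (simp add: vec_eq_iff)
    qed
    moreover have "invertible V" using inv unfolding invertible_det_nz by (simp add: det_transpose)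
    ultimately have "vector_of ix a = 0"
      unfolding invertible_left_inverse matrix_left_invertible_ker by blast
    then show ?thesis using that(2) by (metis vector_of_nth zero_index)
  qed
qed

end

text \<open>
  This is the closure property needed for \<open>eigenvector_in_invariant_subspace\<close>, which then produces simultaneous eigenvectors.
\<close>

lemma commuting_preserves_eigenspace:
  fixes A B :: "complex^'n^'n"
  assumes "A ** B = B ** A" "A *v v = c *s v"
  shows "A *v (B *v v - w *s v) = c *s (B *v v - w *s v)"
proof -
  have "A *v (B *v v) = B *v (A *v v)" by (simp only: matrix_vector_mul_assoc assms(1))
  then show ?thesis
    using assms(2) by (simp add: vec.diff vector_scalar_commute vec_eq_iff algebra_simps)
qed

text \<open>
  \<open>Pt l\<close> describes a finite set of points \<open>(w, z)\<close>, cut out by equations depending on the parameters \<open>l\<close>. The picture is that there are,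
  counted with multiplicity, always \<open>n\<close> points, and that for every \<open>l\<close> the monomials \<open>w ^ p i * z ^ q i\<close> with \<open>i < n\<close> form a basis of the algebra of
  functions on the scheme they form. The matrices \<open>Wm l\<close> and \<open>Zm l\<close> describe multiplication by \<open>w\<close> and \<open>z\<close> in this basis. In concrete
  terms, the points are exactly the simultaneous eigenvalues, the vector of monomials being the eigenvector. The function
  whose values at the points are of interest is \<open>f0 + f1 * z\<close>, with \<open>f0\<close> and \<open>f1\<close> polynomials in \<open>w\<close>.
\<close>

locale point_algebra = numbering ix n
  for ix :: "nat \<Rightarrow> 'n::finite" and n :: nat +
  fixes Wm Zm :: "(nat \<Rightarrow> complex) \<Rightarrow> nat \<Rightarrow> nat \<Rightarrow> complex"
    and p q :: "nat \<Rightarrow> nat"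
    and Pt :: "(nat \<Rightarrow> complex) \<Rightarrow> complex \<Rightarrow> complex \<Rightarrow> bool"
    and f0 f1 :: "(nat \<Rightarrow> complex) \<Rightarrow> complex poly"
    and N :: nat
  assumes polyfun_W: "i < n \<Longrightarrow> j < n \<Longrightarrow> polyfun n (\<lambda>l. Wm l i j)"
    and polyfun_Z: "i < n \<Longrightarrow> j < n \<Longrightarrow> polyfun n (\<lambda>l. Zm l i j)"
    and commute: "i < n \<Longrightarrow> j < n \<Longrightarrow> (\<Sum>k<n. Wm l i k * Zm l k j) = (\<Sum>k<n. Zm l i k * Wm l k j)"
    and basis_0: "p 0 = 0" "q 0 = 0"
    and point_eigen_W: "Pt l w z \<Longrightarrow> i < n \<Longrightarrow> (\<Sum>j<n. Wm l i j * (w ^ p j * z ^ q j)) = w * (w ^ p i * z ^ q i)"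
    and point_eigen_Z: "Pt l w z \<Longrightarrow> i < n \<Longrightarrow> (\<Sum>j<n. Zm l i j * (w ^ p j * z ^ q j)) = z * (w ^ p i * z ^ q i)"
    and eigen_point: "(\<And>i. i < n \<Longrightarrow> (\<Sum>j<n. Wm l i j * u j) = w * u i) \<Longrightarrow>
           (\<And>i. i < n \<Longrightarrow> (\<Sum>j<n. Zm l i j * u j) = z * u i) \<Longrightarrow> k < n \<Longrightarrow> u k \<noteq> 0 \<Longrightarrow> Pt l w z"
    and polyfun_f: "polyfun_coeffs n f0" "polyfun_coeffs n f1"
    and degree_f: "degree (f0 l) \<le> N" "degree (f1 l) \<le> N"
begin

definition W where "W l = matrix_of ix (Wm l)"
definition Z where "Z l = matrix_of ix (Zm l)"
definition T where "T l = matpoly (f0 l) (W l) + matpoly (f1 l) (W l) ** Z l"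
definition pol where "pol l = charpoly (T l)"
definition F where "F l w z = poly (f0 l) w + poly (f1 l) w * z"
definition b :: "complex \<Rightarrow> complex \<Rightarrow> complex^'n" where "b w z = vector_of ix (\<lambda>i. w ^ p i * z ^ q i)"

lemma b_0: "b w z $ ix 0 = 1"
  using n_pos by (simp add: b_def basis_0)

lemma b_nonzero: "b w z \<noteq> 0"
  using b_0 by (metis zero_index zero_neq_one)

lemma W_b: "Pt l w z \<Longrightarrow> W l *v b w z = w *s b w z"
  by (simp add: W_def b_def matrix_of_mult_vec vec_eq_iff all_ix point_eigen_W)

lemma Z_b: "Pt l w z \<Longrightarrow> Z l *v b w z = z *s b w z"
  by (simp add: Z_def b_def matrix_of_mult_vec vec_eq_iff all_ix point_eigen_Z)

lemma T_eigen:
  assumes "W l *v u = w *s u" "Z l *v u = z *s u"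
  shows "T l *v u = F l w z *s u"
proof -
  have "T l *v u = matpoly (f0 l) (W l) *v u + matpoly (f1 l) (W l) *v (Z l *v u)"
    by (simp only: T_def matrix_vector_mult_add_rdistrib matrix_vector_mul_assoc)
  also have "\<dots> = poly (f0 l) w *s u + z *s (poly (f1 l) w *s u)"
    using assms by (simp only: matpoly_eigen[OF assms(1)] assms(2) vector_scalar_commute)
  finally show ?thesis by (simp add: F_def vec_eq_iff algebra_simps)
qed

lemma WZ: "W l ** Z l = Z l ** W l"
  unfolding W_def Z_def by (rule matrix_of_commute) (rule commute)

lemma TW: "T l ** W l = W l ** T l"
proof -
  have "matpoly (f0 l) (W l) ** W l = W l ** matpoly (f0 l) (W l)"
    by (rule matpoly_commute[OF refl, symmetric])
  moreover have "(matpoly (f1 l) (W l) ** Z l) ** W l = W l ** (matpoly (f1 l) (W l) ** Z l)"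
  proof -
    have "(matpoly (f1 l) (W l) ** Z l) ** W l = (matpoly (f1 l) (W l) ** W l) ** Z l"
      by (simp only: matrix_mul_assoc[symmetric] WZ)
    also have "matpoly (f1 l) (W l) ** W l = W l ** matpoly (f1 l) (W l)"
      by (rule matpoly_commute[OF refl, symmetric])
    finally show ?thesis by (simp only: matrix_mul_assoc)
  qed
  ultimately show ?thesis by (simp only: T_def matrix_mult_add_left matrix_add_ldistrib)
qed

lemma TZ: "T l ** Z l = Z l ** T l"
proof -
  have c: "matpoly f (W l) ** Z l = Z l ** matpoly f (W l)" for f
    by (rule matpoly_commute[OF WZ[symmetric], symmetric])
  have "(matpoly (f1 l) (W l) ** Z l) ** Z l = Z l ** (matpoly (f1 l) (W l) ** Z l)"
    by (simp only: matrix_mul_assoc c[of "f1 l", symmetric])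
  then show ?thesis by (simp only: T_def matrix_mult_add_left matrix_add_ldistrib c)
qed

text \<open>
  The eigenspace of \<open>T\<close> for the eigenvalue \<open>c\<close> is mapped to itself by the commuting matrices \<open>W\<close> and \<open>Z\<close>, hence contains a simultaneous
  eigenvector. This is a point, and the value of \<open>F\<close> there is \<open>c\<close>.
\<close>

lemma pol_root_iff: "poly (pol l) c = 0 \<longleftrightarrow> (\<exists>w z. Pt l w z \<and> F l w z = c)"
proof
  assume "\<exists>w z. Pt l w z \<and> F l w z = c"
  then obtain w z where "Pt l w z" "F l w z = c" by blast
  then show "poly (pol l) c = 0"
    unfolding pol_def charpoly_root_iff using T_eigen[OF W_b Z_b] b_nonzero by blast
next
  assume "poly (pol l) c = 0"
  then obtain u where u: "u \<noteq> 0" "T l *v u = c *s u" unfolding pol_def charpoly_root_iff by blast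
  obtain v w where v: "T l *v v = c *s v" "v \<noteq> 0" "W l *v v = w *s v"
    using eigenvector_in_invariant_subspace[of "\<lambda>v. T l *v v = c *s v" u "W l"]
      commuting_preserves_eigenspace[OF TW] u by blast
  obtain v' z where v': "T l *v v' = c *s v' \<and> W l *v v' = w *s v'" "v' \<noteq> 0" "Z l *v v' = z *s v'"
    using eigenvector_in_invariant_subspace[of "\<lambda>v. T l *v v = c *s v \<and> W l *v v = w *s v" v "Z l"]
      commuting_preserves_eigenspace[OF TZ] commuting_preserves_eigenspace[OF WZ] v by blast
  obtain k where k: "k < n" "v' $ ix k \<noteq> 0" using v'(2) by (auto simp: vec_eq_iff all_ix)
  have rowW: "(\<Sum>j<n. Wm l i j * v' $ ix j) = w * v' $ ix i" if "i < n" for i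
    using arg_cong[OF conjunct2[OF v'(1)], of "\<lambda>v. v $ ix i"] that by (simp add: W_def matrix_of_mult_vec)
  have rowZ: "(\<Sum>j<n. Zm l i j * v' $ ix j) = z * v' $ ix i" if "i < n" for i
    using arg_cong[OF v'(3), of "\<lambda>v. v $ ix i"] that by (simp add: Z_def matrix_of_mult_vec)
  have "Pt l w z" by (rule eigen_point[OF rowW rowZ k])
  moreover have "F l w z = c"
  proof -
    have "c *s v' = F l w z *s v'" using T_eigen[of l v' w z] v' by simp
    then show ?thesis using k by (simp add: vec_eq_iff) (metis ix_cases)
  qed
  ultimately show "\<exists>w z. Pt l w z \<and> F l w z = c" by blast
qed

lemma monic_pol: "degree (pol l) = n" "lead_coeff (pol l) = 1"
  using monic_charpoly[of "T l"] card_n by (simp_all add: pol_def)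

lemma polyfun_pol: "polyfun_coeffs n pol"
proof -
  have W: "polyfun n (\<lambda>l. W l $ i $ j)" and Z: "polyfun n (\<lambda>l. Z l $ i $ j)" for i j
    unfolding W_def Z_def by (auto intro: polyfun_matrix_of polyfun_W polyfun_Z)
  have "polyfun n (\<lambda>l. T l $ i $ j)" for i j
    unfolding T_def vector_add_component matrix_matrix_mult_def vec_lambda_beta
    by (intro polyfun.add polyfun_sum polyfun.mult polyfun_matpoly[where N = N] W Z polyfun_f degree_f)
  then show ?thesis unfolding pol_def[abs_def] by (rule polyfun_charpoly)
qed

definition generic :: "(nat \<Rightarrow> complex) \<Rightarrow> bool" where
  "generic l \<longleftrightarrow> card {c. poly (pol l) c = 0} = n \<and> poly (pol l) 0 \<noteq> 0"

text \<open>
  A generic parameter has \<open>n\<close> points with distinct values of \<open>F\<close>; their vectors of monomials are eigenvectors of \<open>T\<close> for distinct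
  eigenvalues.
\<close>

lemma points_separate_basis:
  assumes "generic l" "\<And>w z. Pt l w z \<Longrightarrow> (\<Sum>k<n. a k * (w ^ p k * z ^ q k)) = 0" "k < n"
  shows "a k = 0"
proof -
  let ?R = "{c. poly (pol l) c = 0}"
  have "\<forall>c\<in>?R. \<exists>w z. Pt l w z \<and> F l w z = c" using pol_root_iff by blast
  then obtain w z where wz: "\<And>c. c \<in> ?R \<Longrightarrow> Pt l (w c) (z c) \<and> F l (w c) (z c) = c" by metis
  show ?thesis
  proof (rule eigenbasis_separates[where A = ?R and c = "\<lambda>c. c" and B = "\<lambda>c. b (w c) (z c)" and T = "T l"])
    show "card ?R = n" using assms(1) by (simp add: generic_def)
    show "T l *v b (w c) (z c) = c *s b (w c) (z c)" if "c \<in> ?R" for c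
      using wz[OF that] T_eigen W_b Z_b by metis
    show "(\<Sum>k<n. a k * b (w c) (z c) $ ix k) = 0" if "c \<in> ?R" for c
      using assms(2) wz[OF that] by (simp add: b_def)
  qed (auto simp: b_nonzero assms(3))
qed

text \<open>
  At a generic parameter \<open>T\<close> is diagonalizable with simple eigenvalues, so \<open>W\<close> and \<open>Z\<close> are diagonal in the same basis of point vectors. A
  diagonal matrix has no generalized eigenvectors, which is what \<open>v\<close> would be if \<open>dw\<close> or \<open>dz\<close> were not zero.
\<close>

lemma transversal:
  assumes "generic l" "Pt l w z"
    and "W l *v v = dw *s b w z + w *s v" "Z l *v v = dz *s b w z + z *s v"
  shows "dw = 0 \<and> dz = 0"
proof -
  let ?R = "{c. poly (pol l) c = 0}" and ?c = "F l w z"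
  have c: "?c \<in> ?R" using assms(2) pol_root_iff by blast
  have "\<forall>c\<in>?R. \<exists>w z. Pt l w z \<and> F l w z = c" using pol_root_iff by blast
  then obtain w0 z0 where wz0: "\<And>c. c \<in> ?R \<Longrightarrow> Pt l (w0 c) (z0 c) \<and> F l (w0 c) (z0 c) = c" by metis
  \<comment> \<open>Choose the given point as the representative of its own value.\<close>
  define w' z' where "w' = w0(?c := w)" and "z' = z0(?c := z)"
  have wz: "Pt l (w' c) (z' c) \<and> F l (w' c) (z' c) = c" if "c \<in> ?R" for c
    using wz0[OF that] assms(2) by (auto simp: w'_def z'_def)
  let ?B = "\<lambda>c. b (w' c) (z' c)"
  have card: "card ?R = n" using assms(1) by (simp add: generic_def)
  then have fin: "finite ?R" using n_pos card.infinite by fastforce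
  have TB: "T l *v ?B c = c *s ?B c" if "c \<in> ?R" for c
    using wz[OF that] T_eigen W_b Z_b by metis
  have "\<exists>k. v = (\<Sum>c\<in>?R. k c *s ?B c)"
    by (rule eigenbasis_span[where c = "\<lambda>c. c" and T = "T l", OF card TB]) (auto simp: b_nonzero)
  then obtain k where k: "v = (\<Sum>c\<in>?R. k c *s ?B c)" ..
  have main: "\<delta> = 0" if A: "\<And>c. c \<in> ?R \<Longrightarrow> A *v ?B c = \<mu> c *s ?B c"
    and v: "A *v v = \<delta> *s b w z + \<mu> ?c *s v" for A \<mu> \<delta>
  proof -
    have "A *v v = (\<Sum>c\<in>?R. (k c * \<mu> c) *s ?B c)"
      unfolding k vec.sum using A by (intro sum.cong refl) (simp add: vector_scalar_commute)
    moreover have "b w z = (\<Sum>c\<in>?R. (if c = ?c then 1 else 0) *s ?B c)"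
    proof -
      have "(\<Sum>c\<in>?R. (if c = ?c then 1 else 0) *s ?B c) = (\<Sum>c\<in>?R. if c = ?c then ?B c else 0)"
        by (intro sum.cong) auto
      also have "\<dots> = ?B ?c" using fin c by simp
      also have "\<dots> = b w z" by (simp add: w'_def z'_def)
      finally show ?thesis ..
    qed
    ultimately have "(\<Sum>c\<in>?R. (k c * \<mu> c) *s ?B c)
        = \<delta> *s (\<Sum>c\<in>?R. (if c = ?c then 1 else 0) *s ?B c) + \<mu> ?c *s (\<Sum>c\<in>?R. k c *s ?B c)"
      using v k by simp
    then have "(\<Sum>c\<in>?R. (k c * \<mu> c - \<delta> * (if c = ?c then 1 else 0) - \<mu> ?c * k c) *s ?B c) = 0"
      by (simp add: vec.scale_sum_right vec.scale_left_diff_distrib sum_subtractf)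
    then have "\<forall>c\<in>?R. k c * \<mu> c - \<delta> * (if c = ?c then 1 else 0) - \<mu> ?c * k c = 0"
      by (intro eigenvectors_independent[OF fin TB]) (auto simp: b_nonzero)
    then show ?thesis using c by (auto simp: algebra_simps)
  qed
  have "dw = 0"
    using main[of "W l" w' dw] wz W_b assms(3) by (auto simp: w'_def)
  moreover have "dz = 0"
    using main[of "Z l" z' dz] wz Z_b assms(4) by (auto simp: z'_def)
  ultimately show ?thesis ..
qed

lemma generic_simple_root:
  assumes "generic l" "poly (pol l) c = 0"
  shows "poly (pderiv (pol l)) c \<noteq> 0"
proof -
  have "pol l \<noteq> 0" using monic_pol[of l] by auto
  then show ?thesis using card_roots_eq_degree_iff_pderiv[of "pol l"] assms monic_pol(1)[of l]
    by (auto simp: generic_def)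
qed

text \<open>
  Differentiate \<open>pol (\<gamma> s) (v s) = 0\<close>. The coefficients are stationary along the curve, and the root is simple.
\<close>

lemma critical_value_stationary:
  assumes gen: "generic (\<gamma> 0)"
    and curve: "\<And>i. i < n \<Longrightarrow> ((\<lambda>s. \<gamma> s i) has_field_derivative h i) (at 0)"
    and D: "\<And>j. j < n \<Longrightarrow> (\<Sum>i<n. partial (\<lambda>l. coeff (pol l) j) i (\<gamma> 0) * h i) = 0"
    and v: "\<forall>\<^sub>F s in nhds 0. poly (pol (\<gamma> s)) (v s) = 0" "(v has_field_derivative v') (at 0)"
  shows "v' = 0"
proof -
  have coeff': "((\<lambda>s. coeff (pol (\<gamma> s)) j) has_field_derivative 0) (at 0)" for j
  proof (cases "j < n")
    case True
    then show ?thesis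
      using polyfun_has_field_derivative[of n "\<lambda>l. coeff (pol l) j" \<gamma> h 0] curve polyfun_pol D[OF True]
      by (simp add: polyfun_coeffs_def)
  next
    case False
    then have "coeff (pol (\<gamma> s)) j = (if j = n then 1 else 0)" for s
      using monic_pol[of "\<gamma> s"] by (auto simp: coeff_eq_0)
    then show ?thesis by simp
  qed
  have "((\<lambda>s. \<Sum>j\<le>n. coeff (pol (\<gamma> s)) j * v s ^ j) has_field_derivative
      (\<Sum>j\<le>n. coeff (pol (\<gamma> 0)) j * (of_nat j * v 0 ^ (j - 1) * v'))) (at 0)"
    by (intro DERIV_sum, rule DERIV_cong[OF DERIV_mult'[OF coeff' DERIV_power[OF v(2)]]]) simp
  moreover have "(\<Sum>j\<le>n. coeff (pol (\<gamma> s)) j * v s ^ j) = poly (pol (\<gamma> s)) (v s)" for s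
    using monic_pol(1)[of "\<gamma> s"] by (simp add: poly_altdef)
  moreover have "(\<Sum>j\<le>n. coeff (pol (\<gamma> 0)) j * (of_nat j * v 0 ^ (j - 1) * v'))
      = poly (pderiv (pol (\<gamma> 0))) (v 0) * v'"
  proof -
    obtain m where m: "n = Suc m" using n_pos gr0_conv_Suc by auto
    have "poly (pderiv (pol (\<gamma> 0))) (v 0) = (\<Sum>j\<le>m. coeff (pderiv (pol (\<gamma> 0))) j * v 0 ^ j)"
      using degree_pderiv[of "pol (\<gamma> 0)"] monic_pol(1)[of "\<gamma> 0"] m by (simp add: poly_altdef)
    then show ?thesis unfolding m
      by (simp add: sum.atMost_Suc_shift coeff_pderiv sum_distrib_left mult_ac del: sum.atMost_Suc)
  qed
  ultimately have "((\<lambda>s. poly (pol (\<gamma> s)) (v s)) has_field_derivative poly (pderiv (pol (\<gamma> 0))) (v 0) * v') (at 0)"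
    by simp
  then have "((\<lambda>s. 0) has_field_derivative poly (pderiv (pol (\<gamma> 0))) (v 0) * v') (at 0)"
    using DERIV_cong_ev[OF refl v(1) refl] by blast
  then have "poly (pderiv (pol (\<gamma> 0))) (v 0) * v' = 0" using DERIV_unique DERIV_const by blast
  moreover have "poly (pol (\<gamma> 0)) (v 0) = 0" using eventually_nhds_x_imp_x[OF v(1)] .
  ultimately show ?thesis using generic_simple_root[OF gen] by simp
qed

text \<open>
  The points of a generic parameter are reduced: they do not move along a curve of parameters with zero velocity. Indeed,
  differentiating the eigenvector relations along such a curve yields a generalized eigenvector as in \<open>transversal\<close>.
\<close>

lemma stationary_point:
  assumes gen: "generic (\<gamma> 0)"
    and curve: "\<And>i. i < n \<Longrightarrow> ((\<lambda>s. \<gamma> s i) has_field_derivative 0) (at 0)"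
    and pt: "\<And>s. Pt (\<gamma> s) (w s) (z s)"
    and w: "(w has_field_derivative dw) (at 0)" and z: "(z has_field_derivative dz) (at 0)"
  shows "dw = 0 \<and> dz = 0"
proof -
  define \<beta> where "\<beta> i = w 0 ^ p i * (of_nat (q i) * z 0 ^ (q i - 1) * dz)
      + (of_nat (p i) * w 0 ^ (p i - 1) * dw) * z 0 ^ q i" for i
  have \<beta>: "((\<lambda>s. w s ^ p i * z s ^ q i) has_field_derivative \<beta> i) (at 0)" for i
    unfolding \<beta>_def by (rule derivative_eq_intros w z refl | simp)+
  have row: "(\<Sum>j<n. M (\<gamma> 0) i j * \<beta> j) = \<mu>' * (w 0 ^ p i * z 0 ^ q i) + \<mu> 0 * \<beta> i"
    if M: "\<And>j. j < n \<Longrightarrow> polyfun n (\<lambda>l. M l i j)" and \<mu>: "(\<mu> has_field_derivative \<mu>') (at 0)"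
      and eig: "\<And>s. (\<Sum>j<n. M (\<gamma> s) i j * (w s ^ p j * z s ^ q j)) = \<mu> s * (w s ^ p i * z s ^ q i)"
    for M :: "(nat \<Rightarrow> complex) \<Rightarrow> nat \<Rightarrow> nat \<Rightarrow> complex" and \<mu> \<mu>' i
  proof -
    have "((\<lambda>s. M (\<gamma> s) i j) has_field_derivative 0) (at 0)" if "j < n" for j
      using polyfun_has_field_derivative[OF M[OF that] curve] by simp
    then have "((\<lambda>s. \<Sum>j<n. M (\<gamma> s) i j * (w s ^ p j * z s ^ q j)) has_field_derivative
        (\<Sum>j<n. M (\<gamma> 0) i j * \<beta> j)) (at 0)"
      by (intro DERIV_sum) (rule DERIV_cong[OF DERIV_mult'[OF _ \<beta>]], auto)
    moreover have "((\<lambda>s. \<mu> s * (w s ^ p i * z s ^ q i)) has_field_derivative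
        (\<mu>' * (w 0 ^ p i * z 0 ^ q i) + \<mu> 0 * \<beta> i)) (at 0)"
      by (rule DERIV_cong[OF DERIV_mult'[OF \<mu> \<beta>]]) simp
    ultimately show ?thesis unfolding eig by (rule DERIV_unique)
  qed
  have "W (\<gamma> 0) *v vector_of ix \<beta> = dw *s b (w 0) (z 0) + w 0 *s vector_of ix \<beta>"
    using row[of Wm _ w, OF polyfun_W w point_eigen_W[OF pt]]
    by (simp add: W_def b_def matrix_of_mult_vec vec_eq_iff all_ix)
  moreover have "Z (\<gamma> 0) *v vector_of ix \<beta> = dz *s b (w 0) (z 0) + z 0 *s vector_of ix \<beta>"
    using row[of Zm _ z, OF polyfun_Z z point_eigen_Z[OF pt]]
    by (simp add: Z_def b_def matrix_of_mult_vec vec_eq_iff all_ix)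
  ultimately show ?thesis using transversal[OF gen pt] by blast
qed

end

section \<open>Vanishing of all critical values\<close>

abbreviation X :: "complex poly" where "X \<equiv> [:0, 1:]"

lemma order_eqI:
  fixes G :: "complex poly"
  assumes "P = [:-a, 1:] ^ m * G" "poly G a \<noteq> 0"
  shows "order a P = m"
proof -
  have G: "G \<noteq> 0" using assms(2) by auto
  then have "[:-a, 1:] ^ m * G \<noteq> 0" by simp
  then show ?thesis
    using order_mult[of "[:-a, 1:] ^ m" G a] order_0I[OF assms(2)] by (simp add: assms(1) order_power_n_n)
qed

lemma order_geI: "P \<noteq> 0 \<Longrightarrow> P = [:-a, 1:] ^ m * G \<Longrightarrow> m \<le> order a (P :: complex poly)"
  using order_divides[of a m P] by auto

lemma order_factor:
  assumes "P \<noteq> (0 :: complex poly)"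
  obtains G where "P = [:-a, 1:] ^ order a P * G" "poly G a \<noteq> 0"
  using order_decomp[OF assms, of a] by (metis poly_eq_0_iff_dvd)

lemma root_factor:
  assumes "poly P a = (0::complex)"
  obtains G where "P = [:-a, 1:] * G"
  using assms by (metis poly_eq_0_iff_dvd dvdE)

lemma coeff_eq_0_if_monom_dvd:
  "monom (1::complex) m dvd P \<Longrightarrow> i < m \<Longrightarrow> coeff P i = 0"
  by (auto simp: coeff_monom_mult elim!: dvdE)

text \<open>
  The type II families lead to the function \<open>\<phi> = \<alpha> p(\<alpha>\<^sup>2) - \<beta> q(\<alpha>\<^sup>2) - \<beta>\<^sup>3\<close>. In terms of \<open>X = \<alpha>\<^sup>2\<close>, the polynomial \<open>odd_deriv p\<close> is
  the derivative of \<open>\<alpha> p(\<alpha>\<^sup>2)\<close> with respect to \<open>\<alpha>\<close>.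
\<close>

definition odd_deriv :: "complex poly \<Rightarrow> complex poly" where "odd_deriv p = p + 2 * X * pderiv p"
text \<open>
  Up to sign the discriminant of \<open>\<phi>\<close> as a cubic polynomial in \<open>\<beta>\<close>; it vanishes at the critical points on the zero fibre of \<open>\<phi>\<close>.
\<close>

definition cubic_discr :: "complex poly \<Rightarrow> complex poly \<Rightarrow> complex poly" where "cubic_discr p q = 27 * X * p^2 + 4 * q^3"
text \<open>
  The result of eliminating \<open>z\<close> from the equations \<open>odd_deriv p = 2 * z * pderiv q\<close> and \<open>3 * z\<^sup>2 = - X * q\<close> of the critical points.
\<close>

definition eliminant :: "complex poly \<Rightarrow> complex poly \<Rightarrow> complex poly" where
  "eliminant p q = 3 * (odd_deriv p)^2 + 4 * X * q * (pderiv q)^2"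
text \<open>
  Up to the factor \<open>27 * p * q\<^sup>2\<close> the Wronskian of \<open>q\<^sup>3\<close> and the discriminant.
\<close>

definition wronsk :: "complex poly \<Rightarrow> complex poly \<Rightarrow> complex poly" where
  "wronsk p q = 3 * X * p * pderiv q - q * odd_deriv p"

lemma pderiv_numeral_mult: "pderiv (numeral k * p) = numeral k * pderiv (p :: complex poly)"
  by (metis numeral_mult_conv_smult pderiv_smult)

lemma pderiv_X: "pderiv X = 1" by (simp add: pderiv_pCons)

lemma pderiv_cubic_discr: "pderiv (cubic_discr p q) = 27 * p * odd_deriv p + 12 * q^2 * pderiv q"
  unfolding cubic_discr_def odd_deriv_def power2_eq_square power3_eq_cube
  by (simp only: pderiv_add pderiv_mult pderiv_numeral pderiv_X) algebra

lemma wronsk_identity: "3 * pderiv q * cubic_discr p q - q * pderiv (cubic_discr p q) = 27 * p * wronsk p q"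
  unfolding pderiv_cubic_discr unfolding cubic_discr_def wronsk_def by algebra

text \<open>
  The eliminant in terms of two polynomials whose order at a critical point on the zero fibre is under control.
\<close>

lemma eliminant_identity: "q^2 * eliminant p q = X * (pderiv q)^2 * cubic_discr p q - 18 * X * p * pderiv q * wronsk p q + 3 * (wronsk p q)^2"
  unfolding eliminant_def cubic_discr_def wronsk_def by algebra

lemma pderiv_linear_power_factor:
  "pderiv ([:-a, 1:] ^ Suc m * \<delta>) = [:-a, 1:] ^ m * (of_nat (Suc m) * \<delta> + [:-a, 1:] * pderiv (\<delta> :: complex poly))"
proof -
  have s: "smult (of_nat k) P = of_nat k * P" for k and P :: "complex poly"
    by (simp add: of_nat_poly)
  have y': "pderiv [:-a, 1:] = 1" by (simp add: pderiv_pCons)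
  have "pderiv ([:-a, 1:] ^ Suc m * \<delta>) = [:-a, 1:] ^ Suc m * pderiv \<delta> + \<delta> * (of_nat (Suc m) * [:-a, 1:] ^ m)"
    by (simp only: pderiv_mult pderiv_power_Suc s y' mult_1_right)
  then show ?thesis by (simp only: power_Suc distrib_left mult_ac add_ac)
qed

text \<open>
  Let \<open>m + 1\<close> be the order of the discriminant \<open>D\<close> at \<open>a\<close>. By \<open>wronsk_identity\<close> the order of \<open>K = wronsk p q\<close> is exactly \<open>m\<close>, and \<open>m > 0\<close>
  because \<open>K\<close> vanishes at \<open>a\<close>. The three terms in \<open>eliminant_identity\<close> then have orders at least \<open>m + 1\<close>, exactly \<open>m\<close>, and exactly \<open>2 * m\<close>, so
  the middle one decides.
\<close>

lemma order_eliminant_nondegenerate: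
  assumes a: "a \<noteq> 0" and nz: "poly p a \<noteq> 0" "poly q a \<noteq> 0" "poly (pderiv q) a \<noteq> 0"
    and D: "cubic_discr p q \<noteq> 0" "poly (cubic_discr p q) a = 0" and K: "poly (wronsk p q) a = 0"
  shows "order a (eliminant p q) + 1 = order a (cubic_discr p q) \<and> order a (wronsk p q) = order a (eliminant p q) \<and> wronsk p q \<noteq> 0"
proof -
  let ?y = "[:-a, 1:]"
  have "order a (cubic_discr p q) \<noteq> 0" using D by (simp add: order_root)
  then obtain m where m: "order a (cubic_discr p q) = Suc m" by (metis not0_implies_Suc)
  obtain \<delta> where \<delta>: "cubic_discr p q = ?y ^ Suc m * \<delta>" "poly \<delta> a \<noteq> 0"
    using order_factor[OF D(1), of a] m by metis
  define h where "h = 3 * ?y * pderiv q * \<delta> - of_nat (Suc m) * q * \<delta> - ?y * q * pderiv \<delta>"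
  have ha: "poly h a \<noteq> 0" using nz \<delta>(2) by (simp add: h_def) (metis of_nat_Suc of_nat_neq_0)
  have pK: "27 * p * wronsk p q = ?y ^ m * h"
    unfolding wronsk_identity[symmetric] h_def unfolding \<delta>(1) pderiv_linear_power_factor
    by (simp add: algebra_simps)
  have "poly (27 * p * wronsk p q) a = 0" using K by simp
  then have m0: "m \<noteq> 0" using ha unfolding pK by (cases m) auto
  define g where "g = ?y * X * (pderiv q)^2 * \<delta> * (27 * p)^2 - 18 * X * p * pderiv q * 27 * p * h + 3 * ?y ^ m * h^2"
  have "(27 * p)^2 * (q^2 * eliminant p q) = X * (pderiv q)^2 * cubic_discr p q * (27 * p)^2
      - 18 * X * p * pderiv q * (27 * p) * (27 * p * wronsk p q) + 3 * (27 * p * wronsk p q)^2"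
    unfolding eliminant_identity by (simp add: algebra_simps power2_eq_square)
  also have "\<dots> = ?y ^ m * g"
    unfolding pK \<delta>(1) g_def by (simp add: algebra_simps power2_eq_square)
  finally have "(27 * p)^2 * q^2 * eliminant p q = ?y ^ m * g" by (simp add: mult.assoc)
  moreover have "poly g a \<noteq> 0" using nz a ha m0 by (simp add: g_def power_0_left)
  ultimately have ord: "order a ((27 * p)^2 * q^2 * eliminant p q) = m" by (intro order_eqI)
  have E0: "eliminant p q \<noteq> 0" using \<open>(27 * p)^2 * q^2 * eliminant p q = ?y ^ m * g\<close> \<open>poly g a \<noteq> 0\<close> by auto
  have "order a ((27 * p)^2 * q^2 * eliminant p q) = order a ((27 * p)^2 * q^2) + order a (eliminant p q)"
    using E0 nz by (intro order_mult) auto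
  also have "order a ((27 * p)^2 * q^2) = 0" using nz by (intro order_0I) simp
  finally have oE: "order a (eliminant p q) = m" using ord by simp
  have K0: "wronsk p q \<noteq> 0" using pK ha by auto
  have "order a (27 * p * wronsk p q) = m" using pK ha by (rule order_eqI)
  moreover have "order a (27 * p * wronsk p q) = order a (27 * p) + order a (wronsk p q)"
    using K0 nz by (intro order_mult) auto
  moreover have "order a (27 * p) = 0" using nz by (intro order_0I) simp
  ultimately show ?thesis using oE m K0 by simp
qed

lemma degree_le_1_root:
  assumes "degree (P :: complex poly) \<le> 1" "poly P a = 0"
  obtains c where "P = [:c:] * [:-a, 1:]"
proof -
  obtain G where G: "P = [:-a, 1:] * G" using assms(2) by (rule root_factor)
  have "degree G = 0"
  proof (cases "G = 0")
    case False
    then have "degree P = 1 + degree G" unfolding G by (subst degree_mult_eq) auto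
    then show ?thesis using assms(1) by simp
  qed simp
  then obtain c where "G = [:c:]" by (rule degree_eq_zeroE)
  with G show ?thesis using that by (simp add: mult.commute)
qed

lemma degree_linear_factor:
  assumes "degree ([:-a, 1:] * G :: complex poly) \<le> Suc k" shows "degree G \<le> k"
proof (cases "G = 0")
  case False
  then have "degree ([:-a, 1:] * G) = 1 + degree G" by (subst degree_mult_eq) auto
  with assms show ?thesis by simp
qed simp

text \<open>
  A common root of \<open>p\<close>, \<open>q\<close> and the eliminant is a double root of \<open>p\<close>. As the degrees of \<open>p\<close> and \<open>q\<close> are at most three and two, this leaves
  four cases, according to the order of \<open>q\<close>, that of \<open>p\<close>, and a possible cancellation of leading terms.
\<close>

lemma order_eliminant_common_root:
  assumes a: "a \<noteq> 0" and p: "poly p a = 0" "degree p \<le> 3" and q: "poly q a = 0" "degree q \<le> 2"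
    and E: "poly (eliminant p q) a = 0" "eliminant p q \<noteq> 0" and D: "cubic_discr p q \<noteq> 0"
  shows "order a (eliminant p q) + 2 \<le> order a (cubic_discr p q)"
proof -
  let ?y = "[:-a, 1:]"
  have y': "pderiv ?y = 1" by (simp add: pderiv_pCons)
  obtain p1 where p1: "p = ?y * p1" using p(1) by (rule root_factor)
  have "poly (pderiv p) a = 0" using E(1) p(1) q(1) a by (simp add: eliminant_def odd_deriv_def)
  then have "poly p1 a = 0" unfolding p1 pderiv_mult y' by simp
  then obtain p2 where "p1 = ?y * p2" by (rule root_factor)
  then have p2: "p = ?y * (?y * p2)" using p1 by simp
  have dp2: "degree p2 \<le> 1" using p(2) unfolding p2 by (metis degree_linear_factor numeral_3_eq_3 One_nat_def)
  obtain q1 where q1: "q = ?y * q1" using q(1) by (rule root_factor)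
  have dq1: "degree q1 \<le> 1" using q(2) unfolding q1 by (metis degree_linear_factor numeral_2_eq_2 One_nat_def)
  define r2 where "r2 = (?y + 4 * X) * p2 + 2 * X * ?y * pderiv p2"
  have r: "odd_deriv p = ?y * r2" unfolding odd_deriv_def r2_def p2 pderiv_mult y' by algebra
  \<comment> \<open>A simple root of \<open>q\<close>: the orders are one and at least three.\<close>
  show ?thesis
  proof (cases "poly q1 a = 0")
    case False
    define G where "G = 3 * ?y * r2^2 + 4 * X * q1 * (q1 + ?y * pderiv q1)^2"
    have "eliminant p q = ?y ^ 1 * G"
      unfolding eliminant_def r G_def unfolding q1 pderiv_mult y' by algebra
    moreover have "poly G a \<noteq> 0" using False a by (simp add: G_def)
    ultimately have "order a (eliminant p q) = 1" by (rule order_eqI)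
    moreover have "cubic_discr p q = ?y ^ 3 * (27 * X * ?y * p2^2 + 4 * q1^3)"
      unfolding cubic_discr_def p2 q1 by algebra
    then have "3 \<le> order a (cubic_discr p q)" using order_geI[OF D] by blast
    ultimately show ?thesis by simp
  next
    case True
    then obtain c where c: "q1 = [:c:] * ?y" using degree_le_1_root[OF dq1] by blast
    have q: "q = [:c:] * ?y ^ 2" unfolding q1 c by (simp only: power2_eq_square mult_ac)
    have q': "pderiv q = 2 * [:c:] * ?y"
    proof -
      have "pderiv [:c:] = 0" by simp
      then show ?thesis unfolding q power2_eq_square pderiv_mult y' by algebra
    qed
    have Eq: "eliminant p q = ?y ^ 2 * (3 * r2^2 + 16 * [:c:]^3 * X * ?y^2)"
      unfolding eliminant_def r unfolding q' unfolding q by algebra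
    have Dq: "cubic_discr p q = ?y ^ 4 * (27 * X * p2^2 + 4 * [:c:]^3 * ?y^2)"
      unfolding cubic_discr_def p2 q by algebra
    \<comment> \<open>Double roots of \<open>p\<close> and \<open>q\<close>: the orders are two and at least four, unless \<open>p\<close> has a triple root.\<close>
    show ?thesis
    proof (cases "poly p2 a = 0")
      case False
      have "order a (eliminant p q) = 2" using Eq by (rule order_eqI) (use False a in \<open>simp add: r2_def\<close>)
      moreover have "4 \<le> order a (cubic_discr p q)" using order_geI[OF D Dq] .
      ultimately show ?thesis by simp
    next
      case True
      then obtain d where d: "p2 = [:d:] * ?y" using degree_le_1_root[OF dp2] by blast
      have p2': "pderiv p2 = [:d:]" unfolding d by (simp add: pderiv_pCons)
      have r2: "r2 = ?y * [:d:] * (?y + 6 * X)" unfolding r2_def p2' unfolding d by algebra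
      have Er: "eliminant p q = ?y ^ 4 * (3 * [:d:]^2 * (?y + 6 * X)^2 + 16 * [:c:]^3 * X)"
        unfolding Eq r2 by algebra
      have Dr: "cubic_discr p q = ?y ^ 6 * (27 * X * [:d:]^2 + 4 * [:c:]^3)"
        unfolding Dq d by algebra
      \<comment> \<open>Now \<open>p\<close> and \<open>q\<close> are determined by their leading coefficients \<open>d\<close> and \<open>c\<close>. The orders are four and at
        least six, or five and at least seven if the leading terms cancel.\<close>
      show ?thesis
      proof (cases "27 * a * d^2 + 4 * c^3 = 0")
        case False
        have "order a (eliminant p q) = 4" using Er
        proof (rule order_eqI)
          have "poly (3 * [:d:]^2 * (?y + 6 * X)^2 + 16 * [:c:]^3 * X) a = 4 * a * (27 * a * d^2 + 4 * c^3)"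
            by (simp add: algebra_simps power2_eq_square power3_eq_cube)
          then show "poly (3 * [:d:]^2 * (?y + 6 * X)^2 + 16 * [:c:]^3 * X) a \<noteq> 0" using False a by simp
        qed
        moreover have "6 \<le> order a (cubic_discr p q)" using order_geI[OF D Dr] .
        ultimately show ?thesis by simp
      next
        case True
        then have c3: "4 * c^3 = - 27 * a * d^2" by (simp add: add_eq_0_iff2)
        have "d \<noteq> 0"
        proof
          assume "d = 0"
          then have "c = 0" using c3 by simp
          then show False using D \<open>d = 0\<close> unfolding Dr by simp
        qed
        have C3: "4 * [:c:]^3 = - 27 * [:a:] * [:d:]^2"
        proof -
          have "4 * [:c:]^3 = [:4 * c^3:]" by (simp add: power3_eq_cube numeral_poly mult_ac)
          also have "\<dots> = - 27 * [:a:] * [:d:]^2"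
            unfolding c3 by (simp add: power2_eq_square numeral_poly mult_ac)
          finally show ?thesis .
        qed
        have X: "X = ?y + [:a:]" by simp
        have "cubic_discr p q = ?y ^ 7 * (27 * [:d:]^2)" using C3 X unfolding Dr by algebra
        then have "7 \<le> order a (cubic_discr p q)" by (rule order_geI[OF D])
        moreover have "order a (eliminant p q) = 5"
        proof (rule order_eqI)
          show "eliminant p q = ?y ^ 5 * (3 * [:d:]^2 * (49 * X - [:a:]))" using C3 X unfolding Er by algebra
          show "poly (3 * [:d:]^2 * (49 * X - [:a:])) a \<noteq> 0" using \<open>d \<noteq> 0\<close> a by simp
        qed
        ultimately show ?thesis by simp
      qed
    qed
  qed
qed

text \<open>
  At the origin the variable \<open>X\<close> itself contributes to the orders. After dividing the discriminant by \<open>X\<^sup>3\<close> and the eliminant by \<open>X\<^sup>2\<close>, with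
  quotients \<open>G\<close> and \<open>E1\<close>, one has to show that the order of \<open>E1\<close> does not exceed that of \<open>G\<close>. If \<open>G\<close> vanishes but \<open>q1\<close> does not, this rests
  on an identity like \<open>eliminant_identity\<close>, in which now the terms with \<open>G\<close> and its derivative decide; otherwise it is a matter of
  inspecting low degrees.
\<close>

lemma order_eliminant_origin:
  assumes p: "poly p 0 = 0" "degree p \<le> 3" and q: "poly q 0 = 0" "degree q \<le> 2"
    and E: "eliminant p q \<noteq> 0" and D: "cubic_discr p q \<noteq> 0"
  shows "order 0 (eliminant p q) + 1 \<le> order 0 (cubic_discr p q)"
proof -
  have y: "[:-0, 1:] = X" by simp
  obtain p1 where p1: "p = X * p1" using root_factor[OF p(1)] by auto
  obtain q1 where q1: "q = X * q1" using root_factor[OF q(1)] by auto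
  have dp1: "degree p1 \<le> 2" using p(2) degree_linear_factor[of 0 p1 2] p1 by simp
  have dq1: "degree q1 \<le> 1" using q(2) degree_linear_factor[of 0 q1 1] q1 by simp
  define G where "G = 27 * p1^2 + 4 * q1^3"
  define E1 where "E1 = 3 * (3 * p1 + 2 * X * pderiv p1)^2 + 4 * q1 * (q1 + X * pderiv q1)^2"
  have D1: "cubic_discr p q = X ^ 3 * G" unfolding cubic_discr_def G_def p1 q1 by algebra
  have E1: "eliminant p q = X ^ 2 * E1"
    unfolding eliminant_def odd_deriv_def E1_def p1 q1 pderiv_mult pderiv_X by algebra
  have G0: "G \<noteq> 0" and E0: "E1 \<noteq> 0" using D E D1 E1 by auto
  have shift: "order 0 (X ^ k * P) = k + order 0 P" if "P \<noteq> 0" for k P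
    using order_mult[of "X ^ k" P 0] order_power_n_n[of 0 k] that by simp
  have "order 0 E1 \<le> order 0 G"
  proof (cases "poly G 0 = 0")
    case False
    then have "poly E1 0 \<noteq> 0" by (simp add: G_def E1_def power2_eq_square power3_eq_cube algebra_simps)
    then show ?thesis by (simp add: order_0I)
  next
    case G00: True
    show ?thesis
    proof (cases "poly q1 0 = 0")
      case False
      then have p10: "poly p1 0 \<noteq> 0" using G00 by (auto simp: G_def)
      have "order 0 G \<noteq> 0" using G00 G0 by (simp add: order_root)
      then obtain m where m: "order 0 G = Suc m" by (metis not0_implies_Suc)
      obtain g where g: "G = X ^ Suc m * g" "poly g 0 \<noteq> 0"
        using order_factor[OF G0, of 0] m by auto
      define k where "k = 3 * p1 * pderiv q1 - 2 * q1 * pderiv p1"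
      define h where "h = 3 * X * pderiv q1 * g - q1 * (of_nat (Suc m) * g + X * pderiv g)"
      have G': "pderiv G = X ^ m * (of_nat (Suc m) * g + X * pderiv g)"
        using pderiv_linear_power_factor[of 0 m g] g(1) by simp
      have G'': "pderiv G = 54 * p1 * pderiv p1 + 12 * q1^2 * pderiv q1"
        unfolding G_def by (simp add: pderiv_add pderiv_mult pderiv_numeral_mult power2_eq_square power3_eq_cube algebra_simps)
      have "27 * p1 * k = 3 * pderiv q1 * G - q1 * pderiv G"
        unfolding k_def G'' unfolding G_def by algebra
      also have "\<dots> = X ^ m * h" unfolding G' unfolding g(1) h_def by (simp add: algebra_simps)
      finally have pk: "27 * p1 * k = X ^ m * h" .
      have id: "3 * q1^2 * E1 = 3 * q1^2 * G + 2 * X * q1^2 * pderiv G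
          + 3 * X^2 * ((pderiv q1)^2 * G - 18 * p1 * pderiv q1 * k + 3 * k^2)"
        unfolding G'' unfolding E1_def G_def k_def by algebra
      define H where "H = (27 * p1)^2 * (3 * q1^2 * g + 2 * q1^2 * (of_nat (Suc m) * g + X * pderiv g)
          + 3 * X^2 * (pderiv q1)^2 * g) + 3 * X * (3 * X ^ m * h^2 - 18 * p1 * pderiv q1 * 27 * p1 * h)"
      have "(27 * p1)^2 * (3 * q1^2 * E1) = (27 * p1)^2 * (3 * q1^2 * G + 2 * X * q1^2 * pderiv G
          + 3 * X^2 * ((pderiv q1)^2 * G)) + 3 * X^2 * (3 * (27 * p1 * k)^2 - 18 * p1 * pderiv q1 * (27 * p1) * (27 * p1 * k))"
        unfolding id by algebra
      also have "\<dots> = X ^ Suc m * H"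
        unfolding pk G' unfolding g(1) H_def by (simp add: algebra_simps power2_eq_square)
      finally have *: "(27 * p1)^2 * (3 * q1^2 * E1) = [:-0, 1:] ^ Suc m * H" by simp
      \<comment> \<open>The order \<open>Suc m\<close> contributes \<open>3 + 2 * (m + 1)\<close>, which is not zero.\<close>
      have "poly H 0 = 729 * poly p1 0 ^ 2 * poly q1 0 ^ 2 * poly g 0 * (5 + 2 * of_nat m)"
        by (simp add: H_def algebra_simps power2_eq_square)
      moreover have "(5 + 2 * of_nat m :: complex) \<noteq> 0"
        by (metis of_nat_0_neq of_nat_Suc of_nat_add of_nat_mult of_nat_numeral add_eq_0_iff_both_eq_0 numeral_neq_zero of_nat_eq_0_iff)
      ultimately have "poly H 0 \<noteq> 0" using p10 False g(2) by simp
      then have "order 0 ((27 * p1)^2 * (3 * q1^2 * E1)) = Suc m" using * by (intro order_eqI)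
      moreover have "(27 * p1)^2 * (3 * q1^2 * E1) = ((27 * p1)^2 * (3 * q1^2)) * E1" by (simp add: mult.assoc)
      moreover have "order 0 (((27 * p1)^2 * (3 * q1^2)) * E1) = order 0 ((27 * p1)^2 * (3 * q1^2)) + order 0 E1"
        using E0 p10 False by (intro order_mult) auto
      moreover have "order 0 ((27 * p1)^2 * (3 * q1^2)) = 0" using p10 False by (intro order_0I) simp
      ultimately show ?thesis using m by (metis add.left_neutral order_refl)
    next
      case True
      then have "poly p1 0 = 0" using G00 by (simp add: G_def)
      then obtain p2 where p2: "p1 = X * p2" using root_factor[of p1 0] by auto
      obtain c where c: "q1 = [:c:] * X" using degree_le_1_root[OF dq1 True] by auto
      have dp2: "degree p2 \<le> 1" using degree_linear_factor[of 0 p2 1] dp1 p2 by simp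
      have q1': "pderiv q1 = [:c:]" unfolding c by (simp add: pderiv_pCons)
      have G2: "G = X ^ 2 * (27 * p2^2 + 4 * [:c:]^3 * X)" unfolding G_def p2 c by algebra
      have E2: "E1 = X ^ 2 * (3 * (5 * p2 + 2 * X * pderiv p2)^2 + 16 * [:c:]^3 * X)"
        unfolding E1_def q1' unfolding p2 c pderiv_mult pderiv_X by algebra
      show ?thesis
      proof (cases "poly p2 0 = 0")
        case False
        have "order 0 E1 = 2" by (rule order_eqI[where G = "3 * (5 * p2 + 2 * X * pderiv p2)^2 + 16 * [:c:]^3 * X"])
          (use E2 False in auto)
        moreover have "2 \<le> order 0 G" using order_geI[OF G0, of 0 2] G2 by simp
        ultimately show ?thesis by simp
      next
        case True
        then obtain d where d: "p2 = [:d:] * X" using degree_le_1_root[OF dp2 True] by auto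
        have p2': "pderiv p2 = [:d:]" unfolding d by (simp add: pderiv_pCons)
        have G3: "G = X ^ 3 * (27 * [:d:]^2 * X + 4 * [:c:]^3)" unfolding G2 d by algebra
        have E3: "E1 = X ^ 3 * (147 * [:d:]^2 * X + 16 * [:c:]^3)" unfolding E2 p2' unfolding d by algebra
        show ?thesis
        proof (cases "c = 0")
          case False
          have "order 0 E1 = 3" by (rule order_eqI[where G = "147 * [:d:]^2 * X + 16 * [:c:]^3"])
            (use E3 False in auto)
          moreover have "3 \<le> order 0 G" using order_geI[OF G0, of 0 3] G3 by simp
          ultimately show ?thesis by simp
        next
          case True
          then have "d \<noteq> 0" using G3 G0 by auto
          have zero: "(0 :: complex poly) ^ 3 = 0" by simp
          have "order 0 E1 = 4"
          proof (rule order_eqI)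
            show "E1 = [:-0, 1:] ^ 4 * (147 * [:d:]^2)" unfolding E3 True y pCons_0_0 zero by algebra
            show "poly (147 * [:d:]^2) 0 \<noteq> 0" using \<open>d \<noteq> 0\<close> by simp
          qed
          moreover have "4 \<le> order 0 G"
          proof (rule order_geI[OF G0])
            show "G = [:-0, 1:] ^ 4 * (27 * [:d:]^2)" unfolding G3 True y pCons_0_0 zero by algebra
          qed
          ultimately show ?thesis by simp
        qed
      qed
    qed
  qed
  then show ?thesis unfolding D1 E1 using shift[OF G0] shift[OF E0] by simp
qed

text \<open>
  The hypothesis \<open>F\<close> says that the function vanishes at all critical points with \<open>w = a\<close>. If \<open>q'(a) \<noteq> 0\<close>, the equations determine \<open>z\<close>, and the
  value, multiplied by \<open>a\<close>, is three times the square of \<open>3 * a * p(a) - 2 * z * q(a)\<close>; its vanishing means that the discriminant and the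
  Wronskian vanish too. If \<open>q'(a) = 0\<close>, both signs of \<open>z\<close> occur, and comparing the two values gives \<open>p(a) = q(a) = 0\<close>.
\<close>

lemma critical_points_on_zero_fibre:
  assumes a: "a \<noteq> 0" "poly (eliminant p q) a = 0"
    and F: "\<And>z. poly (odd_deriv p) a = 2 * z * poly (pderiv q) a \<Longrightarrow> 3 * z^2 = - a * poly q a \<Longrightarrow>
        27 * a * poly p a ^ 2 - 36 * poly p a * poly q a * z - 4 * poly q a ^ 3 = 0"
  shows "(poly p a = 0 \<and> poly q a = 0) \<or>
    (poly p a \<noteq> 0 \<and> poly q a \<noteq> 0 \<and> poly (pderiv q) a \<noteq> 0 \<and> poly (cubic_discr p q) a = 0 \<and> poly (wronsk p q) a = 0)"
proof -
  define P Q Q' R where "P = poly p a" and "Q = poly q a" and "Q' = poly (pderiv q) a" and "R = poly (odd_deriv p) a"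
  have E: "3 * R^2 + 4 * a * Q * Q'^2 = 0" using a(2) by (simp add: eliminant_def R_def Q_def Q'_def mult_ac)
  have F': "27 * a * P^2 - 36 * P * Q * z - 4 * Q^3 = 0" if "R = 2 * z * Q'" "3 * z^2 = - a * Q" for z
    using F[of z] that unfolding P_def Q_def Q'_def R_def .
  have cubic_discr: "poly (cubic_discr p q) a = 27 * a * P^2 + 4 * Q^3" by (simp add: cubic_discr_def P_def Q_def)
  have wronsk: "poly (wronsk p q) a = 3 * a * P * Q' - Q * R" by (simp add: wronsk_def P_def Q_def Q'_def R_def)
  have "(P = 0 \<and> Q = 0) \<or> (P \<noteq> 0 \<and> Q \<noteq> 0 \<and> Q' \<noteq> 0 \<and> 27 * a * P^2 + 4 * Q^3 = 0 \<and> 3 * a * P * Q' - Q * R = 0)"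
  proof (cases "Q' = 0")
    case True
    then have R: "R = 0" using E by simp
    define z where "z = csqrt (- a * Q / 3)"
    have z: "3 * z^2 = - a * Q" by (simp add: z_def)
    have 1: "27 * a * P^2 - 36 * P * Q * z - 4 * Q^3 = 0" using F'[of z] R True z by simp
    have 2: "27 * a * P^2 + 36 * P * Q * z - 4 * Q^3 = 0" using F'[of "-z"] R True z by simp
    have "P * Q * z = 0" using 1 2 by algebra
    moreover have "Q = 0" if "z = 0" using z that a(1) by simp
    ultimately have "P = 0 \<or> Q = 0" by auto
    then show ?thesis using 1 a(1) by auto
  next
    case False
    define z where "z = R / (2 * Q')"
    have R: "R = 2 * z * Q'" using False by (simp add: z_def)
    have "Q'^2 * (3 * z^2 + a * Q) = 0" using E R by algebra
    then have "3 * z^2 + a * Q = 0" using False by simp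
    then have z: "3 * z^2 = - a * Q" by algebra
    note F0 = F'[OF R z]
    have "3 * (3 * a * P - 2 * z * Q)^2 = 0" using F0 z by algebra
    then have zQ: "3 * a * P = 2 * z * Q" by simp
    have "a * (27 * a * P^2 + 4 * Q^3) = 0" using zQ z by algebra
    then have D: "27 * a * P^2 + 4 * Q^3 = 0" using a(1) by simp
    have K: "3 * a * P * Q' - Q * R = 0" using zQ R by algebra
    show ?thesis using D K False a(1) by (cases "P = 0"; cases "Q = 0") auto
  qed
  then show ?thesis unfolding cubic_discr wronsk P_def Q_def Q'_def by simp
qed

text \<open>
  A count of multiplicities in the style of the Mason--Stothers theorem. If all critical values vanish, then at every root of
  the eliminant the order of the discriminant is larger by at least one. Since the degrees differ by at most one, the eliminant has a single root
  \<open>a\<close>, where both polynomials have all their roots. For \<open>a \<noteq> 0\<close> either the order of the discriminant is larger by two, or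
  the Wronskian has order \<open>\<tau>\<close>, more than its degree; both are impossible. Hence \<open>a = 0\<close>.
\<close>

lemma nilpotent_imp_discriminant_monomial:
  assumes deg: "degree p \<le> 3" "degree q \<le> 2" "degree (eliminant p q) = \<tau>" "\<tau> > 0" "degree (cubic_discr p q) \<le> Suc \<tau>"
      "degree (wronsk p q) < \<tau>" and D: "cubic_discr p q \<noteq> 0"
    and F: "\<And>w z. poly (odd_deriv p) w = 2 * z * poly (pderiv q) w \<Longrightarrow> 3 * z^2 = - w * poly q w \<Longrightarrow>
        27 * w * poly p w ^ 2 - 36 * poly p w * poly q w * z - 4 * poly q w ^ 3 = 0"
  shows "poly p 0 = 0 \<and> poly q 0 = 0 \<and> (\<forall>j\<le>\<tau>. coeff (cubic_discr p q) j = 0)"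
proof -
  let ?S = "{x. poly (eliminant p q) x = 0}"
  have E: "eliminant p q \<noteq> 0" using deg by auto
  have origin: "poly p 0 = 0 \<and> poly q 0 = 0" if "0 \<in> ?S"
  proof -
    have "poly p 0 = 0" using that by (simp add: eliminant_def odd_deriv_def)
    then show ?thesis using F[of 0 0] by (simp add: odd_deriv_def)
  qed
  have step: "order x (eliminant p q) + 1 \<le> order x (cubic_discr p q)" if x: "x \<in> ?S" for x
  proof (cases "x = 0")
    case True
    then show ?thesis using order_eliminant_origin[of p q] deg E D origin x by auto
  next
    case False
    have "(poly p x = 0 \<and> poly q x = 0) \<or>
      (poly p x \<noteq> 0 \<and> poly q x \<noteq> 0 \<and> poly (pderiv q) x \<noteq> 0 \<and> poly (cubic_discr p q) x = 0 \<and> poly (wronsk p q) x = 0)"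
      using critical_points_on_zero_fibre[OF False] x F by blast
    then show ?thesis
      using order_eliminant_common_root[of x p q] order_eliminant_nondegenerate[of x p q] False deg x E D by auto
  qed
  have fin: "finite ?S" using E by (rule poly_roots_finite)
  have "(\<Sum>x\<in>?S. order x (eliminant p q)) = \<tau>" using sum_order_roots[OF E] deg by simp
  then have "\<tau> + card ?S = (\<Sum>x\<in>?S. order x (eliminant p q) + 1)"
    by (subst sum.distrib) simp
  also have "\<dots> \<le> (\<Sum>x\<in>?S. order x (cubic_discr p q))" by (intro sum_mono step)
  also have sumD: "\<dots> \<le> (\<Sum>x | poly (cubic_discr p q) x = 0. order x (cubic_discr p q))"
  proof (rule sum_mono2)
    show "?S \<subseteq> {x. poly (cubic_discr p q) x = 0}" using step D by (fastforce simp: order_root)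
  qed (use D in \<open>auto intro: poly_roots_finite\<close>)
  also have "\<dots> \<le> Suc \<tau>" using sum_order_le_degree[OF D] deg by simp
  finally have card1: "card ?S \<le> 1" by simp
  have "\<not> constant (poly (eliminant p q))" using deg by (simp add: constant_degree)
  then obtain a where a: "a \<in> ?S" using fundamental_theorem_of_algebra by blast
  have S: "?S = {a}" using card1 a fin card_le_Suc0_iff_eq[OF fin] by auto
  have oE: "order a (eliminant p q) = \<tau>" using sum_order_roots[OF E] deg unfolding S by simp
  have "order a (cubic_discr p q) \<le> Suc \<tau>" using order_degree[OF D, of a] deg by simp
  then have oD: "order a (cubic_discr p q) = Suc \<tau>" using step[OF a] oE by simp
  have "a = 0"
  proof (rule ccontr)
    assume a0: "a \<noteq> 0"
    have "(poly p a = 0 \<and> poly q a = 0) \<or>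
      (poly p a \<noteq> 0 \<and> poly q a \<noteq> 0 \<and> poly (pderiv q) a \<noteq> 0 \<and> poly (cubic_discr p q) a = 0 \<and> poly (wronsk p q) a = 0)"
      using critical_points_on_zero_fibre[OF a0] a F by blast
    then show False
    proof
      assume "poly p a = 0 \<and> poly q a = 0"
      then show False using order_eliminant_common_root[of a p q] a0 deg a E D oE oD by auto
    next
      assume *: "poly p a \<noteq> 0 \<and> poly q a \<noteq> 0 \<and> poly (pderiv q) a \<noteq> 0 \<and> poly (cubic_discr p q) a = 0 \<and> poly (wronsk p q) a = 0"
      then have "order a (wronsk p q) = \<tau>" "wronsk p q \<noteq> 0"
        using order_eliminant_nondegenerate[of a p q] a0 D oE by auto
      then show False using order_degree[of "wronsk p q" a] deg(6) by simp
    qed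
  qed
  then have "monom 1 (Suc \<tau>) dvd cubic_discr p q" using oD monom_1_dvd_iff[OF D] by simp
  then have "coeff (cubic_discr p q) j = 0" if "j \<le> \<tau>" for j
    using that by (simp add: coeff_eq_0_if_monom_dvd)
  then show ?thesis using origin a \<open>a = 0\<close> by auto
qed

text \<open>
  The analogous count for type I, where the critical points are the roots of \<open>Q = 2 * X * pderiv G - G\<close> and the critical value vanishes
  when \<open>G\<close> does. Since \<open>Q\<close> and \<open>G\<close> have the same degree, since the order of \<open>G\<close> exceeds that of \<open>Q\<close> at each non-zero root of \<open>Q\<close>, and is not
  smaller at the origin, there are no non-zero roots: \<open>Q\<close>, and with it \<open>G\<close>, is a monomial. The last step holds
  because the \<open>i\<close>-th coefficient of \<open>Q\<close> is that of \<open>G\<close> times the non-zero number \<open>2 * i - 1\<close>.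
\<close>

lemma nilpotent_imp_monomial_I:
  fixes G :: "complex poly"
  assumes G: "G \<noteq> 0" and roots: "\<And>x. x \<noteq> 0 \<Longrightarrow> poly (2 * X * pderiv G - G) x = 0 \<Longrightarrow> poly G x = 0"
    and j: "j < degree G"
  shows "coeff G j = 0"
proof -
  let ?Q = "2 * X * pderiv G - G"
  have coeffQ: "coeff ?Q i = (2 * of_nat i - 1) * coeff G i" for i
  proof -
    have "2 * X * pderiv G = smult 2 (pCons 0 (pderiv G))" by (simp add: numeral_mult_conv_smult)
    then show ?thesis by (cases i) (simp_all add: coeff_pderiv algebra_simps)
  qed
  have odd: "(2 * of_nat i - 1 :: complex) \<noteq> 0" for i
  proof
    assume "(2 * of_nat i - 1 :: complex) = 0"
    then have "of_nat (2 * i) = (of_nat 1 :: complex)" by simp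
    then show False unfolding of_nat_eq_iff by simp
  qed
  have lead: "coeff ?Q (degree G) \<noteq> 0"
    by (simp only: coeffQ mult_eq_0_iff odd leading_coeff_0_iff, simp add: G)
  have degQ: "degree ?Q = degree G"
  proof (rule antisym)
    show "degree ?Q \<le> degree G"
      by (rule degree_le) (simp only: coeffQ, simp add: coeff_eq_0)
    show "degree G \<le> degree ?Q"
      by (rule le_degree) (rule lead)
  qed
  have Q: "?Q \<noteq> 0"
  proof
    assume "?Q = 0"
    then have "coeff ?Q (degree G) = 0" by (simp only: coeff_0)
    with lead show False ..
  qed
  have ord: "order x ?Q + 1 \<le> order x G" if "x \<noteq> 0" "poly ?Q x = 0" for x
  proof -
    let ?y = "[:-x, 1:]"
    have "order x G \<noteq> 0" using roots[OF that] G by (simp add: order_root)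
    then obtain m where m: "order x G = Suc m" by (metis not0_implies_Suc)
    obtain g where g: "G = ?y ^ Suc m * g" "poly g x \<noteq> 0" using order_factor[OF G, of x] m by metis
    have "?Q = ?y ^ m * (2 * X * (of_nat (Suc m) * g + ?y * pderiv g) - ?y * g)"
    proof -
      have "2 * X * (u * A) - ?y * u * g = u * (2 * X * A - ?y * g)" for u A by algebra
      then show ?thesis unfolding g(1) pderiv_linear_power_factor unfolding power_Suc .
    qed
    then have "order x ?Q = m"
    proof (rule order_eqI)
      have "(of_nat (Suc m) :: complex) \<noteq> 0" by (rule of_nat_neq_0)
      then show "poly (2 * X * (of_nat (Suc m) * g + ?y * pderiv g) - ?y * g) x \<noteq> 0"
        using g(2) that(1) by simp
    qed
    then show ?thesis using m by simp
  qed
  have ord0: "order 0 ?Q \<le> order 0 G"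
  proof -
    have "monom 1 (order 0 ?Q) dvd ?Q" using monom_1_dvd_iff[OF Q] by simp
    then have "coeff ?Q i = 0" if "i < order 0 ?Q" for i
      using that by (rule coeff_eq_0_if_monom_dvd)
    then have "coeff G i = 0" if "i < order 0 ?Q" for i
      using that[THEN \<open>\<And>i. i < order 0 ?Q \<Longrightarrow> coeff ?Q i = 0\<close>] odd[of i] unfolding coeffQ mult_eq_0_iff by blast
    then have "monom 1 (order 0 ?Q) dvd G" by (subst monom_1_dvd_iff') auto
    then show ?thesis using monom_1_dvd_iff[OF G] by simp
  qed
  let ?S = "{x. poly ?Q x = 0}"
  have fin: "finite ?S" using Q by (rule poly_roots_finite)
  have "degree G + card (?S - {0}) = (\<Sum>x\<in>?S. order x ?Q) + (\<Sum>x\<in>?S. if x = 0 then 0 else 1)"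
  proof -
    have "(\<Sum>x\<in>?S. if x = 0 then 0 else (1::nat)) = (\<Sum>x\<in>?S - {0}. 1)"
      using fin by (intro sum.mono_neutral_cong_right) auto
    then show ?thesis using sum_order_roots[OF Q] degQ by simp
  qed
  also have "\<dots> = (\<Sum>x\<in>?S. order x ?Q + (if x = 0 then 0 else 1))"
    by (rule sum.distrib[symmetric])
  also have "\<dots> \<le> (\<Sum>x\<in>?S. order x G)" using ord ord0 by (intro sum_mono) auto
  also have "\<dots> \<le> (\<Sum>x\<in>?S \<union> {x. poly G x = 0}. order x G)"
    using fin G by (intro sum_mono2) (auto intro: poly_roots_finite)
  also have "\<dots> = (\<Sum>x | poly G x = 0. order x G)"
    using fin G by (intro sum.mono_neutral_right) (auto intro: poly_roots_finite simp: order_0I)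
  also have "\<dots> = degree G" by (rule sum_order_roots[OF G])
  finally have "card (?S - {0}) = 0" by simp
  then have S0: "?S \<subseteq> {0}" using fin by auto
  have "order 0 ?Q = degree G"
  proof (cases "?S = {}")
    case True
    then have "poly ?Q 0 \<noteq> 0" by blast
    then have "order 0 ?Q = 0" by (rule order_0I)
    then show ?thesis using sum_order_roots[OF Q] degQ unfolding True by simp
  next
    case False
    then have "?S = {0}" using S0 by blast
    then show ?thesis using sum_order_roots[OF Q] degQ by simp
  qed
  then have "monom 1 (degree G) dvd ?Q" using monom_1_dvd_iff[OF Q] by simp
  then have "coeff ?Q j = 0" using j by (rule coeff_eq_0_if_monom_dvd)
  then show ?thesis using odd[of j] unfolding coeffQ by simp
qed

section \<open>Critical points of the determinants\<close>

lemma has_derivative_zero_iff_4: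
  fixes f :: "complex^4 \<Rightarrow> complex"
  assumes "(f has_derivative (\<lambda>h. A * h $ 1 + B * h $ 2 + C * h $ 3 + D * h $ 4)) (at v)"
  shows "(f has_derivative (\<lambda>_. 0)) (at v) \<longleftrightarrow> A = 0 \<and> B = 0 \<and> C = 0 \<and> D = 0"
proof
  assume "(f has_derivative (\<lambda>_. 0)) (at v)"
  with assms have eq: "(\<lambda>h :: complex^4. A * h $ 1 + B * h $ 2 + C * h $ 3 + D * h $ 4) = (\<lambda>_. 0)"
    by (rule has_derivative_unique)
  show "A = 0 \<and> B = 0 \<and> C = 0 \<and> D = 0"
    using fun_cong[OF eq, of "axis 1 1"] fun_cong[OF eq, of "axis 2 1"]
      fun_cong[OF eq, of "axis 3 1"] fun_cong[OF eq, of "axis 4 1"]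
    by (simp add: axis_def)
qed (use assms in simp)

lemma has_derivative_nth: "((\<lambda>v. v $ i) has_derivative (\<lambda>h. h $ i)) (at v)"
  by (intro bounded_linear_imp_has_derivative bounded_linear_vec_nth)

lemma has_derivative_poly_nth:
  "((\<lambda>v. poly p (v $ i)) has_derivative (\<lambda>h. poly (pderiv p) (v $ i) * h $ i)) (at (v :: complex^'m))"
  by (rule has_derivative_compose[OF has_derivative_nth poly_DERIV[unfolded has_field_derivative_def]])

lemma vec4_ex: "\<exists>v :: complex^4. v $ 1 = x \<and> v $ 2 = y \<and> v $ 3 = z \<and> v $ 4 = w"
  by (rule exI[of _ "\<chi> i. if i = 1 then x else if i = 2 then y else if i = 3 then z else w"]) simp

lemma critical_values_coordinates:
  fixes f :: "complex \<Rightarrow> complex \<Rightarrow> complex \<Rightarrow> complex \<Rightarrow> complex"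
  assumes "\<And>v :: complex^4. ((\<lambda>v. f (v $ 1) (v $ 2) (v $ 3) (v $ 4)) has_derivative
     (\<lambda>h. A (v $ 1) (v $ 2) (v $ 3) (v $ 4) * h $ 1 + B (v $ 1) (v $ 2) (v $ 3) (v $ 4) * h $ 2
        + C (v $ 1) (v $ 2) (v $ 3) (v $ 4) * h $ 3 + D (v $ 1) (v $ 2) (v $ 3) (v $ 4) * h $ 4)) (at v)"
  shows "c \<in> critical_values (\<lambda>v :: complex^4. f (v $ 1) (v $ 2) (v $ 3) (v $ 4)) \<longleftrightarrow>
    (\<exists>x y z w. A x y z w = 0 \<and> B x y z w = 0 \<and> C x y z w = 0 \<and> D x y z w = 0 \<and> f x y z w = c)"
proof -
  have "c \<in> critical_values (\<lambda>v :: complex^4. f (v $ 1) (v $ 2) (v $ 3) (v $ 4)) \<longleftrightarrow>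
    (\<exists>v :: complex^4. A (v $ 1) (v $ 2) (v $ 3) (v $ 4) = 0 \<and> B (v $ 1) (v $ 2) (v $ 3) (v $ 4) = 0 \<and>
      C (v $ 1) (v $ 2) (v $ 3) (v $ 4) = 0 \<and> D (v $ 1) (v $ 2) (v $ 3) (v $ 4) = 0 \<and>
      f (v $ 1) (v $ 2) (v $ 3) (v $ 4) = c)"
    unfolding critical_values_def image_iff bex_simps mem_Collect_eq
    using has_derivative_zero_iff_4[OF assms] by (intro arg_cong[of _ _ Ex] ext) auto
  also have "\<dots> \<longleftrightarrow> (\<exists>x y z w. A x y z w = 0 \<and> B x y z w = 0 \<and> C x y z w = 0 \<and> D x y z w = 0 \<and> f x y z w = c)"
  proof
    assume "\<exists>x y z w. A x y z w = 0 \<and> B x y z w = 0 \<and> C x y z w = 0 \<and> D x y z w = 0 \<and> f x y z w = c"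
    then obtain x y z w where *: "A x y z w = 0" "B x y z w = 0" "C x y z w = 0" "D x y z w = 0" "f x y z w = c"
      by (elim exE conjE)
    obtain v :: "complex^4" where "v $ 1 = x" "v $ 2 = y" "v $ 3 = z" "v $ 4 = w"
      using vec4_ex[of x y z w] by (elim exE conjE)
    with * show "\<exists>v :: complex^4. A (v $ 1) (v $ 2) (v $ 3) (v $ 4) = 0 \<and> B (v $ 1) (v $ 2) (v $ 3) (v $ 4) = 0 \<and>
      C (v $ 1) (v $ 2) (v $ 3) (v $ 4) = 0 \<and> D (v $ 1) (v $ 2) (v $ 3) (v $ 4) = 0 \<and>
      f (v $ 1) (v $ 2) (v $ 3) (v $ 4) = c"
      by (intro exI[of _ v]) simp
  qed (elim exE, intro exI)
  finally show ?thesis .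
qed

lemma det_matrix_II:
  "det (matrix_II p q v) = (\<lambda>x y z w. x * (y * w - z^2) - (p w)^2 * w + 2 * p w * z * (y + q w) - y * (y + q w)^2)
     (v $ 1) (v $ 2) (v $ 3) (v $ 4)"
  by (simp add: matrix_II_def Let_def det_3 power2_eq_square algebra_simps)

text \<open>
  Put \<open>u = y + q\<close>. The derivative in \<open>x\<close> is \<open>y w - z\<^sup>2\<close>, and where it vanishes, \<open>w\<close> times the determinant is \<open>-(p w - z u)\<^sup>2\<close>. So \<open>p w - z u\<close> is not zero
  at a critical point with non-zero value and \<open>w \<noteq> 0\<close>; the other derivatives vanish only if its products with \<open>3 y + q\<close> and with
  \<open>p + 2 w p' - 2 z q'\<close> do. This determines \<open>y\<close>, and leaves the two equations for \<open>w\<close> and \<open>z\<close>. The case \<open>w = 0\<close> is similar, with \<open>y + q\<close> as the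
  non-zero factor.
\<close>

lemma critical_values_II:
  fixes p q :: "complex poly"
  defines "r \<equiv> (\<lambda>w. poly p w + 2 * w * poly (pderiv p) w)"
  assumes c: "c \<noteq> 0"
  shows "c \<in> critical_values (\<lambda>v. det (matrix_II (poly p) (poly q) v)) \<longleftrightarrow>
    (\<exists>w z. r w = 2 * z * poly (pderiv q) w \<and> 3 * z^2 = - w * poly q w \<and>
       c = - (w * poly p w ^ 2 - 4/3 * poly p w * poly q w * z - 4/27 * poly q w ^ 3))"
proof -
  let ?p = "poly p" and ?q = "poly q" and ?p' = "poly (pderiv p)" and ?q' = "poly (pderiv q)"
  let ?f = "\<lambda>x y z w. x * (y * w - z^2) - (?p w)^2 * w + 2 * ?p w * z * (y + ?q w) - y * (y + ?q w)^2"
  let ?A = "\<lambda>x y z w. y * w - z^2"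
  let ?B = "\<lambda>x y z w. x * w + 2 * ?p w * z - (y + ?q w)^2 - 2 * y * (y + ?q w)"
  let ?C = "\<lambda>x y z w. 2 * (?p w * (y + ?q w) - x * z)"
  let ?D = "\<lambda>x y z w. x * y - (?p w)^2 - 2 * ?p w * ?p' w * w + 2 * ?p' w * z * (y + ?q w)
      + 2 * ?p w * z * ?q' w - 2 * y * (y + ?q w) * ?q' w"
  have "c \<in> critical_values (\<lambda>v. det (matrix_II ?p ?q v)) \<longleftrightarrow>
    (\<exists>x y z w. ?A x y z w = 0 \<and> ?B x y z w = 0 \<and> ?C x y z w = 0 \<and> ?D x y z w = 0 \<and> ?f x y z w = c)"
    unfolding det_matrix_II
  proof (rule critical_values_coordinates)
    fix v :: "complex^4"
    show "((\<lambda>v. ?f (v $ 1) (v $ 2) (v $ 3) (v $ 4)) has_derivative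
      (\<lambda>h. ?A (v $ 1) (v $ 2) (v $ 3) (v $ 4) * h $ 1 + ?B (v $ 1) (v $ 2) (v $ 3) (v $ 4) * h $ 2
        + ?C (v $ 1) (v $ 2) (v $ 3) (v $ 4) * h $ 3 + ?D (v $ 1) (v $ 2) (v $ 3) (v $ 4) * h $ 4)) (at v)"
      by (rule has_derivative_eq_rhs, (rule derivative_intros has_derivative_nth has_derivative_poly_nth)+)
         (simp add: fun_eq_iff power2_eq_square algebra_simps)
  qed
  also have "\<dots> \<longleftrightarrow> (\<exists>w z. r w = 2 * z * ?q' w \<and> 3 * z^2 = - w * ?q w \<and>
       c = - (w * ?p w ^ 2 - 4/3 * ?p w * ?q w * z - 4/27 * ?q w ^ 3))"
  proof
    assume "\<exists>x y z w. ?A x y z w = 0 \<and> ?B x y z w = 0 \<and> ?C x y z w = 0 \<and> ?D x y z w = 0 \<and> ?f x y z w = c"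
    then obtain x y z w where eqs: "?A x y z w = 0" "?B x y z w = 0" "?C x y z w = 0" "?D x y z w = 0" "?f x y z w = c"
      by blast
    define P Q P' Q' where "P = ?p w" and "Q = ?q w" and "P' = ?p' w" and "Q' = ?q' w"
    note eq = eqs[folded P_def Q_def P'_def Q'_def]
    have "3 * y + Q = 0 \<and> P + 2 * w * P' = 2 * z * Q'"
    proof (cases "w = 0")
      case True
      then have z: "z = 0" using eq(1) by simp
      then have "(y + Q) * (3 * y + Q) = 0" using eq(2) True by algebra
      moreover have "c = - (y * (y + Q)^2)" using eq(5) True z by simp
      ultimately have y: "3 * y + Q = 0" "y + Q \<noteq> 0" using c by auto
      have "P * (y + Q) = 0" using eq(3) z by simp
      then have "P = 0" using y by simp
      then show ?thesis using y True z by simp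
    next
      case False
      have fw: "c * w = - ((P * w - z * (y + Q))^2)" using eq(1,5) by algebra
      then have nz: "P * w - z * (y + Q) \<noteq> 0" using c False by auto
      have "(P * w - z * (y + Q)) * (3 * y + Q) = 0" using eq(1,2,3) by algebra
      then have y: "3 * y + Q = 0" using nz by simp
      have "(P * w - z * (y + Q)) * (P + 2 * w * P' - 2 * z * Q') = 0"
        using eq(1,3,4) y by algebra
      then show ?thesis using nz y by simp
    qed
    then have "y = - Q / 3" "P + 2 * w * P' = 2 * z * Q'" by (simp_all add: field_simps add_eq_0_iff)
    moreover from this have "3 * z^2 = - w * Q" using eq(1) by algebra
    moreover have "c = - (w * P^2 - 4/3 * P * Q * z - 4/27 * Q^3)"
      using eq(1,5) \<open>y = - Q / 3\<close> by algebra
    ultimately show "\<exists>w z. r w = 2 * z * ?q' w \<and> 3 * z^2 = - w * ?q w \<and>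
       c = - (w * ?p w ^ 2 - 4/3 * ?p w * ?q w * z - 4/27 * ?q w ^ 3)"
      unfolding r_def P_def Q_def P'_def Q'_def by blast
  next
    assume "\<exists>w z. r w = 2 * z * ?q' w \<and> 3 * z^2 = - w * ?q w \<and>
       c = - (w * ?p w ^ 2 - 4/3 * ?p w * ?q w * z - 4/27 * ?q w ^ 3)"
    then obtain w z where wz: "r w = 2 * z * ?q' w" "3 * z^2 = - w * ?q w"
      "c = - (w * ?p w ^ 2 - 4/3 * ?p w * ?q w * z - 4/27 * ?q w ^ 3)" by blast
    define P Q P' Q' where "P = ?p w" and "Q = ?q w" and "P' = ?p' w" and "Q' = ?q' w"
    have E: "P + 2 * w * P' = 2 * z * Q'" "3 * z^2 = - w * Q" "c = - (w * P^2 - 4/3 * P * Q * z - 4/27 * Q^3)"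
      using wz unfolding r_def P_def Q_def P'_def Q'_def by auto
    define y where "y = - Q / 3"
    have y: "Q = - 3 * y" by (simp add: y_def)
    \<comment> \<open>For \<open>w \<noteq> 0\<close> the derivative in \<open>y\<close> determines \<open>x\<close>; for \<open>w = 0\<close> it is the derivative in \<open>w\<close> that does.\<close>
    define x where "x = (if w = 0 then 2 * (y + Q) * Q' else - 2 * P * z / w)"
    have 1: "y * w - z^2 = 0" using E(2) y by algebra
    have 5: "x * (y * w - z^2) - P^2 * w + 2 * P * z * (y + Q) - y * (y + Q)^2 = c"
      using E(3) 1 y by algebra
    have "x * w + 2 * P * z - (y + Q)^2 - 2 * y * (y + Q) = 0
      \<and> 2 * (P * (y + Q) - x * z) = 0
      \<and> x * y - P^2 - 2 * P * P' * w + 2 * P' * z * (y + Q) + 2 * P * z * Q' - 2 * y * (y + Q) * Q' = 0"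
    proof (cases "w = 0")
      case True
      then have "z = 0" "P = 0" using 1 E(1) by auto
      then show ?thesis using True y by (simp add: x_def power2_eq_square)
    next
      case False
      then have xw: "x * w = - 2 * P * z" by (simp add: x_def)
      have "w * (2 * (P * (y + Q) - x * z)) = 0" using xw 1 y by algebra
      moreover have "w * (x * y - P^2 - 2 * P * P' * w + 2 * P' * z * (y + Q) + 2 * P * z * Q' - 2 * y * (y + Q) * Q') = 0"
        using xw 1 y E(1) by algebra
      moreover have "x * w + 2 * P * z - (y + Q)^2 - 2 * y * (y + Q) = 0" using xw y by algebra
      ultimately show ?thesis using False by simp
    qed
    with 1 5 show "\<exists>x y z w. ?A x y z w = 0 \<and> ?B x y z w = 0 \<and> ?C x y z w = 0 \<and> ?D x y z w = 0 \<and> ?f x y z w = c"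
      unfolding P_def Q_def P'_def Q'_def by blast
  qed
  finally show ?thesis .
qed

lemma det_matrix_I:
  "det (matrix_I k l v) = (\<lambda>x y z w. (y + poly (monic_of k l) x) * (x * y - z^2) - x * w^2 + 2 * l k * w * z - (l k)^2 * y)
     (v $ 1) (v $ 2) (v $ 3) (v $ 4)"
  by (simp add: matrix_I_def Let_def det_3 poly_monic_of power2_eq_square algebra_simps)

text \<open>
  The quantity \<open>(y + P) x - a\<^sup>2\<close>, with \<open>a = l k\<close>, is the upper left minor of size two. If it were zero at a critical point, so would
  be the critical value. As it is not zero, the derivatives in \<open>z\<close> and \<open>w\<close> force \<open>z = w = 0\<close>, where the determinant is
  \<open>y * ((y + P) * x - a\<^sup>2)\<close>, and the remaining two equations determine \<open>y\<close>.
\<close>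

lemma critical_values_I:
  fixes l :: "nat \<Rightarrow> complex" and k :: nat
  defines "P \<equiv> monic_of k l"
  assumes c: "c \<noteq> 0"
  shows "c \<in> critical_values (\<lambda>v. det (matrix_I k l v)) \<longleftrightarrow>
    (\<exists>x. x * poly P x + 2 * x^2 * poly (pderiv P) x + (l k)^2 = 0 \<and>
       c = - x * (poly P x + x * poly (pderiv P) x)^2)"
proof -
  let ?f = "\<lambda>x y z w. (y + poly P x) * (x * y - z^2) - x * w^2 + 2 * l k * w * z - (l k)^2 * y"
  let ?A = "\<lambda>x y z w. poly (pderiv P) x * (x * y - z^2) + (y + poly P x) * y - w^2"
  let ?B = "\<lambda>x y z w. (x * y - z^2) + (y + poly P x) * x - (l k)^2"
  let ?C = "\<lambda>x y z w. 2 * (l k * w - (y + poly P x) * z)"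
  let ?D = "\<lambda>x y z w. 2 * (l k * z - x * w)"
  have "c \<in> critical_values (\<lambda>v. det (matrix_I k l v)) \<longleftrightarrow>
    (\<exists>x y z w. ?A x y z w = 0 \<and> ?B x y z w = 0 \<and> ?C x y z w = 0 \<and> ?D x y z w = 0 \<and> ?f x y z w = c)"
    unfolding det_matrix_I P_def[symmetric]
  proof (rule critical_values_coordinates)
    fix v :: "complex^4"
    show "((\<lambda>v. ?f (v $ 1) (v $ 2) (v $ 3) (v $ 4)) has_derivative
      (\<lambda>h. ?A (v $ 1) (v $ 2) (v $ 3) (v $ 4) * h $ 1 + ?B (v $ 1) (v $ 2) (v $ 3) (v $ 4) * h $ 2
        + ?C (v $ 1) (v $ 2) (v $ 3) (v $ 4) * h $ 3 + ?D (v $ 1) (v $ 2) (v $ 3) (v $ 4) * h $ 4)) (at v)"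
      by (rule has_derivative_eq_rhs, (rule derivative_intros has_derivative_nth has_derivative_poly_nth)+)
         (simp add: fun_eq_iff power2_eq_square algebra_simps)
  qed
  also have "\<dots> \<longleftrightarrow> (\<exists>x. x * poly P x + 2 * x^2 * poly (pderiv P) x + (l k)^2 = 0 \<and>
       c = - x * (poly P x + x * poly (pderiv P) x)^2)"
  proof
    assume "\<exists>x y z w. ?A x y z w = 0 \<and> ?B x y z w = 0 \<and> ?C x y z w = 0 \<and> ?D x y z w = 0 \<and> ?f x y z w = c"
    then obtain x y z w where eqs: "?A x y z w = 0" "?B x y z w = 0" "?C x y z w = 0" "?D x y z w = 0" "?f x y z w = c"
      by blast
    define p p' a where "p = poly P x" and "p' = poly (pderiv P) x" and "a = l k"
    note eq = eqs[folded p_def p'_def a_def]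
    have nz: "(y + p) * x - a^2 \<noteq> 0"
    proof
      assume 0: "(y + p) * x - a^2 = 0"
      then have 1: "x * y = z^2" using eq(2) by simp
      show False
      proof (cases "a = 0")
        case True
        then have "x * w = 0" using eq(4) by simp
        then have "c = 0" using eq(5) 1 True by algebra
        then show False using c by simp
      next
        case False
        then have "x \<noteq> 0" using 0 by auto
        have "x * c = 0" using eq(4,5) 0 1 by algebra
        then show False using c \<open>x \<noteq> 0\<close> by simp
      qed
    qed
    have "((y + p) * x - a^2) * z = 0" "((y + p) * x - a^2) * w = 0" using eq(3,4) by algebra+
    then have zw: "z = 0" "w = 0" using nz by auto
    have "y \<noteq> 0" using eq(5) zw c by auto
    have "y * (y + p + x * p') = 0" using eq(1) zw by algebra
    then have "y + p + x * p' = 0" using \<open>y \<noteq> 0\<close> by simp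
    then have y: "y = - (p + x * p')" by algebra
    have "x * p + 2 * x^2 * p' + a^2 = 0" using eq(2) zw y by algebra
    moreover have "c = - x * (p + x * p')^2" using eq(2,5) zw y by algebra
    ultimately show "\<exists>x. x * poly P x + 2 * x^2 * poly (pderiv P) x + (l k)^2 = 0 \<and>
       c = - x * (poly P x + x * poly (pderiv P) x)^2"
      unfolding p_def p'_def a_def by blast
  next
    assume "\<exists>x. x * poly P x + 2 * x^2 * poly (pderiv P) x + (l k)^2 = 0 \<and>
       c = - x * (poly P x + x * poly (pderiv P) x)^2"
    then obtain x where x: "x * poly P x + 2 * x^2 * poly (pderiv P) x + (l k)^2 = 0"
       "c = - x * (poly P x + x * poly (pderiv P) x)^2" by blast
    define y where "y = - (poly P x + x * poly (pderiv P) x)"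
    have "?A x y z w = 0 \<and> ?B x y z w = 0 \<and> ?C x y z w = 0 \<and> ?D x y z w = 0 \<and> ?f x y z w = c"
      if "z = 0" "w = 0" for z w
    proof (intro conjI)
      show "?A x y z w = 0" using that unfolding y_def by algebra
      show "?B x y z w = 0" using x(1) that unfolding y_def by algebra
      show "?f x y z w = c" using x that unfolding y_def by algebra
    qed (use that in simp_all)
    then show "\<exists>x y z w. ?A x y z w = 0 \<and> ?B x y z w = 0 \<and> ?C x y z w = 0 \<and> ?D x y z w = 0 \<and> ?f x y z w = c"
      by blast
  qed
  finally show ?thesis .
qed

section \<open>Deforming critical points of type II\<close>

text \<open>
  \<open>P\<close> and \<open>Q\<close> are the entries \<open>p\<close> and \<open>q\<close> of the matrix as functions of the parameters, on which they depend in an affine way with linear parts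
  \<open>dP\<close> and \<open>dQ\<close>. The parameters numbered \<open>i0\<close> and \<open>j0\<close> are the constant terms of \<open>p\<close> and of \<open>q\<close>.
\<close>

locale type_II = point_algebra ix n Wm Zm ep eq Pt f0 f1 N
  for ix :: "nat \<Rightarrow> 'n::finite" and n Wm Zm ep eq Pt f0 f1 N +
  fixes P Q dP dQ :: "(nat \<Rightarrow> complex) \<Rightarrow> complex poly" and i0 j0 :: nat
  assumes Pt_iff: "Pt l w z \<longleftrightarrow> poly (odd_deriv (P l)) w = 2 * z * poly (pderiv (Q l)) w \<and> 3 * z^2 = - w * poly (Q l) w"
    and f_def: "f0 l = smult (4/27) (Q l ^ 3) - X * P l ^ 2" "f1 l = smult (4/3) (P l * Q l)"
    and affine: "P (\<lambda>i. l i + s * h i) = P l + smult s (dP h)" "Q (\<lambda>i. l i + s * h i) = Q l + smult s (dQ h)"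
    and constants: "dP (\<lambda>i. if i = i0 then 1 else 0) = 1" "dQ (\<lambda>i. if i = i0 then 1 else 0) = 0"
      "dP (\<lambda>i. if i = j0 then 1 else 0) = 0" "dQ (\<lambda>i. if i = j0 then 1 else 0) = 1"
begin

lemma F_eq: "F l w z = - (w * poly (P l) w ^ 2 - 4/3 * poly (P l) w * poly (Q l) w * z - 4/27 * poly (Q l) w ^ 3)"
  by (simp add: F_def f_def algebra_simps)

lemma dP_0: "dP (\<lambda>_. 0) = 0" "dQ (\<lambda>_. 0) = 0"
  using affine[of "\<lambda>_. 0" 1 "\<lambda>_. 0"] by simp_all

lemma square_root_point:
  assumes "Pt l w z"
  obtains \<alpha> \<beta> where "\<alpha>^2 = w" "\<alpha> * \<beta> = z" "3 * \<beta>^2 = - poly (Q l) w"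
proof (cases "w = 0")
  case True
  then have "z = 0" using assms by (simp add: Pt_iff)
  then show ?thesis using that[of 0 "csqrt (- poly (Q l) w / 3)"] True by simp
next
  case False
  let ?\<alpha> = "csqrt w"
  have "?\<alpha> \<noteq> 0" using False by simp
  have "w * (3 * (z / ?\<alpha>)^2) = w * (- poly (Q l) w)"
    using assms False by (simp add: Pt_iff power_divide)
  then have "3 * (z / ?\<alpha>)^2 = - poly (Q l) w" using False by (simp only: mult_cancel_left simp_thms)
  then show ?thesis using that[of ?\<alpha> "z / ?\<alpha>"] \<open>?\<alpha> \<noteq> 0\<close> by simp
qed

text \<open>
  In the coordinates \<open>\<alpha>\<close>, \<open>\<beta>\<close> with \<open>w = \<alpha>\<^sup>2\<close> and \<open>z = \<alpha> \<beta>\<close>, the critical values are the negatives of the squares of the critical values of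
  \<open>\<phi> = \<alpha> p(\<alpha>\<^sup>2) - \<beta> q(\<alpha>\<^sup>2) - \<beta>\<^sup>3\<close>; at a critical point \<open>q = - 3 \<beta>\<^sup>2\<close>.
\<close>

lemma F_square:
  assumes "Pt l w z" "\<alpha>^2 = w" "\<alpha> * \<beta> = z" "3 * \<beta>^2 = - poly (Q l) w"
  shows "F l w z = - ((\<alpha> * poly (P l) w + 2 * \<beta>^3)^2)"
proof -
  have "poly (Q l) w = - 3 * \<beta>^2" using assms(4) by algebra
  then show ?thesis unfolding F_eq assms(2,3)[symmetric]
    by (simp add: power2_eq_square power3_eq_cube algebra_simps)
qed

text \<open>
  Moving a critical point along a line in the coordinates \<open>\<alpha>\<close>, \<open>\<beta>\<close> and the parameters along a line of direction \<open>h\<close>, the equations of the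
  critical points fail by \<open>e1\<close> and \<open>e2\<close>. Correcting the constant terms of \<open>q\<close> and \<open>p\<close> restores them exactly. Assumptions \<open>1\<close>
  and \<open>2\<close> are the linearized equations: they make the corrections of second order, so that \<open>h\<close> remains the tangent of the resulting curve of
  parameters. Since the point is critical for \<open>\<phi>\<close>, the derivative of the critical value of \<open>\<phi>\<close> only sees the explicit dependence on
  the parameters, which is \<open>\<alpha> dp - \<beta> dq\<close>.
\<close>

lemma deformation_curve:
  assumes pt: "\<alpha>^2 = w" "\<alpha> * \<beta> = z" "3 * \<beta>^2 = - poly (Q l) w"
      "poly (odd_deriv (P l)) w = 2 * z * poly (pderiv (Q l)) w"
    and 1: "poly (dQ h) w + 2 * \<alpha> * poly (pderiv (Q l)) w * \<alpha>' + 6 * \<beta> * \<beta>' = 0"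
    and 2: "poly (odd_deriv (dP h)) w + poly (pderiv (odd_deriv (P l))) w * (2 * \<alpha> * \<alpha>')
      - 2 * (\<alpha> * \<beta>' + \<alpha>' * \<beta>) * poly (pderiv (Q l)) w
      - 2 * z * (poly (pderiv (dQ h)) w + poly (pderiv (pderiv (Q l))) w * (2 * \<alpha> * \<alpha>')) = 0"
  obtains \<gamma> where "\<gamma> 0 = l" "\<And>i. ((\<lambda>s. \<gamma> s i) has_field_derivative h i) (at 0)"
    "\<And>s. Pt (\<gamma> s) ((\<alpha> + s * \<alpha>')^2) ((\<alpha> + s * \<alpha>') * (\<beta> + s * \<beta>'))"
    "((\<lambda>s. F (\<gamma> s) ((\<alpha> + s * \<alpha>')^2) ((\<alpha> + s * \<alpha>') * (\<beta> + s * \<beta>'))) has_field_derivative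
       - (2 * (\<alpha> * poly (P l) w + 2 * \<beta>^3) * (\<alpha> * poly (dP h) w - \<beta> * poly (dQ h) w))) (at 0)"
proof -
  define A B W' Z' where "A s = \<alpha> + s * \<alpha>'" and "B s = \<beta> + s * \<beta>'" and "W' s = A s ^ 2" and "Z' s = A s * B s" for s
  define e1 where "e1 s = poly (Q l) (W' s) + s * poly (dQ h) (W' s) + 3 * B s ^ 2" for s
  define e2 where "e2 s = poly (odd_deriv (P l)) (W' s) + s * poly (odd_deriv (dP h)) (W' s)
      - 2 * Z' s * (poly (pderiv (Q l)) (W' s) + s * poly (pderiv (dQ h)) (W' s))" for s
  define \<gamma> where "\<gamma> s i = ((l i + s * h i) + (- e2 s) * (if i = i0 then 1 else 0)) + (- e1 s) * (if i = j0 then 1 else 0)" for s i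
  have at0: "A 0 = \<alpha>" "B 0 = \<beta>" "W' 0 = w" "Z' 0 = z" using pt by (simp_all add: A_def B_def W'_def Z'_def)
  have dA: "(A has_field_derivative \<alpha>') (at 0)" and dB: "(B has_field_derivative \<beta>') (at 0)"
    unfolding A_def B_def by (auto intro!: derivative_eq_intros)
  have dW: "(W' has_field_derivative 2 * \<alpha> * \<alpha>') (at 0)"
    unfolding W'_def[abs_def] by (rule DERIV_cong[OF DERIV_power[OF dA]]) (simp add: at0)
  have dZ: "(Z' has_field_derivative \<alpha> * \<beta>' + \<alpha>' * \<beta>) (at 0)"
    unfolding Z'_def[abs_def] by (rule DERIV_cong[OF DERIV_mult'[OF dA dB]]) (simp add: at0)
  have dpoly: "((\<lambda>s. poly p (W' s)) has_field_derivative poly (pderiv p) w * (2 * \<alpha> * \<alpha>')) (at 0)" for p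
    using DERIV_chain2[OF poly_DERIV dW, of p] by (simp add: at0)
  have dspoly: "((\<lambda>s. s * poly p (W' s)) has_field_derivative poly p w) (at 0)" for p
    by (rule DERIV_cong[OF DERIV_mult'[OF DERIV_ident dpoly]]) (simp add: at0)
  have e0: "e1 0 = 0" "e2 0 = 0" using pt by (simp_all add: e1_def e2_def at0)
  have de1: "(e1 has_field_derivative 0) (at 0)"
    unfolding e1_def[abs_def]
    by (rule DERIV_cong[OF DERIV_add[OF DERIV_add[OF dpoly dspoly] DERIV_cmult[OF DERIV_power[OF dB]]]])
       (use 1 in \<open>simp add: at0 algebra_simps\<close>)
  have de2: "(e2 has_field_derivative 0) (at 0)"
    unfolding e2_def[abs_def]
    by (rule DERIV_cong[OF DERIV_diff[OF DERIV_add[OF dpoly dspoly]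
            DERIV_mult'[OF DERIV_cmult[OF dZ] DERIV_add[OF dpoly dspoly]]]])
       (use 2 in \<open>simp add: at0 algebra_simps\<close>)
  have P\<gamma>: "P (\<gamma> s) = P l + smult s (dP h) - [:e2 s:]" and Q\<gamma>: "Q (\<gamma> s) = Q l + smult s (dQ h) - [:e1 s:]" for s
    unfolding \<gamma>_def affine constants by (simp_all add: one_pCons)
  have odd_deriv\<gamma>: "poly (odd_deriv (P (\<gamma> s))) x = poly (odd_deriv (P l)) x + s * poly (odd_deriv (dP h)) x - e2 s" for s x
    unfolding P\<gamma> odd_deriv_def by (simp add: pderiv_add pderiv_diff pderiv_smult pderiv_pCons algebra_simps)
  have Q'\<gamma>: "poly (pderiv (Q (\<gamma> s))) x = poly (pderiv (Q l)) x + s * poly (pderiv (dQ h)) x" for s x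
    unfolding Q\<gamma> by (simp add: pderiv_add pderiv_diff pderiv_smult pderiv_pCons)
  have Qv: "poly (Q (\<gamma> s)) (W' s) = - 3 * B s ^ 2" for s
    unfolding Q\<gamma> by (simp add: e1_def)
  have Pt\<gamma>: "Pt (\<gamma> s) (W' s) (Z' s)" for s
    unfolding Pt_iff odd_deriv\<gamma> Q'\<gamma> Qv by (simp add: e2_def W'_def Z'_def power_mult_distrib)
  have F\<gamma>: "F (\<gamma> s) (W' s) (Z' s) = - ((A s * poly (P (\<gamma> s)) (W' s) + 2 * B s ^ 3)^2)" for s
    by (rule F_square[OF Pt\<gamma>]) (simp_all add: Z'_def Qv[unfolded W'_def] W'_def)
  have P0: "P (\<gamma> 0) = P l" unfolding P\<gamma> by (simp add: e0)
  have "((\<lambda>s. poly (P (\<gamma> s)) (W' s)) has_field_derivative poly (pderiv (P l)) w * (2 * \<alpha> * \<alpha>') + poly (dP h) w - 0) (at 0)"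
    unfolding P\<gamma> using DERIV_diff[OF DERIV_add[OF dpoly dspoly] de2] by simp
  note dA' = DERIV_add[OF DERIV_mult'[OF dA this] DERIV_cmult[OF DERIV_power[OF dB, of 3], of 2]]
  have "((\<lambda>s. A s * poly (P (\<gamma> s)) (W' s) + 2 * B s ^ 3) has_field_derivative
      \<alpha> * poly (dP h) w - \<beta> * poly (dQ h) w) (at 0)"
  proof (rule DERIV_cong[OF dA'])
    have r: "poly (P l) w + 2 * w * poly (pderiv (P l)) w = 2 * z * poly (pderiv (Q l)) w"
      using pt(4) by (simp add: odd_deriv_def mult_ac)
    show "A 0 * (poly (pderiv (P l)) w * (2 * \<alpha> * \<alpha>') + poly (dP h) w - 0) + \<alpha>' * poly (P (\<gamma> 0)) (W' 0)
        + 2 * (of_nat 3 * (\<beta>' * B 0 ^ (3 - Suc 0))) = \<alpha> * poly (dP h) w - \<beta> * poly (dQ h) w"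
      unfolding at0 P0 using r 1 pt(1,2) by (simp add: numeral_3_eq_3[symmetric]) algebra
  qed
  from DERIV_minus[OF DERIV_power[OF this, of 2]]
  have dF: "((\<lambda>s. F (\<gamma> s) (W' s) (Z' s)) has_field_derivative
       - (2 * (\<alpha> * poly (P l) w + 2 * \<beta>^3) * (\<alpha> * poly (dP h) w - \<beta> * poly (dQ h) w))) (at 0)"
    unfolding F\<gamma> by (rule DERIV_cong) (simp add: at0 P0)
  show ?thesis
  proof (rule that[of \<gamma>])
    show "\<gamma> 0 = l" by (simp add: \<gamma>_def e0 fun_eq_iff)
    show "((\<lambda>s. \<gamma> s i) has_field_derivative h i) (at 0)" for i
    proof -
      have "((\<lambda>s. l i + s * h i) has_field_derivative h i) (at 0)" by (auto intro!: derivative_eq_intros)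
      from DERIV_add[OF DERIV_add[OF this DERIV_cmult_right[OF DERIV_minus[OF de2]]] DERIV_cmult_right[OF DERIV_minus[OF de1]]]
      show ?thesis unfolding \<gamma>_def by (rule DERIV_cong) simp
    qed
    show "Pt (\<gamma> s) ((\<alpha> + s * \<alpha>')^2) ((\<alpha> + s * \<alpha>') * (\<beta> + s * \<beta>'))" for s
      using Pt\<gamma>[of s] by (simp add: W'_def Z'_def A_def B_def)
    show "((\<lambda>s. F (\<gamma> s) ((\<alpha> + s * \<alpha>')^2) ((\<alpha> + s * \<alpha>') * (\<beta> + s * \<beta>'))) has_field_derivative
       - (2 * (\<alpha> * poly (P l) w + 2 * \<beta>^3) * (\<alpha> * poly (dP h) w - \<beta> * poly (dQ h) w))) (at 0)"
      using dF by (simp add: W'_def Z'_def A_def B_def)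
  qed
qed

text \<open>
  Let \<open>h\<close> lie in the kernel of the differential of the coefficients of \<open>pol\<close>. If the critical point is nondegenerate, the linearized equations
  of \<open>deformation_curve\<close> can be solved, so the point can be followed in the direction \<open>h\<close>; its critical value is stationary by
  \<open>critical_value_stationary\<close>. As \<open>\<phi>\<close> does not vanish at the point, \<open>\<alpha> dp = \<beta> dq\<close>, and the claim
  is this equation multiplied by \<open>\<alpha>\<close> and by \<open>3 \<beta>\<close>.
\<close>

lemma stationary_direction:
  assumes gen: "generic l" and pt: "Pt l w z"
    and D: "\<And>j. j < n \<Longrightarrow> (\<Sum>i<n. partial (\<lambda>l. coeff (pol l) j) i l * h i) = 0"
  shows "w * poly (dP h) w = z * poly (dQ h) w \<and> 3 * z * poly (dP h) w = - poly (Q l) w * poly (dQ h) w"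
proof -
  obtain \<alpha> \<beta> where ab: "\<alpha>^2 = w" "\<alpha> * \<beta> = z" "3 * \<beta>^2 = - poly (Q l) w"
    using square_root_point[OF pt] by blast
  have r: "poly (odd_deriv (P l)) w = 2 * z * poly (pderiv (Q l)) w" using pt by (simp add: Pt_iff)
  let ?\<phi> = "\<alpha> * poly (P l) w + 2 * \<beta>^3"
  have "poly (pol l) (F l w z) = 0" using pol_root_iff pt by blast
  then have "F l w z \<noteq> 0" using gen by (auto simp: generic_def)
  then have \<phi>: "?\<phi> \<noteq> 0" using F_square[OF pt ab] by auto
  let ?Q' = "poly (pderiv (Q l)) w"
  define a b c where "a = 2 * \<alpha> * ?Q'" and "b = 6 * \<beta>"
    and "c = 2 * \<alpha> * poly (pderiv (odd_deriv (P l))) w - 2 * \<beta> * ?Q' - 4 * \<alpha> * z * poly (pderiv (pderiv (Q l))) w"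
  have c_eq: "poly (pderiv (odd_deriv (P l))) w * (2 * \<alpha> * x) - 2 * (\<alpha> * y + x * \<beta>) * ?Q'
      - 2 * z * (poly (pderiv (pderiv (Q l))) w * (2 * \<alpha> * x)) = c * x - a * y" for x y
    unfolding c_def a_def by (simp add: algebra_simps)
  \<comment> \<open>The linearized equations have the matrix with rows \<open>(a, b)\<close> and \<open>(c, - a)\<close>. If it were singular, a kernel vector would move the
    point along a curve of parameters with zero velocity, which \<open>stationary_point\<close> excludes.\<close>
  have det: "a * a + b * c \<noteq> 0"
  proof
    assume det0: "a * a + b * c = 0"
    obtain x y where xy: "a * x + b * y = 0" "c * x - a * y = 0" "x \<noteq> 0 \<or> y \<noteq> 0"
    proof (cases "a = 0 \<and> b = 0")
      case True
      show ?thesis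
      proof (cases "c = 0")
        case True
        then show ?thesis using that[of 1 0] \<open>a = 0 \<and> b = 0\<close> by simp
      next
        case False
        then show ?thesis using that[of 0 1] \<open>a = 0 \<and> b = 0\<close> by simp
      qed
    next
      case False
      have "c * b - a * (- a) = 0" using det0 by algebra
      then show ?thesis using that[of b "-a"] False by auto
    qed
    obtain \<gamma> where \<gamma>: "\<gamma> 0 = l" "\<And>i. ((\<lambda>s. \<gamma> s i) has_field_derivative (\<lambda>_. 0) i) (at 0)"
       "\<And>s. Pt (\<gamma> s) ((\<alpha> + s * x)^2) ((\<alpha> + s * x) * (\<beta> + s * y))"
    proof (rule deformation_curve[OF ab r, of "\<lambda>_. 0" x y])
      show "poly (dQ (\<lambda>_. 0)) w + 2 * \<alpha> * ?Q' * x + 6 * \<beta> * y = 0"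
        using xy(1) by (simp add: dP_0 a_def b_def)
      show "poly (odd_deriv (dP (\<lambda>_. 0))) w + poly (pderiv (odd_deriv (P l))) w * (2 * \<alpha> * x)
        - 2 * (\<alpha> * y + x * \<beta>) * ?Q'
        - 2 * z * (poly (pderiv (dQ (\<lambda>_. 0))) w + poly (pderiv (pderiv (Q l))) w * (2 * \<alpha> * x)) = 0"
        using xy(2) c_eq[of x y] by (simp add: dP_0 odd_deriv_def)
    qed blast
    have dw: "((\<lambda>s. (\<alpha> + s * x)^2) has_field_derivative 2 * \<alpha> * x) (at 0)"
      by (auto intro!: derivative_eq_intros)
    have dz: "((\<lambda>s. (\<alpha> + s * x) * (\<beta> + s * y)) has_field_derivative \<alpha> * y + x * \<beta>) (at 0)"
      by (auto intro!: derivative_eq_intros)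
    have st: "2 * \<alpha> * x = 0 \<and> \<alpha> * y + x * \<beta> = 0"
      using stationary_point[of \<gamma> "\<lambda>s. (\<alpha> + s * x)^2" "\<lambda>s. (\<alpha> + s * x) * (\<beta> + s * y)", OF _ _ \<gamma>(3) dw dz] gen \<gamma>(1,2)
      by simp
    show False
    proof (cases "\<alpha> = 0")
      case True
      then have "\<beta> \<noteq> 0" using \<phi> by auto
      then have "x = 0" using st True by simp
      moreover have "y = 0" using xy(1) \<open>\<beta> \<noteq> 0\<close> True by (simp add: a_def b_def)
      ultimately show False using xy(3) by simp
    next
      case False
      then show False using st xy(3) by auto
    qed
  qed
  define u v where "u = - poly (dQ h) w" and "v = - (poly (odd_deriv (dP h)) w - 2 * z * poly (pderiv (dQ h)) w)"
  define x y where "x = (a * u + b * v) / (a * a + b * c)" and "y = (c * u - a * v) / (a * a + b * c)"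
  have x: "x * (a * a + b * c) = a * u + b * v" and y: "y * (a * a + b * c) = c * u - a * v"
    using det by (simp_all add: x_def y_def)
  have "(a * a + b * c) * (a * x + b * y - u) = 0" using x y by algebra
  then have 1: "a * x + b * y = u" using det by simp
  have "(a * a + b * c) * (c * x - a * y - v) = 0" using x y by algebra
  then have 2: "c * x - a * y = v" using det by simp
  obtain \<gamma> where \<gamma>: "\<gamma> 0 = l" "\<And>i. ((\<lambda>s. \<gamma> s i) has_field_derivative h i) (at 0)"
     "\<And>s. Pt (\<gamma> s) ((\<alpha> + s * x)^2) ((\<alpha> + s * x) * (\<beta> + s * y))"
     "((\<lambda>s. F (\<gamma> s) ((\<alpha> + s * x)^2) ((\<alpha> + s * x) * (\<beta> + s * y))) has_field_derivative
       - (2 * ?\<phi> * (\<alpha> * poly (dP h) w - \<beta> * poly (dQ h) w))) (at 0)"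
  proof (rule deformation_curve[OF ab r, of h x y])
    show "poly (dQ h) w + 2 * \<alpha> * ?Q' * x + 6 * \<beta> * y = 0"
      using 1 unfolding a_def b_def u_def by algebra
    show "poly (odd_deriv (dP h)) w + poly (pderiv (odd_deriv (P l))) w * (2 * \<alpha> * x)
        - 2 * (\<alpha> * y + x * \<beta>) * ?Q'
        - 2 * z * (poly (pderiv (dQ h)) w + poly (pderiv (pderiv (Q l))) w * (2 * \<alpha> * x)) = 0"
      using 2 c_eq[of x y] unfolding v_def by algebra
  qed blast
  have "- (2 * ?\<phi> * (\<alpha> * poly (dP h) w - \<beta> * poly (dQ h) w)) = 0"
  proof (rule critical_value_stationary[where \<gamma> = \<gamma> and h = h])
    show "\<forall>\<^sub>F s in nhds 0. poly (pol (\<gamma> s)) (F (\<gamma> s) ((\<alpha> + s * x)^2) ((\<alpha> + s * x) * (\<beta> + s * y))) = 0"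
      using pol_root_iff \<gamma>(3) by (intro always_eventually allI) blast
  qed (use gen D \<gamma> in auto)
  then have "?\<phi> * (\<alpha> * poly (dP h) w - \<beta> * poly (dQ h) w) = 0" by algebra
  then have *: "\<alpha> * poly (dP h) w = \<beta> * poly (dQ h) w"
    using \<phi> unfolding mult_eq_0_iff by simp
  show ?thesis
  proof
    show "w * poly (dP h) w = z * poly (dQ h) w" using * ab by algebra
    show "3 * z * poly (dP h) w = - poly (Q l) w * poly (dQ h) w" using * ab by algebra
  qed
qed

end

section \<open>Multiplication tables of type II\<close>

lemma sum_lessThan_numeral:
  fixes f :: "nat \<Rightarrow> complex"
  shows
  "(\<Sum>j<4. f j) = f 0 + f 1 + f 2 + (f 3 :: complex)"
  "(\<Sum>j<5. f j) = f 0 + f 1 + f 2 + f 3 + (f 4 :: complex)"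
  "(\<Sum>j<6. f j) = f 0 + f 1 + f 2 + f 3 + f 4 + (f 5 :: complex)"
  by (simp_all add: eval_nat_numeral)

lemma all_lessThan_numeral:
  "(\<forall>i<4. R i) \<longleftrightarrow> R 0 \<and> R 1 \<and> R 2 \<and> R (3::nat)"
  "(\<forall>i<5. R i) \<longleftrightarrow> R 0 \<and> R 1 \<and> R 2 \<and> R 3 \<and> R (4::nat)"
  "(\<forall>i<6. R i) \<longleftrightarrow> R 0 \<and> R 1 \<and> R 2 \<and> R 3 \<and> R 4 \<and> R (5::nat)"
  by (simp_all add: eval_nat_numeral All_less_Suc conj_ac)

abbreviation unit_row :: "nat \<Rightarrow> nat \<Rightarrow> complex" where "unit_row k j \<equiv> (if j = k then 1 else 0)"

text \<open>
  The critical points and the two parts of the critical value \<open>value0 + value1 * z\<close>, as found in \<open>critical_values_II\<close>.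
\<close>

definition point :: "complex poly \<Rightarrow> complex poly \<Rightarrow> complex \<Rightarrow> complex \<Rightarrow> bool" where
  "point p q w z \<longleftrightarrow> poly (odd_deriv p) w = 2 * z * poly (pderiv q) w \<and> 3 * z^2 = - w * poly q w"
definition value0 :: "complex poly \<Rightarrow> complex poly \<Rightarrow> complex poly" where
  "value0 p q = smult (4/27) (q ^ 3) - X * p ^ 2"
definition value1 :: "complex poly \<Rightarrow> complex poly \<Rightarrow> complex poly" where
  "value1 p q = smult (4/3) (p * q)"

lemma polyfun_coeffs_diff: "polyfun_coeffs n p \<Longrightarrow> polyfun_coeffs n q \<Longrightarrow> polyfun_coeffs n (\<lambda>l. p l - q l)"
  unfolding polyfun_coeffs_def by (auto intro: polyfun_diff)
lemma polyfun_coeffs_power: "polyfun_coeffs n p \<Longrightarrow> polyfun_coeffs n (\<lambda>l. p l ^ k)"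
  by (induction k) auto
lemma polyfun_coeffs_smult: "polyfun_coeffs n p \<Longrightarrow> polyfun_coeffs n (\<lambda>l. smult c (p l))"
  unfolding polyfun_coeffs_def by (auto intro: polyfun.mult)

lemma polyfun_value:
  assumes "polyfun_coeffs n p" "polyfun_coeffs n q"
  shows "polyfun_coeffs n (\<lambda>l. value0 (p l) (q l))" "polyfun_coeffs n (\<lambda>l. value1 (p l) (q l))"
  unfolding value0_def value1_def
  by (intro polyfun_coeffs_diff polyfun_coeffs_smult polyfun_coeffs_power polyfun_coeffs_mult
      polyfun_coeffs_const assms)+

lemma degree_value:
  assumes "degree p \<le> 3" "degree q \<le> 3"
  shows "degree (value0 p q) \<le> 9" "degree (value1 p q) \<le> 9"
proof -
  have "degree (q^3) \<le> 9" using degree_power_le[of q 3] assms by linarith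
  moreover have "degree (X * p^2) \<le> 7"
    using degree_mult_le[of X "p^2"] degree_power_le[of p 2] assms by (simp add: degree_pCons_eq_if)
  ultimately show "degree (value0 p q) \<le> 9"
    unfolding value0_def by (intro degree_diff_le) (auto intro: order_trans[OF degree_smult_le])
  have "degree (p * q) \<le> 6" using degree_mult_le[of p q] assms by linarith
  then show "degree (value1 p q) \<le> 9"
    unfolding value1_def by (auto intro: order_trans[OF degree_smult_le])
qed

text \<open>
  The algebra of critical points for \<open>\<tau> = 4\<close> has the basis \<open>1, w, z, w z\<close>, numbered from \<open>0\<close>: the relations \<open>5 w\<^sup>2 = \<dots>\<close> and \<open>3 z\<^sup>2 = \<dots>\<close> of
  \<open>point_4\<close> reduce all other monomials. The functions \<open>w2_4\<close>, \<open>w3_4\<close> and \<open>z2_4\<close> are the coordinate rows of \<open>w\<^sup>2\<close>, \<open>w\<^sup>3\<close> and \<open>z\<^sup>2\<close>.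
\<close>

definition P4 :: "(nat \<Rightarrow> complex) \<Rightarrow> complex poly" where "P4 l = [:l 0, l 1, 1:]"
definition Q4 :: "(nat \<Rightarrow> complex) \<Rightarrow> complex poly" where "Q4 l = [:l 2, l 3:]"
definition w2_4 where "w2_4 l j = (2 * l 3 * unit_row 2 j - 3 * l 1 * unit_row 1 j - l 0 * unit_row 0 j) / 5" for l :: "nat \<Rightarrow> complex"
definition w3_4 where "w3_4 l j = (2 * l 3 * unit_row 3 j - 3 * l 1 * w2_4 l j - l 0 * unit_row 1 j) / 5" for l :: "nat \<Rightarrow> complex"
definition z2_4 where "z2_4 l j = - (l 3 * w2_4 l j + l 2 * unit_row 1 j) / 3" for l :: "nat \<Rightarrow> complex"
definition W4 :: "(nat \<Rightarrow> complex) \<Rightarrow> nat \<Rightarrow> nat \<Rightarrow> complex" where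
  "W4 l i j = (if i = 0 then unit_row 1 j else if i = 1 then w2_4 l j else if i = 2 then unit_row 3 j
     else (2 * l 3 * z2_4 l j - 3 * l 1 * unit_row 3 j - l 0 * unit_row 2 j) / 5)"
definition Z4 :: "(nat \<Rightarrow> complex) \<Rightarrow> nat \<Rightarrow> nat \<Rightarrow> complex" where
  "Z4 l i j = (if i = 0 then unit_row 2 j else if i = 1 then unit_row 3 j else if i = 2 then z2_4 l j
     else - (l 3 * w3_4 l j + l 2 * w2_4 l j) / 3)"

lemma point_4: "point (P4 l) (Q4 l) w z \<longleftrightarrow>
    l 0 + 3 * l 1 * w + 5 * w^2 = 2 * z * (l 3) \<and> 3 * z^2 = - w * (l 2 + l 3 * w)"
  by (simp add: point_def P4_def Q4_def odd_deriv_def pderiv_pCons numeral_poly power2_eq_square power3_eq_cube algebra_simps)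

lemmas rows_4 = W4_def Z4_def w2_4_def w3_4_def z2_4_def

lemma commute_4:
  "\<forall>i<4. \<forall>j<4. (\<Sum>k<4. W4 l i k * Z4 l k j) = (\<Sum>k<4. Z4 l i k * W4 l k j)"
  unfolding all_lessThan_numeral sum_lessThan_numeral
  by (simp add: rows_4 field_simps)

lemma type_II4_tables:
  fixes ix :: "nat \<Rightarrow> 'n::finite"
  assumes "bij_betw ix {..<4} UNIV"
  shows "type_II ix 4 W4 Z4 (\<lambda>i. i mod 2) (\<lambda>i. i div 2)
     (\<lambda>l. point (P4 l) (Q4 l)) (\<lambda>l. value0 (P4 l) (Q4 l)) (\<lambda>l. value1 (P4 l) (Q4 l)) 9
     P4 Q4 (\<lambda>h. [:h 0, h 1:]) (\<lambda>h. [:h 2, h 3:]) 0 2"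
proof unfold_locales
  show "bij_betw ix {..<4} UNIV" by fact
  show "polyfun 4 (\<lambda>l. W4 l i j)" "polyfun 4 (\<lambda>l. Z4 l i j)" for i j
    unfolding rows_4 by (intro polyfun_if polyfun_divide polyfun_diff polyfun.add polyfun.mult polyfun_uminus
      polyfun.const polyfun.coord; simp)+
  show "(\<Sum>k<4. W4 l i k * Z4 l k j) = (\<Sum>k<4. Z4 l i k * W4 l k j)"
    if "i < 4" "j < 4" for l i j
    using commute_4[of l] that by blast
  fix l :: "nat \<Rightarrow> complex" and w z :: complex
  let ?b = "\<lambda>i. w ^ (i mod 2) * z ^ (i div 2)"
  show "(\<Sum>j<4. W4 l i j * ?b j) = w * ?b i" "(\<Sum>j<4. Z4 l i j * ?b j) = z * ?b i"
    if "point (P4 l) (Q4 l) w z" "i < 4" for i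
  proof -
    have rel: "l 0 + 3 * l 1 * w + 5 * w^2 = 2 * z * (l 3)" "3 * z^2 = - w * (l 2 + l 3 * w)"
      using that(1) unfolding point_4 by auto
    have "\<forall>i<4. (\<Sum>j<4. W4 l i j * ?b j) = w * ?b i"
      unfolding all_lessThan_numeral sum_lessThan_numeral
      using rel by (simp add: rows_4 field_simps power2_eq_square power3_eq_cube; algebra)
    moreover have "\<forall>i<4. (\<Sum>j<4. Z4 l i j * ?b j) = z * ?b i"
      unfolding all_lessThan_numeral sum_lessThan_numeral
      using rel by (simp add: rows_4 field_simps power2_eq_square power3_eq_cube; algebra)
    ultimately show "(\<Sum>j<4. W4 l i j * ?b j) = w * ?b i" "(\<Sum>j<4. Z4 l i j * ?b j) = z * ?b i"
      using that(2) by blast+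
  qed
  show "point (P4 l) (Q4 l) w z"
    if W: "\<And>i. i < 4 \<Longrightarrow> (\<Sum>j<4. W4 l i j * u j) = w * u i"
      and Z: "\<And>i. i < 4 \<Longrightarrow> (\<Sum>j<4. Z4 l i j * u j) = z * u i"
      and k: "k < 4" "u k \<noteq> 0" for u k
  proof -
    have u: "u 1 = w * u 0" "u 2 = z * u 0" "u 3 = w * u 2"
      using W[of 0] Z[of 0] W[of 2] unfolding sum_lessThan_numeral by (simp_all add: rows_4)
    have "u 0 \<noteq> 0"
    proof
      assume "u 0 = 0"
      then have "\<forall>k<4. u k = 0" unfolding all_lessThan_numeral using u by simp
      with k show False by blast
    qed
    moreover have "u 0 * (l 0 + 3 * l 1 * w + 5 * w^2 - 2 * z * (l 3)) = 0"
      using W[of 1] u unfolding sum_lessThan_numeral by (simp add: rows_4 field_simps power2_eq_square power3_eq_cube; algebra)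
    moreover have "u 0 * (3 * z^2 + w * (l 2 + l 3 * w)) = 0"
      using Z[of 2] W[of 1] u unfolding sum_lessThan_numeral by (simp add: rows_4 field_simps power2_eq_square power3_eq_cube; algebra)
    ultimately show ?thesis unfolding point_4 by (simp add: add_eq_0_iff2)
  qed
next
  have PQ: "polyfun_coeffs 4 P4" "polyfun_coeffs 4 Q4"
    unfolding P4_def Q4_def by (intro polyfun_coeffs_pCons polyfun.coord polyfun_coeffs_const polyfun.const; simp)+
  show "polyfun_coeffs 4 (\<lambda>l. value0 (P4 l) (Q4 l))" "polyfun_coeffs 4 (\<lambda>l. value1 (P4 l) (Q4 l))"
    by (rule polyfun_value[OF PQ])+
  show "degree (value0 (P4 l) (Q4 l)) \<le> 9" "degree (value1 (P4 l) (Q4 l)) \<le> 9" for l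
    by (rule degree_value; simp add: P4_def Q4_def degree_pCons_eq_if)+
qed (simp_all add: point_def value0_def value1_def P4_def Q4_def one_pCons)

text \<open>
  For \<open>\<tau> = 5\<close> the basis is \<open>1, w, w\<^sup>2, w\<^sup>3, z\<close>. The first relation in \<open>point_5\<close> now reduces \<open>w z\<close>, the second one \<open>z\<^sup>2\<close>; multiplying the second
  by \<open>w\<close> and reducing \<open>w z\<^sup>2\<close> by the first yields \<open>w\<^sup>4\<close>.
\<close>

definition P5 :: "(nat \<Rightarrow> complex) \<Rightarrow> complex poly" where "P5 l = [:l 0, l 1, l 2:]"
definition Q5 :: "(nat \<Rightarrow> complex) \<Rightarrow> complex poly" where "Q5 l = [:l 3, l 4, 1:]"
definition wz_5 where "wz_5 l j = (5 * l 2 * unit_row 2 j + 3 * l 1 * unit_row 1 j + l 0 * unit_row 0 j - 2 * l 4 * unit_row 4 j) / 4" for l :: "nat \<Rightarrow> complex"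
definition z2_5 where "z2_5 l j = - (unit_row 3 j + l 4 * unit_row 2 j + l 3 * unit_row 1 j) / 3" for l :: "nat \<Rightarrow> complex"
definition w2z_5 where "w2z_5 l j = (5 * l 2 * unit_row 3 j + 3 * l 1 * unit_row 2 j + l 0 * unit_row 1 j - 2 * l 4 * wz_5 l j) / 4" for l :: "nat \<Rightarrow> complex"
definition w4_5 where "w4_5 l j = - l 4 * unit_row 3 j - l 3 * unit_row 2 j
    - 3 * (5 * l 2 * w2z_5 l j + 3 * l 1 * wz_5 l j + l 0 * unit_row 4 j - 2 * l 4 * z2_5 l j) / 4" for l :: "nat \<Rightarrow> complex"
definition W5 :: "(nat \<Rightarrow> complex) \<Rightarrow> nat \<Rightarrow> nat \<Rightarrow> complex" where
  "W5 l i j = (if i = 0 then unit_row 1 j else if i = 1 then unit_row 2 j else if i = 2 then unit_row 3 j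
     else if i = 3 then w4_5 l j else wz_5 l j)"
definition Z5 :: "(nat \<Rightarrow> complex) \<Rightarrow> nat \<Rightarrow> nat \<Rightarrow> complex" where
  "Z5 l i j = (if i = 0 then unit_row 4 j else if i = 1 then wz_5 l j else if i = 2 then w2z_5 l j
     else if i = 3 then (5 * l 2 * w4_5 l j + 3 * l 1 * unit_row 3 j + l 0 * unit_row 2 j - 2 * l 4 * w2z_5 l j) / 4 else z2_5 l j)"

lemma point_5: "point (P5 l) (Q5 l) w z \<longleftrightarrow>
    l 0 + 3 * l 1 * w + 5 * l 2 * w^2 = 2 * z * (l 4 + 2 * w) \<and> 3 * z^2 = - w * (l 3 + l 4 * w + w^2)"
  by (simp add: point_def P5_def Q5_def odd_deriv_def pderiv_pCons numeral_poly power2_eq_square power3_eq_cube algebra_simps)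

lemmas rows_5 = W5_def Z5_def wz_5_def z2_5_def w2z_5_def w4_5_def

lemma commute_5:
  "\<forall>i<5. \<forall>j<5. (\<Sum>k<5. W5 l i k * Z5 l k j) = (\<Sum>k<5. Z5 l i k * W5 l k j)"
  unfolding all_lessThan_numeral sum_lessThan_numeral
  by (simp add: rows_5 field_simps)

lemma type_II5_tables:
  fixes ix :: "nat \<Rightarrow> 'n::finite"
  assumes "bij_betw ix {..<5} UNIV"
  shows "type_II ix 5 W5 Z5 (\<lambda>i. i mod 4) (\<lambda>i. i div 4)
     (\<lambda>l. point (P5 l) (Q5 l)) (\<lambda>l. value0 (P5 l) (Q5 l)) (\<lambda>l. value1 (P5 l) (Q5 l)) 9
     P5 Q5 (\<lambda>h. [:h 0, h 1, h 2:]) (\<lambda>h. [:h 3, h 4:]) 0 3"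
proof unfold_locales
  show "bij_betw ix {..<5} UNIV" by fact
  show "polyfun 5 (\<lambda>l. W5 l i j)" "polyfun 5 (\<lambda>l. Z5 l i j)" for i j
    unfolding rows_5 by (intro polyfun_if polyfun_divide polyfun_diff polyfun.add polyfun.mult polyfun_uminus
      polyfun.const polyfun.coord; simp)+
  show "(\<Sum>k<5. W5 l i k * Z5 l k j) = (\<Sum>k<5. Z5 l i k * W5 l k j)"
    if "i < 5" "j < 5" for l i j
    using commute_5[of l] that by blast
  fix l :: "nat \<Rightarrow> complex" and w z :: complex
  let ?b = "\<lambda>i. w ^ (i mod 4) * z ^ (i div 4)"
  show "(\<Sum>j<5. W5 l i j * ?b j) = w * ?b i" "(\<Sum>j<5. Z5 l i j * ?b j) = z * ?b i"
    if "point (P5 l) (Q5 l) w z" "i < 5" for i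
  proof -
    have rel: "l 0 + 3 * l 1 * w + 5 * l 2 * w^2 = 2 * z * (l 4 + 2 * w)" "3 * z^2 = - w * (l 3 + l 4 * w + w^2)"
      using that(1) unfolding point_5 by auto
    have "\<forall>i<5. (\<Sum>j<5. W5 l i j * ?b j) = w * ?b i"
      unfolding all_lessThan_numeral sum_lessThan_numeral
      using rel by (simp add: rows_5 field_simps power2_eq_square power3_eq_cube; algebra)
    moreover have "\<forall>i<5. (\<Sum>j<5. Z5 l i j * ?b j) = z * ?b i"
      unfolding all_lessThan_numeral sum_lessThan_numeral
      using rel by (simp add: rows_5 field_simps power2_eq_square power3_eq_cube; algebra)
    ultimately show "(\<Sum>j<5. W5 l i j * ?b j) = w * ?b i" "(\<Sum>j<5. Z5 l i j * ?b j) = z * ?b i"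
      using that(2) by blast+
  qed
  show "point (P5 l) (Q5 l) w z"
    if W: "\<And>i. i < 5 \<Longrightarrow> (\<Sum>j<5. W5 l i j * u j) = w * u i"
      and Z: "\<And>i. i < 5 \<Longrightarrow> (\<Sum>j<5. Z5 l i j * u j) = z * u i"
      and k: "k < 5" "u k \<noteq> 0" for u k
  proof -
    have u: "u 1 = w * u 0" "u 2 = w * u 1" "u 3 = w * u 2" "u 4 = z * u 0"
      using W[of 0] W[of 1] W[of 2] Z[of 0] unfolding sum_lessThan_numeral by (simp_all add: rows_5)
    have "u 0 \<noteq> 0"
    proof
      assume "u 0 = 0"
      then have "\<forall>k<5. u k = 0" unfolding all_lessThan_numeral using u by simp
      with k show False by blast
    qed
    moreover have "u 0 * (l 0 + 3 * l 1 * w + 5 * l 2 * w^2 - 2 * z * (l 4 + 2 * w)) = 0"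
      using W[of 4] u unfolding sum_lessThan_numeral by (simp add: rows_5 field_simps power2_eq_square power3_eq_cube; algebra)
    moreover have "u 0 * (3 * z^2 + w * (l 3 + l 4 * w + w^2)) = 0"
      using Z[of 4]  u unfolding sum_lessThan_numeral by (simp add: rows_5 field_simps power2_eq_square power3_eq_cube; algebra)
    ultimately show ?thesis unfolding point_5 by (simp add: add_eq_0_iff2)
  qed
next
  have PQ: "polyfun_coeffs 5 P5" "polyfun_coeffs 5 Q5"
    unfolding P5_def Q5_def by (intro polyfun_coeffs_pCons polyfun.coord polyfun_coeffs_const polyfun.const; simp)+
  show "polyfun_coeffs 5 (\<lambda>l. value0 (P5 l) (Q5 l))" "polyfun_coeffs 5 (\<lambda>l. value1 (P5 l) (Q5 l))"
    by (rule polyfun_value[OF PQ])+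
  show "degree (value0 (P5 l) (Q5 l)) \<le> 9" "degree (value1 (P5 l) (Q5 l)) \<le> 9" for l
    by (rule degree_value; simp add: P5_def Q5_def degree_pCons_eq_if)+
qed (simp_all add: point_def value0_def value1_def P5_def Q5_def one_pCons)

text \<open>
  For \<open>\<tau> = 6\<close> the basis is \<open>1, w, w\<^sup>2, z, w z, w\<^sup>2 z\<close>, and the relations in \<open>point_6\<close> reduce \<open>w\<^sup>3\<close> and \<open>z\<^sup>2\<close>.
\<close>

definition P6 :: "(nat \<Rightarrow> complex) \<Rightarrow> complex poly" where "P6 l = [:l 0, l 1, l 2, 1:]"
definition Q6 :: "(nat \<Rightarrow> complex) \<Rightarrow> complex poly" where "Q6 l = [:l 3, l 4, l 5:]"
definition w3_6 where "w3_6 l j = (2 * l 4 * unit_row 3 j + 4 * l 5 * unit_row 4 j - 5 * l 2 * unit_row 2 j - 3 * l 1 * unit_row 1 j - l 0 * unit_row 0 j) / 7" for l :: "nat \<Rightarrow> complex"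
definition w4_6 where "w4_6 l j = (2 * l 4 * unit_row 4 j + 4 * l 5 * unit_row 5 j - 5 * l 2 * w3_6 l j - 3 * l 1 * unit_row 2 j - l 0 * unit_row 1 j) / 7" for l :: "nat \<Rightarrow> complex"
definition z2_6 where "z2_6 l j = - (l 5 * w3_6 l j + l 4 * unit_row 2 j + l 3 * unit_row 1 j) / 3" for l :: "nat \<Rightarrow> complex"
definition wz2_6 where "wz2_6 l j = - (l 5 * w4_6 l j + l 4 * w3_6 l j + l 3 * unit_row 2 j) / 3" for l :: "nat \<Rightarrow> complex"
definition w3z_6 where "w3z_6 l j = (2 * l 4 * z2_6 l j + 4 * l 5 * wz2_6 l j - 5 * l 2 * unit_row 5 j - 3 * l 1 * unit_row 4 j - l 0 * unit_row 3 j) / 7" for l :: "nat \<Rightarrow> complex"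
definition w5_6 where "w5_6 l j = (2 * l 4 * unit_row 5 j + 4 * l 5 * w3z_6 l j - 5 * l 2 * w4_6 l j - 3 * l 1 * w3_6 l j - l 0 * unit_row 2 j) / 7" for l :: "nat \<Rightarrow> complex"
definition W6 :: "(nat \<Rightarrow> complex) \<Rightarrow> nat \<Rightarrow> nat \<Rightarrow> complex" where
  "W6 l i j = (if i = 0 then unit_row 1 j else if i = 1 then unit_row 2 j else if i = 2 then w3_6 l j
     else if i = 3 then unit_row 4 j else if i = 4 then unit_row 5 j else w3z_6 l j)"
definition Z6 :: "(nat \<Rightarrow> complex) \<Rightarrow> nat \<Rightarrow> nat \<Rightarrow> complex" where
  "Z6 l i j = (if i = 0 then unit_row 3 j else if i = 1 then unit_row 4 j else if i = 2 then unit_row 5 j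
     else if i = 3 then z2_6 l j else if i = 4 then wz2_6 l j else - (l 5 * w5_6 l j + l 4 * w4_6 l j + l 3 * w3_6 l j) / 3)"

lemma point_6: "point (P6 l) (Q6 l) w z \<longleftrightarrow>
    l 0 + 3 * l 1 * w + 5 * l 2 * w^2 + 7 * w^3 = 2 * z * (l 4 + 2 * l 5 * w) \<and> 3 * z^2 = - w * (l 3 + l 4 * w + l 5 * w^2)"
  by (simp add: point_def P6_def Q6_def odd_deriv_def pderiv_pCons numeral_poly power2_eq_square power3_eq_cube algebra_simps)

lemmas rows_6 = W6_def Z6_def w3_6_def w4_6_def z2_6_def wz2_6_def w3z_6_def w5_6_def

text \<open>
  The product of a row vector and a matrix. For \<open>\<tau> = 6\<close> the two products of the multiplication matrices are compared row by row, with the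
  coordinate rows of the monomials kept folded; expanding all entries in terms of the parameters would be unwieldy.
\<close>

definition row_times :: "nat \<Rightarrow> (nat \<Rightarrow> nat \<Rightarrow> complex) \<Rightarrow> (nat \<Rightarrow> complex) \<Rightarrow> nat \<Rightarrow> complex" where
  "row_times n M r j = (\<Sum>k<n. r k * M k j)"

lemma row_times_linear:
  "row_times n M (\<lambda>k. x k + y k) j = row_times n M x j + row_times n M y j"
  "row_times n M (\<lambda>k. x k - y k) j = row_times n M x j - row_times n M y j"
  "row_times n M (\<lambda>k. - x k) j = - row_times n M x j"
  "row_times n M (\<lambda>k. c * x k) j = c * row_times n M x j"
  "row_times n M (\<lambda>k. x k / c) j = row_times n M x j / c"
  by (simp_all add: row_times_def sum.distrib sum_subtractf sum_negf sum_distrib_left sum_divide_distrib algebra_simps)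

lemma row_times_unit: "i < n \<Longrightarrow> row_times n M (unit_row i) j = M i j"
  by (simp add: row_times_def if_distrib[of "\<lambda>x. x * _"] cong: if_cong)

lemma row_W6:
  "W6 l 0 = unit_row 1" "W6 l (Suc 0) = unit_row 2" "W6 l 2 = w3_6 l" "W6 l 3 = unit_row 4" "W6 l 4 = unit_row 5" "W6 l 5 = w3z_6 l"
  by (simp_all add: W6_def fun_eq_iff)

definition w2z2_6 where "w2z2_6 l j = - (l 5 * w5_6 l j + l 4 * w4_6 l j + l 3 * w3_6 l j) / 3" for l :: "nat \<Rightarrow> complex"

lemma row_Z6:
  "Z6 l 0 = unit_row 3" "Z6 l (Suc 0) = unit_row 4" "Z6 l 2 = unit_row 5" "Z6 l 3 = z2_6 l" "Z6 l 4 = wz2_6 l" "Z6 l 5 = w2z2_6 l"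
  by (simp_all add: Z6_def w2z2_6_def fun_eq_iff)

text \<open>
  The two ways to compute the row of \<open>w\<^sup>3 z\<^sup>2\<close>: reducing \<open>w\<^sup>3\<close> first, or \<open>z\<^sup>2\<close> first.
\<close>

lemma commute_6_aux:
  fixes l0 l1 l2 l3 l4 l5 w3 w4 w5 w3z w4z z2 wz2 w2z2 e1 e2 e3 e4 e5 :: complex
  assumes w5: "w5 = (2 * l4 * e5 + 4 * l5 * w3z - 5 * l2 * w4 - 3 * l1 * w3 - l0 * e2) / 7"
    and w4: "w4 = (2 * l4 * e4 + 4 * l5 * e5 - 5 * l2 * w3 - 3 * l1 * e2 - l0 * e1) / 7"
    and w2z2: "w2z2 = - (l5 * w5 + l4 * w4 + l3 * w3) / 3"
    and wz2: "wz2 = - (l5 * w4 + l4 * w3 + l3 * e2) / 3"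
    and z2: "z2 = - (l5 * w3 + l4 * e2 + l3 * e1) / 3"
  shows "(2 * l4 * (- (l5 * w3z + l4 * e5 + l3 * e4) / 3)
        + 4 * l5 * (- (l5 * w4z + l4 * w3z + l3 * e5) / 3)
        - 5 * l2 * w2z2 - 3 * l1 * wz2 - l0 * z2) / 7
     = - (l5 * ((2 * l4 * w3z + 4 * l5 * w4z - 5 * l2 * w5 - 3 * l1 * w4 - l0 * w3) / 7)
        + l4 * w5 + l3 * w4) / 3" (is "?L / 7 = - ?R / 3")
proof -
  have "3 * ?L = - 2 * l4 * (l5 * w3z + l4 * e5 + l3 * e4) - 4 * l5 * (l5 * w4z + l4 * w3z + l3 * e5)
      + 5 * l2 * (l5 * w5 + l4 * w4 + l3 * w3) + 3 * l1 * (l5 * w4 + l4 * w3 + l3 * e2)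
      + l0 * (l5 * w3 + l4 * e2 + l3 * e1)"
    unfolding w2z2 wz2 z2 by (simp add: algebra_simps add_divide_distrib diff_divide_distrib)
  also have "\<dots> = - (l5 * (2 * l4 * w3z + 4 * l5 * w4z - 5 * l2 * w5 - 3 * l1 * w4 - l0 * w3)
        + l4 * (2 * l4 * e5 + 4 * l5 * w3z - 5 * l2 * w4 - 3 * l1 * w3 - l0 * e2)
        + l3 * (2 * l4 * e4 + 4 * l5 * e5 - 5 * l2 * w3 - 3 * l1 * e2 - l0 * e1))"
    by (simp add: algebra_simps)
  also have "2 * l4 * e5 + 4 * l5 * w3z - 5 * l2 * w4 - 3 * l1 * w3 - l0 * e2 = 7 * w5" by (simp add: w5)
  also have "2 * l4 * e4 + 4 * l5 * e5 - 5 * l2 * w3 - 3 * l1 * e2 - l0 * e1 = 7 * w4" by (simp add: w4)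
  also have "- (l5 * (2 * l4 * w3z + 4 * l5 * w4z - 5 * l2 * w5 - 3 * l1 * w4 - l0 * w3)
      + l4 * (7 * w5) + l3 * (7 * w4)) = - 7 * ?R" by (simp add: algebra_simps)
  finally have "3 * ?L = - 7 * ?R" .
  moreover have "x / 7 = - y / 3" if "3 * x = - 7 * y" for x y :: complex
    using that by (simp add: field_simps)
  ultimately show ?thesis by blast
qed

lemma commute_6:
  "\<forall>i<6. \<forall>j<6. (\<Sum>k<6. W6 l i k * Z6 l k j) = (\<Sum>k<6. Z6 l i k * W6 l k j)"
proof -
  let ?W = "row_times 6 (W6 l)" and ?Z = "row_times 6 (Z6 l)"
  note s = row_times_linear row_times_unit row_W6 row_Z6
  define w4z where "w4z j = (2 * l 4 * wz2_6 l j + 4 * l 5 * w2z2_6 l j - 5 * l 2 * w3z_6 l j - 3 * l 1 * unit_row 5 j - l 0 * unit_row 4 j) / 7" for j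
  have Ww3: "?W (w3_6 l) j = w4_6 l j" and Zw3: "?Z (w3_6 l) j = w3z_6 l j" for j
    unfolding w3_6_def[abs_def] by (simp_all add: s w4_6_def w3z_6_def)
  have Ww4: "?W (w4_6 l) j = w5_6 l j" and Zw4: "?Z (w4_6 l) j = w4z j" for j
    unfolding w4_6_def[abs_def] by (simp_all add: s Ww3 Zw3 w5_6_def w4z_def)
  have Wz2: "?W (z2_6 l) j = wz2_6 l j" and Zz2: "?Z (z2_6 l) j = - (l 5 * w3z_6 l j + l 4 * unit_row 5 j + l 3 * unit_row 4 j) / 3" for j
    unfolding z2_6_def[abs_def] by (simp_all add: s Ww3 Zw3 wz2_6_def)
  have Wwz2: "?W (wz2_6 l) j = w2z2_6 l j" and Zwz2: "?Z (wz2_6 l) j = - (l 5 * w4z j + l 4 * w3z_6 l j + l 3 * unit_row 5 j) / 3" for j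
    unfolding wz2_6_def[abs_def] by (simp_all add: s Ww3 Zw3 Ww4 Zw4 w2z2_6_def)
  have Ww3z: "?W (w3z_6 l) j = w4z j" for j
    unfolding w3z_6_def[abs_def] by (simp add: s Wz2 Wwz2 w4z_def)
  have Ww5: "?W (w5_6 l) j = (2 * l 4 * w3z_6 l j + 4 * l 5 * w4z j - 5 * l 2 * w5_6 l j - 3 * l 1 * w4_6 l j - l 0 * w3_6 l j) / 7" for j
    unfolding w5_6_def[abs_def] by (simp add: s Ww3z Ww4 Ww3) (simp add: w5_6_def)
  have last: "?W (w2z2_6 l) j = ?Z (w3z_6 l) j" for j
  proof -
    have "?Z (w3z_6 l) j = (2 * l 4 * (- (l 5 * w3z_6 l j + l 4 * unit_row 5 j + l 3 * unit_row 4 j) / 3)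
        + 4 * l 5 * (- (l 5 * w4z j + l 4 * w3z_6 l j + l 3 * unit_row 5 j) / 3)
        - 5 * l 2 * w2z2_6 l j - 3 * l 1 * wz2_6 l j - l 0 * z2_6 l j) / 7"
      by (subst w3z_6_def[abs_def]) (simp add: s Zz2 Zwz2)
    also have "\<dots> = - (l 5 * ((2 * l 4 * w3z_6 l j + 4 * l 5 * w4z j - 5 * l 2 * w5_6 l j - 3 * l 1 * w4_6 l j - l 0 * w3_6 l j) / 7)
        + l 4 * w5_6 l j + l 3 * w4_6 l j) / 3"
      by (rule commute_6_aux[OF w5_6_def w4_6_def w2z2_6_def wz2_6_def z2_6_def])
    also have "\<dots> = ?W (w2z2_6 l) j"
      unfolding w2z2_6_def[abs_def] by (simp add: s Ww5 Ww4 Ww3)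
    finally show ?thesis ..
  qed
  have "\<forall>i<6. \<forall>j<6. ?Z (W6 l i) j = ?W (Z6 l i) j"
    unfolding all_lessThan_numeral(3)[of "\<lambda>i. \<forall>j<6. ?Z (W6 l i) j = ?W (Z6 l i) j"]
    using last by (simp add: s Zw3 Wz2 Wwz2 w3z_6_def)
  then show ?thesis by (simp only: row_times_def)
qed

lemma type_II6_tables:
  fixes ix :: "nat \<Rightarrow> 'n::finite"
  assumes "bij_betw ix {..<6} UNIV"
  shows "type_II ix 6 W6 Z6 (\<lambda>i. i mod 3) (\<lambda>i. i div 3)
     (\<lambda>l. point (P6 l) (Q6 l)) (\<lambda>l. value0 (P6 l) (Q6 l)) (\<lambda>l. value1 (P6 l) (Q6 l)) 9
     P6 Q6 (\<lambda>h. [:h 0, h 1, h 2:]) (\<lambda>h. [:h 3, h 4, h 5:]) 0 3"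
proof unfold_locales
  show "bij_betw ix {..<6} UNIV" by fact
  show "polyfun 6 (\<lambda>l. W6 l i j)" "polyfun 6 (\<lambda>l. Z6 l i j)" for i j
    unfolding rows_6 by (intro polyfun_if polyfun_divide polyfun_diff polyfun.add polyfun.mult polyfun_uminus
      polyfun.const polyfun.coord; simp)+
  show "(\<Sum>k<6. W6 l i k * Z6 l k j) = (\<Sum>k<6. Z6 l i k * W6 l k j)"
    if "i < 6" "j < 6" for l i j
    using commute_6[of l] that by blast
  fix l :: "nat \<Rightarrow> complex" and w z :: complex
  let ?b = "\<lambda>i. w ^ (i mod 3) * z ^ (i div 3)"
  show "(\<Sum>j<6. W6 l i j * ?b j) = w * ?b i" "(\<Sum>j<6. Z6 l i j * ?b j) = z * ?b i"
    if "point (P6 l) (Q6 l) w z" "i < 6" for i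
  proof -
    have rel: "l 0 + 3 * l 1 * w + 5 * l 2 * w^2 + 7 * w^3 = 2 * z * (l 4 + 2 * l 5 * w)" "3 * z^2 = - w * (l 3 + l 4 * w + l 5 * w^2)"
      using that(1) unfolding point_6 by auto
    have "\<forall>i<6. (\<Sum>j<6. W6 l i j * ?b j) = w * ?b i"
      unfolding all_lessThan_numeral sum_lessThan_numeral
      using rel by (simp add: rows_6 field_simps power2_eq_square power3_eq_cube; algebra)
    moreover have "\<forall>i<6. (\<Sum>j<6. Z6 l i j * ?b j) = z * ?b i"
      unfolding all_lessThan_numeral sum_lessThan_numeral
      using rel by (simp add: rows_6 field_simps power2_eq_square power3_eq_cube; algebra)
    ultimately show "(\<Sum>j<6. W6 l i j * ?b j) = w * ?b i" "(\<Sum>j<6. Z6 l i j * ?b j) = z * ?b i"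
      using that(2) by blast+
  qed
  show "point (P6 l) (Q6 l) w z"
    if W: "\<And>i. i < 6 \<Longrightarrow> (\<Sum>j<6. W6 l i j * u j) = w * u i"
      and Z: "\<And>i. i < 6 \<Longrightarrow> (\<Sum>j<6. Z6 l i j * u j) = z * u i"
      and k: "k < 6" "u k \<noteq> 0" for u k
  proof -
    have u: "u 1 = w * u 0" "u 2 = w * u 1" "u 3 = z * u 0" "u 4 = w * u 3" "u 5 = w * u 4"
      using W[of 0] W[of 1] Z[of 0] W[of 3] W[of 4] unfolding sum_lessThan_numeral by (simp_all add: rows_6)
    have "u 0 \<noteq> 0"
    proof
      assume "u 0 = 0"
      then have "\<forall>k<6. u k = 0" unfolding all_lessThan_numeral using u by simp
      with k show False by blast
    qed
    moreover have "u 0 * (l 0 + 3 * l 1 * w + 5 * l 2 * w^2 + 7 * w^3 - 2 * z * (l 4 + 2 * l 5 * w)) = 0"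
      using W[of 2] u unfolding sum_lessThan_numeral by (simp add: rows_6 field_simps power2_eq_square power3_eq_cube; algebra)
    moreover have "u 0 * (3 * z^2 + w * (l 3 + l 4 * w + l 5 * w^2)) = 0"
      using Z[of 3] W[of 2] u unfolding sum_lessThan_numeral by (simp add: rows_6 field_simps power2_eq_square power3_eq_cube; algebra)
    ultimately show ?thesis unfolding point_6 by (simp add: add_eq_0_iff2)
  qed
next
  have PQ: "polyfun_coeffs 6 P6" "polyfun_coeffs 6 Q6"
    unfolding P6_def Q6_def by (intro polyfun_coeffs_pCons polyfun.coord polyfun_coeffs_const polyfun.const; simp)+
  show "polyfun_coeffs 6 (\<lambda>l. value0 (P6 l) (Q6 l))" "polyfun_coeffs 6 (\<lambda>l. value1 (P6 l) (Q6 l))"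
    by (rule polyfun_value[OF PQ])+
  show "degree (value0 (P6 l) (Q6 l)) \<le> 9" "degree (value1 (P6 l) (Q6 l)) \<le> 9" for l
    by (rule degree_value; simp add: P6_def Q6_def degree_pCons_eq_if)+
qed (simp_all add: point_def value0_def value1_def P6_def Q6_def one_pCons)

section \<open>The three families of type II\<close>

lemma (in point_algebra) genericI:
  assumes "finite C" "card C = n" "0 \<notin> C" "\<And>c. c \<in> C \<Longrightarrow> \<exists>w z. Pt l w z \<and> F l w z = c"
  shows "generic l"
proof -
  let ?R = "{c. poly (pol l) c = 0}"
  have p0: "pol l \<noteq> 0" using monic_pol[of l] by auto
  have fin: "finite ?R" using p0 by (rule poly_roots_finite)
  have sub: "C \<subseteq> ?R" using assms(4) pol_root_iff by blast
  have "card ?R \<le> n" using card_poly_roots_bound[OF p0] monic_pol(1)[of l] by simp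
  then have "?R = C" using card_seteq[OF fin sub] assms(2) by simp
  moreover from this have "poly (pol l) 0 \<noteq> 0" using assms(3) by blast
  ultimately show ?thesis using assms(2) by (simp add: generic_def)
qed

context type_II begin

lemma nonzero_critical_values_II:
  assumes "matrix_family S = (\<lambda>l. matrix_II (poly (P l)) (poly (Q l)))"
  shows "nonzero_critical_values S ix t = {c. poly (pol (\<lambda>i. t $ ix i)) c = 0} - {0}"
proof -
  have "c \<in> nonzero_critical_values S ix t \<longleftrightarrow> c \<noteq> 0 \<and> poly (pol (\<lambda>i. t $ ix i)) c = 0" for c
    using critical_values_II[of c "P (\<lambda>i. t $ ix i)" "Q (\<lambda>i. t $ ix i)"]
    unfolding nonzero_critical_values_def assms pol_root_iff F_eq Pt_iff
    by (cases "c = 0") (auto simp: odd_deriv_def mult_ac)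
  then show ?thesis by auto
qed

text \<open>
  The factors \<open>\<sigma>\<close>, \<open>\<zeta>\<close>, \<open>\<pi>\<close>, \<open>\<kappa>\<close> and \<open>\<rho>\<close> scale \<open>w\<close>, \<open>z\<close>, \<open>p\<close>, \<open>q\<close> and the critical values; the relations between them say that all terms of
  each equation scale alike.
\<close>

lemma homogeneous_II:
  assumes nz: "\<sigma> \<noteq> 0" and wt: "\<pi> * \<sigma> = \<zeta> * \<kappa>" "\<zeta>^2 = \<sigma> * \<kappa>" "\<sigma> * \<pi>^2 = \<rho>" "\<pi> * \<kappa> * \<zeta> = \<rho>" "\<kappa>^3 = \<rho>"
    and scale: "\<And>w. poly (P l') (\<sigma> * w) = \<pi> * poly (P l) w" "\<And>w. poly (Q l') (\<sigma> * w) = \<kappa> * poly (Q l) w"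
    and c: "poly (pol l) c = 0"
  shows "poly (pol l') (\<rho> * c) = 0"
proof -
  have deriv: "\<sigma> * poly (pderiv p') (\<sigma> * w) = k * poly (pderiv p) w"
    if "\<And>w. poly p' (\<sigma> * w) = k * poly p w" for p p' :: "complex poly" and k w
  proof -
    have "pcompose p' [:0, \<sigma>:] = smult k p"
    proof (rule poly_eq_poly_eq_iff[THEN iffD1], rule ext)
      fix x
      have "poly p' (x * \<sigma>) = k * poly p x" using that[of x] by (simp only: mult.commute)
      then show "poly (pcompose p' [:0, \<sigma>:]) x = poly (smult k p) x" by (simp add: poly_pcompose)
    qed
    then have "pderiv (pcompose p' [:0, \<sigma>:]) = smult k (pderiv p)" by (simp add: pderiv_smult)
    then have "poly (pcompose (pderiv p') [:0, \<sigma>:] * [:\<sigma>:]) w = k * poly (pderiv p) w"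
      by (simp add: pderiv_pcompose pderiv_pCons)
    then show ?thesis by (simp add: poly_pcompose mult.commute)
  qed
  obtain w z where wz: "Pt l w z" "F l w z = c" using c pol_root_iff by blast
  have r: "poly (P l) w + 2 * w * poly (pderiv (P l)) w = 2 * z * poly (pderiv (Q l)) w"
    and q: "3 * z^2 = - w * poly (Q l) w"
    using wz(1) by (simp_all add: Pt_iff odd_deriv_def mult_ac)
  have dP': "\<sigma> * poly (pderiv (P l')) (\<sigma> * w) = \<pi> * poly (pderiv (P l)) w"
    and dQ': "\<sigma> * poly (pderiv (Q l')) (\<sigma> * w) = \<kappa> * poly (pderiv (Q l)) w"
    using deriv[OF scale(1)] deriv[OF scale(2)] by blast+
  have "\<sigma> * (poly (P l') (\<sigma> * w) + 2 * (\<sigma> * w) * poly (pderiv (P l')) (\<sigma> * w)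
      - 2 * (\<zeta> * z) * poly (pderiv (Q l')) (\<sigma> * w)) = 0"
    using dP' dQ' r wt(1) scale(1)[of w] by algebra
  then have "poly (P l') (\<sigma> * w) + 2 * (\<sigma> * w) * poly (pderiv (P l')) (\<sigma> * w)
      - 2 * (\<zeta> * z) * poly (pderiv (Q l')) (\<sigma> * w) = 0" using nz by simp
  moreover have "3 * (\<zeta> * z)^2 = - (\<sigma> * w) * poly (Q l') (\<sigma> * w)"
    using q wt(2) scale(2)[of w] by algebra
  ultimately have "Pt l' (\<sigma> * w) (\<zeta> * z)" by (simp add: Pt_iff odd_deriv_def mult_ac)
  moreover have "F l' (\<sigma> * w) (\<zeta> * z) = \<rho> * c"
  proof -
    have 1: "\<sigma> * w * (\<pi> * poly (P l) w)^2 = \<rho> * (w * poly (P l) w ^ 2)"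
      unfolding wt(3)[symmetric] by (simp add: power_mult_distrib mult_ac)
    have 2: "4/3 * (\<pi> * poly (P l) w) * (\<kappa> * poly (Q l) w) * (\<zeta> * z) = \<rho> * (4/3 * poly (P l) w * poly (Q l) w * z)"
      unfolding wt(4)[symmetric] by (simp add: mult_ac)
    have 3: "4/27 * (\<kappa> * poly (Q l) w)^3 = \<rho> * (4/27 * poly (Q l) w ^ 3)"
      unfolding wt(5)[symmetric] by (simp add: power_mult_distrib)
    show ?thesis unfolding wz(2)[symmetric] F_eq scale 1 2 3 by (simp only: right_diff_distrib mult_minus_right)
  qed
  ultimately show ?thesis using pol_root_iff by blast
qed

lemma nilpotent_II:
  assumes nil: "\<And>c. poly (pol l) c = 0 \<Longrightarrow> c = 0"
    and deg: "degree (P l) \<le> 3" "degree (Q l) \<le> 2" "degree (eliminant (P l) (Q l)) = n" "degree (cubic_discr (P l) (Q l)) \<le> Suc n"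
      "degree (wronsk (P l) (Q l)) < n" "cubic_discr (P l) (Q l) \<noteq> 0"
  shows "poly (P l) 0 = 0 \<and> poly (Q l) 0 = 0 \<and> (\<forall>j\<le>n. coeff (cubic_discr (P l) (Q l)) j = 0)"
proof (rule nilpotent_imp_discriminant_monomial[OF deg(1-3) n_pos deg(4-6)])
  fix w z assume "poly (odd_deriv (P l)) w = 2 * z * poly (pderiv (Q l)) w" "3 * z^2 = - w * poly (Q l) w"
  then have "Pt l w z" by (simp add: Pt_iff)
  then have "F l w z = 0" using nil pol_root_iff by blast
  then have "27 * F l w z = 0" by simp
  then show "27 * w * poly (P l) w ^ 2 - 36 * poly (P l) w * poly (Q l) w * z - 4 * poly (Q l) w ^ 3 = 0"
    unfolding F_eq by (simp add: algebra_simps)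
qed

end

abbreviation (input) LL_covering_property :: "sym_singularity \<Rightarrow> (nat \<Rightarrow> 'n::finite) \<Rightarrow> bool" where
  "LL_covering_property S ix \<equiv> holomorphic_map_on (LL S ix) UNIV
       \<and> proper_map euclidean euclidean (LL S ix)
       \<and> LL S ix ` bifurcation_diagram S ix \<subseteq> discriminant_set ix
       \<and> covering_space (- bifurcation_diagram S ix) (LL S ix) (- discriminant_set ix)
       \<and> (\<exists>N::nat. \<forall>a \<in> - discriminant_set ix.
            finite {t \<in> - bifurcation_diagram S ix. LL S ix t = a} \<and>
            card {t \<in> - bifurcation_diagram S ix. LL S ix t = a} = N)"

text \<open>
  With these expansions the degrees required in \<open>nilpotent_II\<close> can be read off: \<open>\<tau> + 1\<close> for the discriminant, \<open>\<tau>\<close> for the eliminant, and less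
  than \<open>\<tau>\<close> for the Wronskian.
\<close>

lemma discriminants_4:
  "cubic_discr (P4 l) (Q4 l) = [:4 * l 2^3, 27 * l 0^2 + 12 * l 2^2 * l 3, 54 * l 0 * l 1 + 12 * l 2 * l 3^2, 54 * l 0 + 27 * l 1^2 + 4 * l 3^3, 54 * l 1, 27:]"
  "eliminant (P4 l) (Q4 l) = [:3 * l 0^2, 18 * l 0 * l 1 + 4 * l 2 * l 3^2, 30 * l 0 + 27 * l 1^2 + 4 * l 3^3, 90 * l 1, 75:]"
  "wronsk (P4 l) (Q4 l) = [:- l 0 * l 2, 2 * l 0 * l 3 - 3 * l 1 * l 2, - 5 * l 2, - 2 * l 3:]"
  by (simp_all add: cubic_discr_def eliminant_def wronsk_def odd_deriv_def P4_def Q4_def pderiv_pCons numeral_poly power2_eq_square power3_eq_cube algebra_simps)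

lemma discriminants_5:
  "cubic_discr (P5 l) (Q5 l) = [:4 * l 3^3, 27 * l 0^2 + 12 * l 3^2 * l 4, 54 * l 0 * l 1 + 12 * l 3 * l 4^2 + 12 * l 3^2, 54 * l 0 * l 2 + 27 * l 1^2 + 24 * l 3 * l 4 + 4 * l 4^3, 54 * l 1 * l 2 + 12 * l 3 + 12 * l 4^2, 27 * l 2^2 + 12 * l 4, 4:]"
  "eliminant (P5 l) (Q5 l) = [:3 * l 0^2, 18 * l 0 * l 1 + 4 * l 3 * l 4^2, 30 * l 0 * l 2 + 27 * l 1^2 + 16 * l 3 * l 4 + 4 * l 4^3, 90 * l 1 * l 2 + 16 * l 3 + 20 * l 4^2, 75 * l 2^2 + 32 * l 4, 16:]"
  "wronsk (P5 l) (Q5 l) = [:- l 0 * l 3, 2 * l 0 * l 4 - 3 * l 1 * l 3, 5 * l 0 - 5 * l 2 * l 3, 3 * l 1 - 2 * l 2 * l 4, l 2:]"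
  by (simp_all add: cubic_discr_def eliminant_def wronsk_def odd_deriv_def P5_def Q5_def pderiv_pCons numeral_poly power2_eq_square power3_eq_cube algebra_simps)

lemma discriminants_6:
  "cubic_discr (P6 l) (Q6 l) = [:4 * l 3^3, 27 * l 0^2 + 12 * l 3^2 * l 4, 54 * l 0 * l 1 + 12 * l 3 * l 4^2 + 12 * l 3^2 * l 5, 54 * l 0 * l 2 + 27 * l 1^2 + 24 * l 3 * l 4 * l 5 + 4 * l 4^3, 54 * l 0 + 54 * l 1 * l 2 + 12 * l 3 * l 5^2 + 12 * l 4^2 * l 5, 54 * l 1 + 27 * l 2^2 + 12 * l 4 * l 5^2, 54 * l 2 + 4 * l 5^3, 27:]"
  "eliminant (P6 l) (Q6 l) = [:3 * l 0^2, 18 * l 0 * l 1 + 4 * l 3 * l 4^2, 30 * l 0 * l 2 + 27 * l 1^2 + 16 * l 3 * l 4 * l 5 + 4 * l 4^3, 42 * l 0 + 90 * l 1 * l 2 + 16 * l 3 * l 5^2 + 20 * l 4^2 * l 5, 126 * l 1 + 75 * l 2^2 + 32 * l 4 * l 5^2, 210 * l 2 + 16 * l 5^3, 147:]"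
  "wronsk (P6 l) (Q6 l) = [:- l 0 * l 3, 2 * l 0 * l 4 - 3 * l 1 * l 3, 5 * l 0 * l 5 - 5 * l 2 * l 3, 3 * l 1 * l 5 - 2 * l 2 * l 4 - 7 * l 3, l 2 * l 5 - 4 * l 4, - l 5:]"
  by (simp_all add: cubic_discr_def eliminant_def wronsk_def odd_deriv_def P6_def Q6_def pderiv_pCons numeral_poly power2_eq_square power3_eq_cube algebra_simps)

text \<open>
  In all three families the discriminant is a monomial only at the origin, once the constant terms of \<open>p\<close> and \<open>q\<close> vanish.
\<close>

lemma cubic_discr_monomial_4: assumes "\<forall>j\<le>4. coeff (cubic_discr (P4 l) (Q4 l)) j = 0" "l 0 = 0" "l 2 = 0"
  shows "l 1 = 0" "l 3 = 0"
proof -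
  have "coeff (cubic_discr (P4 l) (Q4 l)) 3 = 0" "coeff (cubic_discr (P4 l) (Q4 l)) 4 = 0" using assms(1) by auto
  then show "l 1 = 0" "l 3 = 0" using assms(2,3) unfolding discriminants_4 by (auto simp: eval_nat_numeral)
qed

lemma cubic_discr_monomial_5: assumes "\<forall>j\<le>5. coeff (cubic_discr (P5 l) (Q5 l)) j = 0" "l 0 = 0" "l 3 = 0"
  shows "l 1 = 0" "l 2 = 0" "l 4 = 0"
proof -
  have "coeff (cubic_discr (P5 l) (Q5 l)) 3 = 0" "coeff (cubic_discr (P5 l) (Q5 l)) 4 = 0" "coeff (cubic_discr (P5 l) (Q5 l)) 5 = 0"
    using assms(1) by auto
  then have c: "27 * l 1^2 + 4 * l 4^3 = 0" "54 * l 1 * l 2 + 12 * l 4^2 = 0" "27 * l 2^2 + 12 * l 4 = 0"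
    using assms(2,3) unfolding discriminants_5 by (simp_all add: numeral_nat)
  have "l 2 ^ 8 = 0" using c by algebra
  then show 2: "l 2 = 0" by simp
  then show 4: "l 4 = 0" using c(3) by simp
  then show "l 1 = 0" using c(1) by simp
qed

lemma cubic_discr_monomial_6: assumes "\<forall>j\<le>6. coeff (cubic_discr (P6 l) (Q6 l)) j = 0" "l 0 = 0" "l 3 = 0"
  shows "l 1 = 0" "l 2 = 0" "l 4 = 0" "l 5 = 0"
proof -
  have "coeff (cubic_discr (P6 l) (Q6 l)) 3 = 0" "coeff (cubic_discr (P6 l) (Q6 l)) 4 = 0" "coeff (cubic_discr (P6 l) (Q6 l)) 5 = 0"
    "coeff (cubic_discr (P6 l) (Q6 l)) 6 = 0"
    using assms(1) by auto
  then have c: "27 * l 1^2 + 4 * l 4^3 = 0" "54 * l 1 * l 2 + 12 * l 4^2 * l 5 = 0"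
      "54 * l 1 + 27 * l 2^2 + 12 * l 4 * l 5^2 = 0" "54 * l 2 + 4 * l 5^3 = 0"
    using assms(2,3) unfolding discriminants_6 by (simp_all add: numeral_nat)
  define s t where "s = l 5" and "t = l 4"
  have l2: "l 2 = - 2 / 27 * s^3" using c(4) unfolding s_def by algebra
  have l1: "l 1 = - (2 / 729 * s^6) - 2 / 9 * s^2 * t" using c(3) l2 unfolding s_def t_def by algebra
  have "s = 0"
  proof (rule ccontr)
    assume s: "s \<noteq> 0"
    have "s * (3 * t^2 - s^2 * l 1) = 0" using c(2) l2 unfolding s_def t_def by algebra
    then have tt: "3 * t^2 = s^2 * l 1" using s by simp
    have "t^3 * (243 * t + 4 * s^4) = 0" using c(1) tt unfolding s_def t_def by algebra
    then have "t = 0 \<or> 243 * t = - 4 * s^4" by (auto simp: add_eq_0_iff2)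
    then show False
    proof
      assume "t = 0"
      then have "s^8 = 0" using tt l1 by algebra
      then show False using s by simp
    next
      assume "243 * t = - 4 * s^4"
      then have "s^8 = 0" using tt l1 by algebra
      then show False using s by simp
    qed
  qed
  then show 5: "l 5 = 0" by (simp add: s_def)
  show 2: "l 2 = 0" using l2 \<open>s = 0\<close> by simp
  show 1: "l 1 = 0" using l1 \<open>s = 0\<close> by simp
  show "l 4 = 0" using c(1) 1 by simp
qed

lemma matrix_family_II:
  "matrix_family TypeII4 = (\<lambda>l. matrix_II (poly (P4 l)) (poly (Q4 l)))"
  "matrix_family TypeII5 = (\<lambda>l. matrix_II (poly (P5 l)) (poly (Q5 l)))"
  "matrix_family TypeII6 = (\<lambda>l. matrix_II (poly (P6 l)) (poly (Q6 l)))"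
proof -
  have "(\<lambda>w. w^2 + l 1 * w + l 0) = poly (P4 l)" "(\<lambda>w. l 3 * w + l 2) = poly (Q4 l)"
    "(\<lambda>w. l 2 * w^2 + l 1 * w + l 0) = poly (P5 l)" "(\<lambda>w. w^2 + l 4 * w + l 3) = poly (Q5 l)"
    "(\<lambda>w. w^3 + l 2 * w^2 + l 1 * w + l 0) = poly (P6 l)" "(\<lambda>w. l 5 * w^2 + l 4 * w + l 3) = poly (Q6 l)" for l
    by (simp_all add: fun_eq_iff P4_def Q4_def P5_def Q5_def P6_def Q6_def algebra_simps power2_eq_square power3_eq_cube)
  then show "matrix_family TypeII4 = (\<lambda>l. matrix_II (poly (P4 l)) (poly (Q4 l)))"
    "matrix_family TypeII5 = (\<lambda>l. matrix_II (poly (P5 l)) (poly (Q5 l)))"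
    "matrix_family TypeII6 = (\<lambda>l. matrix_II (poly (P6 l)) (poly (Q6 l)))"
    by (simp_all only: matrix_family.simps ext)
qed

lemma LL_type_II4:
  fixes ix :: "nat \<Rightarrow> 'n::finite"
  assumes ix: "bij_betw ix {..<4} UNIV"
  shows "LL_covering_property TypeII4 ix"
proof -
  interpret T: type_II ix 4 W4 Z4 "\<lambda>i. i mod 2" "\<lambda>i. i div 2" "\<lambda>l. point (P4 l) (Q4 l)"
     "\<lambda>l. value0 (P4 l) (Q4 l)" "\<lambda>l. value1 (P4 l) (Q4 l)" 9 P4 Q4 "\<lambda>h. [:h 0, h 1:]" "\<lambda>h. [:h 2, h 3:]" 0 2
    by (rule type_II4_tables[OF ix])
  \<comment> \<open>The variables \<open>w\<close>, \<open>z\<close> have weights \<open>6\<close>, \<open>8\<close>, the polynomials \<open>p\<close>, \<open>q\<close> weights \<open>12\<close>, \<open>10\<close>, and the critical values weight \<open>30\<close>.\<close>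
  let ?wt = "\<lambda>i::nat. if i = 0 then 12 else if i = 1 then 6 else if i = 2 then 10 else (4::nat)"
  interpret C: critical_value_family ix 4 T.pol ?wt 30
  proof unfold_locales
    show "i < 4 \<Longrightarrow> l i = 0" if "\<And>c. poly (T.pol l) c = 0 \<Longrightarrow> c = 0" for l i
    proof -
      have "poly (P4 l) 0 = 0 \<and> poly (Q4 l) 0 = 0 \<and> (\<forall>j\<le>4. coeff (cubic_discr (P4 l) (Q4 l)) j = 0)"
      proof (rule T.nilpotent_II[OF that])
        show "degree (P4 l) \<le> 3" "degree (Q4 l) \<le> 2" by (simp_all add: P4_def Q4_def degree_pCons_eq_if)
      qed (simp_all add: discriminants_4 degree_pCons_eq_if)
      then have "poly (P4 l) 0 = 0" "poly (Q4 l) 0 = 0" and D: "\<forall>j\<le>4. coeff (cubic_discr (P4 l) (Q4 l)) j = 0"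
        by blast+
      then have "l 0 = 0" "l 2 = 0" by (simp_all add: P4_def Q4_def)
      then have "\<forall>i<4. l i = 0" using cubic_discr_monomial_4[OF D] unfolding all_lessThan_numeral by simp
      then show "i < 4 \<Longrightarrow> l i = 0" by blast
    qed
    show "poly (T.pol (\<lambda>i. of_real s ^ ?wt i * l i)) (of_real s ^ 30 * c) = 0"
      if "s > 0" "poly (T.pol l) c = 0" for s l c
      by (rule T.homogeneous_II[OF _ _ _ _ _ _ _ _ that(2), of "of_real s ^ 6" "of_real s ^ 12" "of_real s ^ 8" "of_real s ^ 10"])
        (use that(1) in \<open>simp_all add: P4_def Q4_def algebra_simps flip: power_add power_mult\<close>)
    show "\<exists>l. card {c. poly (T.pol l) c = 0} = 4 \<and> poly (T.pol l) 0 \<noteq> 0"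
    proof -
      \<comment> \<open>A generic parameter: for \<open>p = w\<^sup>2 - 5\<close> and \<open>q = - 3\<close> the critical points have \<open>\<beta> = 1\<close> and \<open>\<alpha>\<close> a fourth root of unity \<open>u\<close>,
        up to a common sign, and \<open>\<phi> = 2 - 4 u\<close>.\<close>
      let ?l = "\<lambda>i::nat. if i = 0 then -5 else if i = 2 then -3 else (0::complex)"
      let ?U = "{u::complex. u ^ 4 = 1}" and ?f = "\<lambda>u::complex. - ((2 - 4 * u)^2)"
      have "T.generic ?l"
      proof (rule T.genericI[of "?f ` ?U"])
        have "inj_on ?f ?U"
        proof (rule inj_onI)
          fix u v assume uv: "u \<in> ?U" "v \<in> ?U" "?f u = ?f v"
          then have uv': "u^4 = 1" "v^4 = 1" by auto
          have "(u - v) * (4 * (u + v) - 4) = 0" using uv(3) by algebra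
          moreover have "4 * (u + v) - 4 \<noteq> 0"
          proof
            assume "4 * (u + v) - 4 = 0"
            then have "(1::complex) = 0" using uv' by algebra
            then show False by simp
          qed
          ultimately show "u = v" by simp
        qed
        then show "card (?f ` ?U) = 4" by (simp add: card_image card_roots_unity_eq)
        then show "finite (?f ` ?U)" using card.infinite by fastforce
        show "0 \<notin> ?f ` ?U"
        proof
          assume "0 \<in> ?f ` ?U"
          then obtain u :: complex where u: "u^4 = 1" "- ((2 - 4 * u)^2) = 0" by auto
          then have "4 * u = 2" by simp
          then have "4^4 * u^4 = 2^4" by (metis power_mult_distrib)
          then show False using u(1) by simp
        qed
        fix c assume "c \<in> ?f ` ?U"
        then obtain u :: complex where u: "u^4 = 1" "c = ?f u" by auto
        have "point (P4 ?l) (Q4 ?l) (u^2) u" unfolding point_4 using u(1) by simp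
        moreover have "T.F ?l (u^2) u = c"
        proof -
          have P: "poly (P4 ?l) (u^2) = u^4 - 5" by (simp add: P4_def power2_eq_square eval_nat_numeral)
          have Q: "poly (Q4 ?l) (u^2) = - 3" by (simp add: Q4_def)
          show ?thesis unfolding T.F_eq P Q u by (simp add: algebra_simps power2_eq_square)
        qed
        ultimately show "\<exists>w z. point (P4 ?l) (Q4 ?l) w z \<and> T.F ?l w z = c" by blast
      qed
      then show ?thesis unfolding T.generic_def by blast
    qed
    show "h i = 0" if gen: "card {c. poly (T.pol l) c = 0} = 4" "poly (T.pol l) 0 \<noteq> 0"
      and D: "\<And>j. j < 4 \<Longrightarrow> (\<Sum>i<4. partial (\<lambda>l. coeff (T.pol l) j) i l * h i) = 0" and i: "i < 4" for l h i
    proof -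
      have g: "T.generic l" using gen by (simp add: T.generic_def)
      let ?P = "\<lambda>w. h 0 + h 1 * w" and ?Q = "\<lambda>w. h 2 + h 3 * w"
      have A: "w * ?P w = z * ?Q w" and B: "3 * z * ?P w = - (l 2 + l 3 * w) * ?Q w"
        and rel: "l 0 + 3 * l 1 * w + 5 * w^2 = 2 * z * (l 3)"
        if "point (P4 l) (Q4 l) w z" for w z
        using T.stationary_direction[OF g that D] that unfolding point_4
        by (simp_all add: Q4_def algebra_simps power2_eq_square)
      have coord: "a k = 0" if "\<And>w z. point (P4 l) (Q4 l) w z \<Longrightarrow> a 0 + a 1 * w + a 2 * z + a 3 * (w * z) = 0"
        "k < 4" for a :: "nat \<Rightarrow> complex" and k
        by (rule T.points_separate_basis[OF g _ that(2)])
           (use that(1) in \<open>simp add: sum_lessThan_numeral mult_ac\<close>)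
      \<comment> \<open>\<open>a\<close> and \<open>b\<close> are the coefficients of the equations \<open>B\<close> and \<open>A\<close> after reduction to the basis; that of \<open>w z\<close> in \<open>B\<close> gives \<open>h 1 = 0\<close>,
        and then \<open>A\<close> contains basis monomials only.\<close>
      define a where "a k = (if k = 0 then l 2 * h 2 - l 3 * h 3 * l 0 / 5 else if k = 1 then l 2 * h 3 + l 3 * h 2 - 3 * l 1 * l 3 * h 3 / 5 else if k = 2 then 3 * h 0 + 2 * l 3^2 * h 3 / 5 else 3 * h 1)" for k :: nat
      have a: "a k = 0" if "k < 4" for k
      proof (rule coord[OF _ that])
        fix w z assume pt: "point (P4 l) (Q4 l) w z"
        show "a 0 + a 1 * w + a 2 * z + a 3 * (w * z) = 0" using B[OF pt] rel[OF pt] by (simp add: a_def) algebra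
      qed
      have h1: "h 1 = 0" using a[of 3] by (simp add: a_def)
      define b where "b k = (if k = 0 then 0 else if k = 1 then h 0 else if k = 2 then - h 2 else - h 3)" for k :: nat
      have b: "b k = 0" if "k < 4" for k
      proof (rule coord[OF _ that])
        fix w z assume pt: "point (P4 l) (Q4 l) w z"
        show "b 0 + b 1 * w + b 2 * z + b 3 * (w * z) = 0" using A[OF pt] h1 by (simp add: b_def) algebra
      qed
      have "\<forall>i<4. h i = 0" unfolding all_lessThan_numeral
        using h1 b[of 1] b[of 2] b[of 3] by (simp add: b_def)
      then show ?thesis using i by blast
    qed
  qed (use T.monic_pol T.polyfun_pol ix in auto)
  show ?thesis
    by (rule C.LL_is_covering) (simp, rule T.nonzero_critical_values_II[OF matrix_family_II(1)])
qed

lemma LL_type_II5: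
  fixes ix :: "nat \<Rightarrow> 'n::finite"
  assumes ix: "bij_betw ix {..<5} UNIV"
  shows "LL_covering_property TypeII5 ix"
proof -
  interpret T: type_II ix 5 W5 Z5 "\<lambda>i. i mod 4" "\<lambda>i. i div 4" "\<lambda>l. point (P5 l) (Q5 l)"
     "\<lambda>l. value0 (P5 l) (Q5 l)" "\<lambda>l. value1 (P5 l) (Q5 l)" 9 P5 Q5 "\<lambda>h. [:h 0, h 1, h 2:]" "\<lambda>h. [:h 3, h 4:]" 0 3
    by (rule type_II5_tables[OF ix])
  \<comment> \<open>The variables \<open>w\<close>, \<open>z\<close> have weights \<open>2\<close>, \<open>3\<close>, the polynomials \<open>p\<close>, \<open>q\<close> weights \<open>5\<close>, \<open>4\<close>, and the critical values weight \<open>12\<close>.\<close>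
  let ?wt = "\<lambda>i::nat. if i = 0 then 5 else if i = 1 then 3 else if i = 2 then 1 else if i = 3 then 4 else (2::nat)"
  interpret C: critical_value_family ix 5 T.pol ?wt 12
  proof unfold_locales
    show "i < 5 \<Longrightarrow> l i = 0" if "\<And>c. poly (T.pol l) c = 0 \<Longrightarrow> c = 0" for l i
    proof -
      have "poly (P5 l) 0 = 0 \<and> poly (Q5 l) 0 = 0 \<and> (\<forall>j\<le>5. coeff (cubic_discr (P5 l) (Q5 l)) j = 0)"
      proof (rule T.nilpotent_II[OF that])
        show "degree (P5 l) \<le> 3" "degree (Q5 l) \<le> 2" by (simp_all add: P5_def Q5_def degree_pCons_eq_if)
      qed (simp_all add: discriminants_5 degree_pCons_eq_if)
      then have "poly (P5 l) 0 = 0" "poly (Q5 l) 0 = 0" and D: "\<forall>j\<le>5. coeff (cubic_discr (P5 l) (Q5 l)) j = 0"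
        by blast+
      then have "l 0 = 0" "l 3 = 0" by (simp_all add: P5_def Q5_def)
      then have "\<forall>i<5. l i = 0" using cubic_discr_monomial_5[OF D] unfolding all_lessThan_numeral by simp
      then show "i < 5 \<Longrightarrow> l i = 0" by blast
    qed
    show "poly (T.pol (\<lambda>i. of_real s ^ ?wt i * l i)) (of_real s ^ 12 * c) = 0"
      if "s > 0" "poly (T.pol l) c = 0" for s l c
      by (rule T.homogeneous_II[OF _ _ _ _ _ _ _ _ that(2), of "of_real s ^ 2" "of_real s ^ 5" "of_real s ^ 3" "of_real s ^ 4"])
        (use that(1) in \<open>simp_all add: P5_def Q5_def eval_nat_numeral algebra_simps\<close>)
    show "\<exists>l. card {c. poly (T.pol l) c = 0} = 5 \<and> poly (T.pol l) 0 \<noteq> 0"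
    proof -
      \<comment> \<open>A generic parameter: for \<open>p\<close> constant and \<open>q = w\<^sup>2\<close> the equations give \<open>4 w z = p\<close> and \<open>3 z\<^sup>2 = - w\<^sup>3\<close>, so \<open>w\<^sup>5\<close> is constant;
        the constant \<open>p = 4 k\<close> with \<open>3 k\<^sup>2 = - 1\<close> makes it \<open>1\<close>.\<close>
      define k where "k = csqrt (- 1 / 3)"
      have k2: "k^2 = - 1 / 3" unfolding k_def by (rule power2_csqrt)
      then have k: "3 * k^2 = - 1" by simp
      let ?l = "\<lambda>i::nat. if i = 0 then 4 * k else (0::complex)"
      let ?U = "{u::complex. u ^ 5 = 1}" and ?f = "\<lambda>u::complex. 100 / 27 * u"
      have "T.generic ?l"
      proof (rule T.genericI[of "?f ` ?U"])
        have "inj_on ?f ?U" by (simp add: inj_on_def)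
        then show "card (?f ` ?U) = 5" by (simp add: card_image card_roots_unity_eq)
        then show "finite (?f ` ?U)" using card.infinite by fastforce
        show "0 \<notin> ?f ` ?U" by auto
        fix c assume "c \<in> ?f ` ?U"
        then obtain u :: complex where u: "u^5 = 1" "c = ?f u" by auto
        have "4 * k = 2 * (k * u^4) * (2 * u)" using u(1) by algebra
        moreover have "3 * (k * u^4)^2 = - u * u^2" using u(1) k by algebra
        ultimately have "point (P5 ?l) (Q5 ?l) u (k * u^4)" unfolding point_5 by simp
        moreover have "T.F ?l u (k * u^4) = c"
        proof -
          have P: "poly (P5 ?l) u = 4 * k" by (simp add: P5_def)
          have Q: "poly (Q5 ?l) u = u^2" by (simp add: Q5_def power2_eq_square)
          have u6: "u^6 = u" using u(1) by algebra
          have kk: "k * k = - 1 / 3" using k2 by (simp add: power2_eq_square)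
          have "u * (4 * k)^2 - 4/3 * (4 * k) * u^2 * (k * u^4) - 4/27 * (u^2)^3
              = 16 * (k * k) * u - 16/3 * (k * k) * u^6 - 4/27 * u^6"
            by (simp add: algebra_simps eval_nat_numeral)
          also have "\<dots> = - (100 / 27 * u)" unfolding u6 kk by simp
          finally have "u * (4 * k)^2 - 4/3 * (4 * k) * u^2 * (k * u^4) - 4/27 * (u^2)^3 = - (100 / 27 * u)" .
          then show ?thesis unfolding T.F_eq P Q u by simp
        qed
        ultimately show "\<exists>w z. point (P5 ?l) (Q5 ?l) w z \<and> T.F ?l w z = c" by blast
      qed
      then show ?thesis unfolding T.generic_def by blast
    qed
    show "h i = 0" if gen: "card {c. poly (T.pol l) c = 0} = 5" "poly (T.pol l) 0 \<noteq> 0"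
      and D: "\<And>j. j < 5 \<Longrightarrow> (\<Sum>i<5. partial (\<lambda>l. coeff (T.pol l) j) i l * h i) = 0" and i: "i < 5" for l h i
    proof -
      have g: "T.generic l" using gen by (simp add: T.generic_def)
      let ?P = "\<lambda>w. h 0 + h 1 * w + h 2 * w^2" and ?Q = "\<lambda>w. h 3 + h 4 * w"
      have A: "w * ?P w = z * ?Q w" and B: "3 * z * ?P w = - (l 3 + l 4 * w + w^2) * ?Q w"
        and rel: "l 0 + 3 * l 1 * w + 5 * l 2 * w^2 = 2 * z * (l 4 + 2 * w)"
        if "point (P5 l) (Q5 l) w z" for w z
        using T.stationary_direction[OF g that D] that unfolding point_5
        by (simp_all add: Q5_def algebra_simps power2_eq_square)
      have coord: "a k = 0" if "\<And>w z. point (P5 l) (Q5 l) w z \<Longrightarrow> a 0 + a 1 * w + a 2 * w^2 + a 3 * w^3 + a 4 * z = 0"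
        "k < 5" for a :: "nat \<Rightarrow> complex" and k
        by (rule T.points_separate_basis[OF g _ that(2)])
           (use that(1) in \<open>simp add: sum_lessThan_numeral mult_ac\<close>)
      \<comment> \<open>\<open>a\<close> and \<open>b\<close> are the coefficients of the equations \<open>A\<close> and \<open>B\<close> after reduction to the basis; those of \<open>w\<^sup>3\<close> give
        \<open>h 2 = 0\<close> and \<open>h 4 = 0\<close>. After this \<open>A\<close> involves basis monomials only, with coefficients \<open>c\<close>.\<close>
      define a where "a k = (if k = 0 then - l 0 * h 4 / 4 else if k = 1 then h 0 - 3 * l 1 * h 4 / 4 else if k = 2 then h 1 - 5 * l 2 * h 4 / 4 else if k = 3 then h 2 else l 4 * h 4 / 2 - h 3)" for k :: nat
      have a: "a k = 0" if "k < 5" for k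
      proof (rule coord[OF _ that])
        fix w z assume pt: "point (P5 l) (Q5 l) w z"
        show "a 0 + a 1 * w + a 2 * w^2 + a 3 * w^3 + a 4 * z = 0" using A[OF pt] rel[OF pt] by (simp add: a_def) algebra
      qed
      have h2: "h 2 = 0" using a[of 3] by (simp add: a_def)
      define b where "b k = (if k = 0 then l 3 * h 3 + 3 * h 1 * l 0 / 4 else if k = 1 then l 3 * h 4 + l 4 * h 3 + 9 * l 1 * h 1 / 4 else if k = 2 then l 4 * h 4 + h 3 + 15 * l 2 * h 1 / 4 else if k = 3 then h 4 else 3 * h 0 - 3 * l 4 * h 1 / 2)" for k :: nat
      have b: "b k = 0" if "k < 5" for k
      proof (rule coord[OF _ that])
        fix w z assume pt: "point (P5 l) (Q5 l) w z"
        show "b 0 + b 1 * w + b 2 * w^2 + b 3 * w^3 + b 4 * z = 0" using B[OF pt] rel[OF pt] h2 by (simp add: b_def) algebra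
      qed
      have h4: "h 4 = 0" using b[of 3] by (simp add: b_def)
      define c where "c k = (if k = 0 then 0 else if k = 1 then h 0 else if k = 2 then h 1 else if k = 3 then 0 else - h 3)" for k :: nat
      have c: "c k = 0" if "k < 5" for k
      proof (rule coord[OF _ that])
        fix w z assume pt: "point (P5 l) (Q5 l) w z"
        show "c 0 + c 1 * w + c 2 * w^2 + c 3 * w^3 + c 4 * z = 0" using A[OF pt] h2 h4 by (simp add: c_def) algebra
      qed
      have "\<forall>i<5. h i = 0" unfolding all_lessThan_numeral
        using h2 h4 c[of 1] c[of 2] c[of 4] by (simp add: c_def)
      then show ?thesis using i by blast
    qed
  qed (use T.monic_pol T.polyfun_pol ix in auto)
  show ?thesis
    by (rule C.LL_is_covering) (simp, rule T.nonzero_critical_values_II[OF matrix_family_II(2)])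
qed

lemma LL_type_II6:
  fixes ix :: "nat \<Rightarrow> 'n::finite"
  assumes ix: "bij_betw ix {..<6} UNIV"
  shows "LL_covering_property TypeII6 ix"
proof -
  interpret T: type_II ix 6 W6 Z6 "\<lambda>i. i mod 3" "\<lambda>i. i div 3" "\<lambda>l. point (P6 l) (Q6 l)"
     "\<lambda>l. value0 (P6 l) (Q6 l)" "\<lambda>l. value1 (P6 l) (Q6 l)" 9 P6 Q6 "\<lambda>h. [:h 0, h 1, h 2:]" "\<lambda>h. [:h 3, h 4, h 5:]" 0 3
    by (rule type_II6_tables[OF ix])
  \<comment> \<open>The variables \<open>w\<close>, \<open>z\<close> have weights \<open>6\<close>, \<open>10\<close>, the polynomials \<open>p\<close>, \<open>q\<close> weights \<open>18\<close>, \<open>14\<close>, and the critical values weight \<open>42\<close>.\<close>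
  let ?wt = "\<lambda>i::nat. if i = 0 then 18 else if i = 1 then 12 else if i = 2 then 6 else if i = 3 then 14 else if i = 4 then 8 else (2::nat)"
  interpret C: critical_value_family ix 6 T.pol ?wt 42
  proof unfold_locales
    show "i < 6 \<Longrightarrow> l i = 0" if "\<And>c. poly (T.pol l) c = 0 \<Longrightarrow> c = 0" for l i
    proof -
      have "poly (P6 l) 0 = 0 \<and> poly (Q6 l) 0 = 0 \<and> (\<forall>j\<le>6. coeff (cubic_discr (P6 l) (Q6 l)) j = 0)"
      proof (rule T.nilpotent_II[OF that])
        show "degree (P6 l) \<le> 3" "degree (Q6 l) \<le> 2" by (simp_all add: P6_def Q6_def degree_pCons_eq_if)
      qed (simp_all add: discriminants_6 degree_pCons_eq_if)
      then have "poly (P6 l) 0 = 0" "poly (Q6 l) 0 = 0" and D: "\<forall>j\<le>6. coeff (cubic_discr (P6 l) (Q6 l)) j = 0"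
        by blast+
      then have "l 0 = 0" "l 3 = 0" by (simp_all add: P6_def Q6_def)
      then have "\<forall>i<6. l i = 0" using cubic_discr_monomial_6[OF D] unfolding all_lessThan_numeral by simp
      then show "i < 6 \<Longrightarrow> l i = 0" by blast
    qed
    show "poly (T.pol (\<lambda>i. of_real s ^ ?wt i * l i)) (of_real s ^ 42 * c) = 0"
      if "s > 0" "poly (T.pol l) c = 0" for s l c
      by (rule T.homogeneous_II[OF _ _ _ _ _ _ _ _ that(2), of "of_real s ^ 6" "of_real s ^ 18" "of_real s ^ 10" "of_real s ^ 14"])
        (use that(1) in \<open>simp_all add: P6_def Q6_def algebra_simps flip: power_add power_mult\<close>)
    show "\<exists>l. card {c. poly (T.pol l) c = 0} = 6 \<and> poly (T.pol l) 0 \<noteq> 0"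
    proof -
      \<comment> \<open>A generic parameter: for \<open>p = w\<^sup>3 - 7\<close> and \<open>q = - 3\<close> the critical points have \<open>\<beta> = 1\<close> and \<open>\<alpha>\<close> a sixth root of unity \<open>u\<close>,
        up to a common sign, and \<open>\<phi> = 2 - 6 u\<close>.\<close>
      let ?l = "\<lambda>i::nat. if i = 0 then -7 else if i = 3 then -3 else (0::complex)"
      let ?U = "{u::complex. u ^ 6 = 1}" and ?f = "\<lambda>u::complex. - ((2 - 6 * u)^2)"
      have "T.generic ?l"
      proof (rule T.genericI[of "?f ` ?U"])
        have "inj_on ?f ?U"
        proof (rule inj_onI)
          fix u v assume uv: "u \<in> ?U" "v \<in> ?U" "?f u = ?f v"
          then have uv': "u^6 = 1" "v^6 = 1" by auto
          have "(u - v) * (6 * (u + v) - 4) = 0" using uv(3) by algebra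
          moreover have "6 * (u + v) - 4 \<noteq> 0"
          proof
            assume "6 * (u + v) - 4 = 0"
            then have "(1::complex) = 0" using uv' by algebra
            then show False by simp
          qed
          ultimately show "u = v" by simp
        qed
        then show "card (?f ` ?U) = 6" by (simp add: card_image card_roots_unity_eq)
        then show "finite (?f ` ?U)" using card.infinite by fastforce
        show "0 \<notin> ?f ` ?U"
        proof
          assume "0 \<in> ?f ` ?U"
          then obtain u :: complex where u: "u^6 = 1" "- ((2 - 6 * u)^2) = 0" by auto
          then have "6 * u = 2" by simp
          then have "6^6 * u^6 = 2^6" by (metis power_mult_distrib)
          then show False using u(1) by simp
        qed
        fix c assume "c \<in> ?f ` ?U"
        then obtain u :: complex where u: "u^6 = 1" "c = ?f u" by auto
        have "point (P6 ?l) (Q6 ?l) (u^2) u" unfolding point_6 using u(1) by simp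
        moreover have "T.F ?l (u^2) u = c"
        proof -
          have P: "poly (P6 ?l) (u^2) = u^6 - 7" by (simp add: P6_def power2_eq_square eval_nat_numeral)
          have Q: "poly (Q6 ?l) (u^2) = - 3" by (simp add: Q6_def)
          show ?thesis unfolding T.F_eq P Q u by (simp add: algebra_simps power2_eq_square)
        qed
        ultimately show "\<exists>w z. point (P6 ?l) (Q6 ?l) w z \<and> T.F ?l w z = c" by blast
      qed
      then show ?thesis unfolding T.generic_def by blast
    qed
    show "h i = 0" if gen: "card {c. poly (T.pol l) c = 0} = 6" "poly (T.pol l) 0 \<noteq> 0"
      and D: "\<And>j. j < 6 \<Longrightarrow> (\<Sum>i<6. partial (\<lambda>l. coeff (T.pol l) j) i l * h i) = 0" and i: "i < 6" for l h i
    proof -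
      have g: "T.generic l" using gen by (simp add: T.generic_def)
      let ?P = "\<lambda>w. h 0 + h 1 * w + h 2 * w^2" and ?Q = "\<lambda>w. h 3 + h 4 * w + h 5 * w^2"
      have A: "w * ?P w = z * ?Q w" and B: "3 * z * ?P w = - (l 3 + l 4 * w + l 5 * w^2) * ?Q w"
        and rel: "l 0 + 3 * l 1 * w + 5 * l 2 * w^2 + 7 * w^3 = 2 * z * (l 4 + 2 * l 5 * w)"
        if "point (P6 l) (Q6 l) w z" for w z
        using T.stationary_direction[OF g that D] that unfolding point_6
        by (simp_all add: Q6_def algebra_simps power2_eq_square)
      have coord: "a k = 0" if "\<And>w z. point (P6 l) (Q6 l) w z \<Longrightarrow> a 0 + a 1 * w + a 2 * w^2 + a 3 * z + a 4 * (w * z) + a 5 * (w^2 * z) = 0"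
        "k < 6" for a :: "nat \<Rightarrow> complex" and k
        by (rule T.points_separate_basis[OF g _ that(2)])
           (use that(1) in \<open>simp add: sum_lessThan_numeral mult_ac\<close>)
      \<comment> \<open>\<open>a\<close> and \<open>b\<close> are the coefficients of the equations \<open>A\<close> and \<open>B\<close> after reduction to the basis; those of \<open>w\<^sup>2 z\<close> give
        \<open>h 5 = 0\<close> and \<open>h 2 = 0\<close>. After this \<open>A\<close> involves basis monomials only, with coefficients \<open>c\<close>.\<close>
      define a where "a k = (if k = 0 then - h 2 * l 0 / 7 else if k = 1 then h 0 - 3 * l 1 * h 2 / 7 else if k = 2 then h 1 - 5 * l 2 * h 2 / 7 else if k = 3 then 2 * l 4 * h 2 / 7 - h 3 else if k = 4 then 4 * l 5 * h 2 / 7 - h 4 else - h 5)" for k :: nat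
      have a: "a k = 0" if "k < 6" for k
      proof (rule coord[OF _ that])
        fix w z assume pt: "point (P6 l) (Q6 l) w z"
        show "a 0 + a 1 * w + a 2 * w^2 + a 3 * z + a 4 * (w * z) + a 5 * (w^2 * z) = 0" using A[OF pt] rel[OF pt] by (simp add: a_def) algebra
      qed
      have h5: "h 5 = 0" using a[of 5] by (simp add: a_def)
      define b where "b k = (if k = 0 then l 3 * h 3 - l 5 * h 4 * l 0 / 7 else if k = 1 then l 3 * h 4 + l 4 * h 3 - 3 * l 1 * l 5 * h 4 / 7 else if k = 2 then l 4 * h 4 + l 5 * h 3 - 5 * l 2 * l 5 * h 4 / 7 else if k = 3 then 3 * h 0 + 2 * l 4 * l 5 * h 4 / 7 else if k = 4 then 3 * h 1 + 4 * l 5^2 * h 4 / 7 else 3 * h 2)" for k :: nat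
      have b: "b k = 0" if "k < 6" for k
      proof (rule coord[OF _ that])
        fix w z assume pt: "point (P6 l) (Q6 l) w z"
        show "b 0 + b 1 * w + b 2 * w^2 + b 3 * z + b 4 * (w * z) + b 5 * (w^2 * z) = 0" using B[OF pt] rel[OF pt] h5 by (simp add: b_def) algebra
      qed
      have h2: "h 2 = 0" using b[of 5] by (simp add: b_def)
      define c where "c k = (if k = 0 then 0 else if k = 1 then h 0 else if k = 2 then h 1 else if k = 3 then - h 3 else if k = 4 then - h 4 else 0)" for k :: nat
      have c: "c k = 0" if "k < 6" for k
      proof (rule coord[OF _ that])
        fix w z assume pt: "point (P6 l) (Q6 l) w z"
        show "c 0 + c 1 * w + c 2 * w^2 + c 3 * z + c 4 * (w * z) + c 5 * (w^2 * z) = 0" using A[OF pt] h2 h5 by (simp add: c_def) algebra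
      qed
      have "\<forall>i<6. h i = 0" unfolding all_lessThan_numeral
        using h2 h5 c[of 1] c[of 2] c[of 3] c[of 4] by (simp add: c_def)
      then show ?thesis using i by blast
    qed
  qed (use T.monic_pol T.polyfun_pol ix in auto)
  show ?thesis
    by (rule C.LL_is_covering) (simp, rule T.nonzero_critical_values_II[OF matrix_family_II(3)])
qed

section \<open>The family of type I and the theorem\<close>

text \<open>
  The monic polynomial of degree \<open>k + 1\<close> with these lower coefficients is proportional to \<open>x P + 2 x\<^sup>2 P' + (l k)\<^sup>2\<close>, whose roots are the critical points of
  type I; the leading coefficient of the latter is \<open>2 k + 1\<close>.
\<close>

definition critical_coeffs_I :: "nat \<Rightarrow> (nat \<Rightarrow> complex) \<Rightarrow> nat \<Rightarrow> complex" where
  "critical_coeffs_I k l j = (if j = 0 then (l k)^2 else (2 * of_nat j - 1) * l (j - 1)) / of_nat (2 * k + 1)"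

abbreviation critical_poly_I :: "nat \<Rightarrow> (nat \<Rightarrow> complex) \<Rightarrow> complex poly" where
  "critical_poly_I k l \<equiv> monic_of (Suc k) (critical_coeffs_I k l)"

definition value_I :: "nat \<Rightarrow> (nat \<Rightarrow> complex) \<Rightarrow> complex poly" where
  "value_I k l = - (X * (monic_of k l + X * pderiv (monic_of k l))^2)"

lemma critical_poly_I_eq: "smult (of_nat (2 * k + 1)) (critical_poly_I k l) = X * monic_of k l + 2 * X^2 * pderiv (monic_of k l) + [:(l k)^2:]"
proof (rule poly_eqI)
  fix i
  have R: "X * monic_of k l + 2 * X^2 * pderiv (monic_of k l) + [:(l k)^2:]
      = pCons ((l k)^2) (monic_of k l + smult 2 (pCons 0 (pderiv (monic_of k l))))"
    by (simp add: power2_eq_square numeral_mult_conv_smult)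
  have nz: "(of_nat (2 * k + 1) :: complex) \<noteq> 0" by (simp only: of_nat_eq_0_iff)
  show "coeff (smult (of_nat (2 * k + 1)) (critical_poly_I k l)) i = coeff (X * monic_of k l + 2 * X^2 * pderiv (monic_of k l) + [:(l k)^2:]) i"
  proof (cases i)
    case 0
    then show ?thesis unfolding R using nz by (simp add: coeff_monic_of critical_coeffs_I_def del: of_nat_add of_nat_mult)
  next
    case (Suc j)
    have "coeff (pCons 0 (pderiv (monic_of k l))) j = of_nat j * coeff (monic_of k l) j"
      by (cases j) (simp_all add: coeff_pderiv)
    then have "coeff (X * monic_of k l + 2 * X^2 * pderiv (monic_of k l) + [:(l k)^2:]) i = (2 * of_nat j + 1) * coeff (monic_of k l) j"
      unfolding R Suc by (simp add: algebra_simps del: smult_pCons flip: smult_pCons)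
    moreover have "coeff (smult (of_nat (2 * k + 1)) (critical_poly_I k l)) i = (2 * of_nat j + 1) * coeff (monic_of k l) j"
      unfolding Suc using nz
      by (simp add: coeff_monic_of critical_coeffs_I_def add_ac del: of_nat_add of_nat_mult) (simp add: algebra_simps)
    ultimately show ?thesis by simp
  qed
qed

lemma critical_poly_I_root_iff:
  "poly (critical_poly_I k l) x = 0 \<longleftrightarrow> x * poly (monic_of k l) x + 2 * x^2 * poly (pderiv (monic_of k l)) x + (l k)^2 = 0"
proof -
  have nz: "(of_nat (2 * k + 1) :: complex) \<noteq> 0" by (simp only: of_nat_eq_0_iff)
  have "of_nat (2 * k + 1) * poly (critical_poly_I k l) x = x * poly (monic_of k l) x + 2 * x^2 * poly (pderiv (monic_of k l)) x + (l k)^2"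
    using arg_cong[OF critical_poly_I_eq[of k l], of "\<lambda>p. poly p x"] by (simp add: mult_ac)
  then show ?thesis using nz by (metis mult_eq_0_iff)
qed

lemma polyfun_coeffs_monic_of: "k \<le> m \<Longrightarrow> polyfun_coeffs m (monic_of k)"
  unfolding polyfun_coeffs_def coeff_monic_of by (auto intro!: polyfun_if)

lemma polyfun_coeffs_pderiv: "polyfun_coeffs m p \<Longrightarrow> polyfun_coeffs m (\<lambda>l. pderiv (p l))"
  unfolding polyfun_coeffs_def coeff_pderiv by auto

text \<open>
  One variable suffices here. The second coordinate is set to zero, and multiplication by the first one is given by the companion matrix.
\<close>

lemma point_algebra_type_I:
  fixes ix :: "nat \<Rightarrow> 'n::finite"
  assumes "bij_betw ix {..<Suc k} UNIV"
  shows "point_algebra ix (Suc k) (\<lambda>l. companion (Suc k) (critical_coeffs_I k l)) (\<lambda>_ _ _. 0) (\<lambda>i. i) (\<lambda>_. 0)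
     (\<lambda>l w z. z = 0 \<and> poly (critical_poly_I k l) w = 0) (value_I k) (\<lambda>_. 0) (2 * k + 1)"
proof -
  interpret numbering ix "Suc k" by unfold_locales fact
  show ?thesis
  proof unfold_locales
    show "polyfun (Suc k) (\<lambda>l. companion (Suc k) (critical_coeffs_I k l) i j)" if "i < Suc k" "j < Suc k" for i j
    proof -
      have "polyfun (Suc k) (\<lambda>l. critical_coeffs_I k l j)"
        unfolding critical_coeffs_I_def using that by (cases j) (auto intro!: polyfun_power polyfun_divide polyfun.mult)
      then show ?thesis unfolding companion_def by (auto intro!: polyfun_if polyfun_uminus)
    qed
    show "(\<Sum>j<Suc k. companion (Suc k) (critical_coeffs_I k l) i j * (w ^ j * z ^ 0)) = w * (w ^ i * z ^ 0)"
      if "z = 0 \<and> poly (critical_poly_I k l) w = 0" "i < Suc k" for l w z i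
      using arg_cong[OF companion_eigen[of "critical_coeffs_I k l" w], of "\<lambda>v. v $ ix i"] that
      by (simp add: matrix_of_mult_vec del: sum.lessThan_Suc)
    show "z = 0 \<and> poly (critical_poly_I k l) w = 0"
      if W: "\<And>i. i < Suc k \<Longrightarrow> (\<Sum>j<Suc k. companion (Suc k) (critical_coeffs_I k l) i j * u j) = w * u i"
        and Z: "\<And>i. i < Suc k \<Longrightarrow> (\<Sum>j<Suc k. 0 * u j) = z * u i" and m: "m < Suc k" "u m \<noteq> 0" for l w z u m
    proof
      show "z = 0" using Z[OF m(1)] m(2) by simp
      have "matrix_of ix (companion (Suc k) (critical_coeffs_I k l)) *v vector_of ix u = w *s vector_of ix u"
        using W by (simp add: matrix_of_mult_vec vec_eq_iff all_ix del: sum.lessThan_Suc)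
      moreover have "vector_of ix u \<noteq> 0" using m by (metis vector_of_nth zero_index)
      ultimately show "poly (critical_poly_I k l) w = 0" by (rule companion_eigenD(1))
    qed
    have "polyfun_coeffs (Suc k) (\<lambda>l. 0 - X * (monic_of k l + X * pderiv (monic_of k l))^2)"
      by (intro polyfun_coeffs_diff polyfun_coeffs_mult polyfun_coeffs_power polyfun_coeffs_add polyfun_coeffs_const
          polyfun_coeffs_pderiv polyfun_coeffs_monic_of) simp_all
    then show "polyfun_coeffs (Suc k) (value_I k)" by (simp add: value_I_def[abs_def])
    show "degree (value_I k l) \<le> 2 * k + 1" for l
    proof -
      have "degree (X * pderiv (monic_of k l)) \<le> k"
      proof (cases k)
        case 0
        then show ?thesis by (simp add: monic_of_def)
      next
        case (Suc m)
        then show ?thesis using degree_mult_le[of X "pderiv (monic_of k l)"]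
          by (simp add: degree_pderiv degree_monic_of degree_pCons_eq_if split: if_splits)
      qed
      then have "degree (monic_of k l + X * pderiv (monic_of k l)) \<le> k"
        by (intro degree_add_le) (simp_all add: degree_monic_of)
      then have "degree ((monic_of k l + X * pderiv (monic_of k l))^2) \<le> 2 * k"
        using degree_power_le[of "monic_of k l + X * pderiv (monic_of k l)" 2] by linarith
      then have "degree (X * (monic_of k l + X * pderiv (monic_of k l))^2) \<le> 2 * k + 1"
        by (simp add: degree_pCons_eq_if)
      then show ?thesis by (simp only: value_I_def degree_minus)
    qed
  qed simp_all
qed

lemma value_I_eq: "poly (value_I k l) x = - x * (poly (monic_of k l) x + x * poly (pderiv (monic_of k l)) x)^2"
  by (simp add: value_I_def)

lemma monic_of_add: "monic_of k (\<lambda>i. l i + s * h i) = monic_of k l + smult s (\<Sum>i<k. monom (h i) i)"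
proof (rule poly_eqI)
  fix i
  have "coeff (\<Sum>i<k. monom (h i) i) i = (if i < k then h i else 0)" by (simp add: coeff_sum)
  then show "coeff (monic_of k (\<lambda>i. l i + s * h i)) i = coeff (monic_of k l + smult s (\<Sum>i<k. monom (h i) i)) i"
    by (simp add: coeff_monic_of)
qed

text \<open>
  The same argument as for type II, with \<open>P = monic_of k l\<close>, \<open>a = l k\<close>, and the polynomial \<open>G = X P - a\<^sup>2\<close>, in terms of which the critical points are the roots
  of \<open>2 X G' - G\<close> and the critical value vanishes at a non-zero root exactly if \<open>G'\<close>, and hence \<open>G\<close>, does.
\<close>

lemma LL_type_I:
  fixes ix :: "nat \<Rightarrow> 'n::finite"
  assumes ix: "bij_betw ix {..<Suc k} UNIV" and k: "k \<ge> 1"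
  shows "LL_covering_property (TypeI k) ix"
proof -
  interpret T: point_algebra ix "Suc k" "\<lambda>l. companion (Suc k) (critical_coeffs_I k l)" "\<lambda>_ _ _. 0" "\<lambda>i. i" "\<lambda>_. 0"
     "\<lambda>l w z. z = 0 \<and> poly (critical_poly_I k l) w = 0" "value_I k" "\<lambda>_. 0" "2 * k + 1"
    by (rule point_algebra_type_I[OF ix])
  let ?P = "\<lambda>l. poly (monic_of k l)" and ?P' = "\<lambda>l. poly (pderiv (monic_of k l))"
  have F: "T.F l x 0 = - x * (?P l x + x * ?P' l x)^2" for l x
    unfolding T.F_def value_I_eq by simp
  have root: "poly (T.pol l) c = 0 \<longleftrightarrow> (\<exists>x. x * ?P l x + 2 * x^2 * ?P' l x + (l k)^2 = 0 \<and>
      - x * (?P l x + x * ?P' l x)^2 = c)" for l c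
    unfolding T.pol_root_iff using F by (auto simp: critical_poly_I_root_iff)
  \<comment> \<open>The variable \<open>x\<close> has weight \<open>2\<close>, \<open>P\<close> has weight \<open>2 k\<close>, and \<open>a\<^sup>2\<close> has the weight \<open>2 k + 2\<close> of \<open>x P\<close>.\<close>
  let ?wt = "\<lambda>i. if i = k then k + 1 else 2 * (k - i)"
  interpret C: critical_value_family ix "Suc k" T.pol ?wt "4 * k + 2"
  proof unfold_locales
    show "i < Suc k \<Longrightarrow> l i = 0" if nil: "\<And>c. poly (T.pol l) c = 0 \<Longrightarrow> c = 0" for l i
    proof -
      define G where "G = X * monic_of k l - [:(l k)^2:]"
      have G: "G = pCons (- ((l k)^2)) (monic_of k l)" by (simp add: G_def)
      have P0: "monic_of k l \<noteq> 0" using lead_coeff_monic_of[of k l] by auto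
      then have dG: "degree G = Suc k" unfolding G by (simp add: degree_monic_of)
      have "coeff G j = 0" if "j < degree G" for j
      proof (rule nilpotent_imp_monomial_I[OF _ _ that])
        show "G \<noteq> 0" using dG by auto
        fix x :: complex assume x: "x \<noteq> 0" "poly (2 * X * pderiv G - G) x = 0"
        have G': "poly (pderiv G) x = ?P l x + x * ?P' l x" unfolding G by (simp add: pderiv_pCons)
        have Gx: "poly G x = x * ?P l x - (l k)^2" unfolding G by simp
        have Q: "x * ?P l x + 2 * x^2 * ?P' l x + (l k)^2 = 0"
          using x(2) by (simp add: G' Gx algebra_simps power2_eq_square)
        then have "- x * (?P l x + x * ?P' l x)^2 = 0" using nil root by blast
        then have "?P l x + x * ?P' l x = 0" using x(1) by simp
        then show "poly G x = 0" unfolding Gx using Q by algebra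
      qed
      then have c: "coeff G j = 0" if "j \<le> k" for j using that dG by simp
      show "l i = 0" if "i < Suc k"
      proof (cases "i = k")
        case True
        then show ?thesis using c[of 0] by (simp add: G)
      next
        case False
        then have "i < k" using that by simp
        then show ?thesis using c[of "Suc i"] by (simp add: G coeff_monic_of)
      qed
    qed
    show "?wt i > 0" if "i < Suc k" for i using that by auto
    show "poly (T.pol (\<lambda>i. of_real s ^ ?wt i * l i)) (of_real s ^ (4 * k + 2) * c) = 0"
      if s: "s > 0" and c: "poly (T.pol l) c = 0" for s l c
    proof -
      let ?s = "complex_of_real s" and ?l = "\<lambda>i. of_real s ^ ?wt i * l i"
      obtain x where x: "x * ?P l x + 2 * x^2 * ?P' l x + (l k)^2 = 0" "- x * (?P l x + x * ?P' l x)^2 = c"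
        using c root by blast
      have P: "?P ?l (?s^2 * y) = ?s ^ (2 * k) * ?P l y" for y
      proof -
        have "?l i * (?s^2 * y)^i = ?s ^ (2 * k) * (l i * y^i)" if "i < k" for i
        proof -
          have "?s ^ (2 * (k - i)) * (?s^2)^i = ?s ^ (2 * k)"
            using that by (simp add: power_mult[symmetric] power_add[symmetric] flip: add_mult_distrib2)
          then show ?thesis using that by (simp add: power_mult_distrib mult_ac)
        qed
        then have "(\<Sum>i<k. ?l i * (?s^2 * y)^i) = ?s ^ (2 * k) * (\<Sum>i<k. l i * y^i)"
          unfolding sum_distrib_left by (intro sum.cong) auto
        then show ?thesis unfolding poly_monic_of
          by (simp add: power_mult_distrib power_mult[symmetric] distrib_left)
      qed
      have "pcompose (monic_of k ?l) [:0, ?s^2:] = smult (?s ^ (2 * k)) (monic_of k l)"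
        by (rule poly_eq_poly_eq_iff[THEN iffD1], rule ext) (use P in \<open>simp add: poly_pcompose mult.commute\<close>)
      then have "pderiv (pcompose (monic_of k ?l) [:0, ?s^2:]) = smult (?s ^ (2 * k)) (pderiv (monic_of k l))"
        by (simp add: pderiv_smult)
      then have "poly (pcompose (pderiv (monic_of k ?l)) [:0, ?s^2:] * [:?s^2:]) x = ?s ^ (2 * k) * ?P' l x"
        by (simp add: pderiv_pcompose pderiv_pCons)
      then have P': "?s^2 * ?P' ?l (?s^2 * x) = ?s ^ (2 * k) * ?P' l x"
        by (simp add: poly_pcompose mult.commute)
      have lk: "?l k ^ 2 = ?s^2 * ?s ^ (2 * k) * (l k)^2"
        by (simp add: power_mult_distrib power_mult[symmetric] power_add[symmetric] mult.commute[of k 2])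
      have "(?s^2 * x) * ?P ?l (?s^2 * x) + 2 * (?s^2 * x)^2 * ?P' ?l (?s^2 * x) + ?l k ^ 2
          = ?s^2 * ?s ^ (2 * k) * (x * ?P l x + 2 * x^2 * ?P' l x + (l k)^2)"
      proof -
        have "S * x * (T * p) + 2 * (S * x)^2 * p1 + S * T * b = S * T * (x * p + 2 * x^2 * p' + b)"
          if "S * p1 = T * p'" for S T p p1 p' b :: complex using that by algebra
        from this[OF P'] show ?thesis unfolding lk P .
      qed
      then have "(?s^2 * x) * ?P ?l (?s^2 * x) + 2 * (?s^2 * x)^2 * ?P' ?l (?s^2 * x) + ?l k ^ 2 = 0"
        using x(1) by simp
      moreover have "- (?s^2 * x) * (?P ?l (?s^2 * x) + (?s^2 * x) * ?P' ?l (?s^2 * x))^2 = ?s ^ (4 * k + 2) * c"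
      proof -
        have "?P ?l (?s^2 * x) + (?s^2 * x) * ?P' ?l (?s^2 * x) = ?s ^ (2 * k) * (?P l x + x * ?P' l x)"
          unfolding P using arg_cong[OF P', of "\<lambda>t. x * t"] by (simp add: algebra_simps)
        moreover have "?s ^ (4 * k + 2) = ?s^2 * (?s ^ (2 * k))^2"
          by (simp add: power_mult[symmetric] power_add[symmetric] mult.commute)
        ultimately show ?thesis unfolding x(2)[symmetric] by (simp add: power_mult_distrib mult_ac)
      qed
      ultimately show ?thesis using root by blast
    qed
    show "\<exists>l. card {c. poly (T.pol l) c = 0} = Suc k \<and> poly (T.pol l) 0 \<noteq> 0"
    proof -
      \<comment> \<open>A generic parameter: for \<open>P = x ^ k\<close> and \<open>a\<^sup>2 = - (2 k + 1)\<close> the critical points are the roots of unity of order \<open>k + 1\<close>.\<close>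
      let ?l = "\<lambda>i. if i = k then csqrt (- of_nat (2 * k + 1)) else 0"
      let ?U = "{u::complex. u ^ Suc k = 1}" and ?f = "\<lambda>u::complex. - (of_nat (Suc k)^2 * inverse u)"
      have P: "monic_of k ?l = monom 1 k" by (simp add: monic_of_def)
      have U0: "u \<noteq> 0" if "u \<in> ?U" for u using that by auto
      have "T.generic ?l"
      proof (rule T.genericI[of "?f ` ?U"])
        have "inj_on ?f ?U"
          by (rule inj_onI) (simp del: of_nat_Suc)
        then have "card (?f ` ?U) = card ?U" by (rule card_image)
        then show card: "card (?f ` ?U) = Suc k" using card_roots_unity_eq[of "Suc k"] by simp
        show "finite (?f ` ?U)" by (rule card_ge_0_finite) (simp only: card zero_less_Suc)
        show "0 \<notin> ?f ` ?U" using U0 by (auto simp del: of_nat_Suc)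
        fix c assume "c \<in> ?f ` ?U"
        then obtain u :: complex where u: "u ^ Suc k = 1" "c = ?f u" by auto
        have u': "u * (of_nat k * u ^ (k - 1)) = of_nat k * u ^ k" using k by (cases k) auto
        have Pu: "?P ?l u = u ^ k" "u * ?P' ?l u = of_nat k * u ^ k"
          unfolding P using u' by (simp_all add: poly_monom pderiv_monom)
        have "u * ?P ?l u + 2 * u^2 * ?P' ?l u + (?l k)^2 = 0"
        proof -
          have "2 * u^2 * ?P' ?l u = 2 * u * (of_nat k * u ^ k)" unfolding Pu(2)[symmetric] by (simp add: power2_eq_square)
          then have "u * ?P ?l u + 2 * u^2 * ?P' ?l u = of_nat (2 * k + 1) * u ^ Suc k"
            unfolding Pu(1) by (simp add: algebra_simps)
          moreover have "(?l k)^2 = - of_nat (2 * k + 1)" by (simp only: refl if_True power2_csqrt)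
          ultimately show ?thesis by (simp only: u(1) mult_1_right add.right_inverse)
        qed
        then have "0 = (0::complex) \<and> poly (critical_poly_I k ?l) u = 0" unfolding critical_poly_I_root_iff by simp
        moreover have "T.F ?l u 0 = c"
        proof -
          have "u ^ k = inverse u" using u(1) by (metis inverse_unique power_Suc)
          then have "u * (u ^ k)^2 = inverse u" using u(1) by (simp add: power2_eq_square)
          moreover have "T.F ?l u 0 = - (of_nat (Suc k)^2 * (u * (u ^ k)^2))"
            unfolding F Pu by (simp add: algebra_simps power2_eq_square)
          ultimately show ?thesis using u(2) by simp
        qed
        ultimately show "\<exists>w z. (z = 0 \<and> poly (critical_poly_I k ?l) w = 0) \<and> T.F ?l w z = c" by blast
      qed
      then show ?thesis unfolding T.generic_def by blast
    qed
    show "h i = 0" if gen: "card {c. poly (T.pol l) c = 0} = Suc k" "poly (T.pol l) 0 \<noteq> 0"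
      and D: "\<And>j. j < Suc k \<Longrightarrow> (\<Sum>i<Suc k. partial (\<lambda>l. coeff (T.pol l) j) i l * h i) = 0" and i: "i < Suc k" for l h i
    proof -
      have g: "T.generic l" using gen by (simp add: T.generic_def)
      define \<delta> where "\<delta> = (\<Sum>i<k. monom (h i) i)"
      define a where "a = l k"
      have F0: "T.F l x 0 \<noteq> 0" if "poly (critical_poly_I k l) x = 0" for x
        using that T.pol_root_iff[of l "T.F l x 0"] gen(2) by auto
      have simple: "poly (pderiv (critical_poly_I k l)) x \<noteq> 0" if x: "poly (critical_poly_I k l) x = 0" for x
      proof -
        have Q0: "critical_poly_I k l \<noteq> 0" using lead_coeff_monic_of[of "Suc k" "critical_coeffs_I k l"] by auto
        have fin: "finite {x. poly (critical_poly_I k l) x = 0}" using Q0 by (rule poly_roots_finite)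
        have "{c. poly (T.pol l) c = 0} = (\<lambda>x. T.F l x 0) ` {x. poly (critical_poly_I k l) x = 0}"
          using T.pol_root_iff by (auto simp: image_iff)
        then have "Suc k \<le> card {x. poly (critical_poly_I k l) x = 0}"
          using card_image_le[OF fin, of "\<lambda>x. T.F l x 0"] gen(1) by simp
        moreover have "card {x. poly (critical_poly_I k l) x = 0} \<le> Suc k"
          using card_poly_roots_bound[OF Q0] by (simp add: degree_monic_of)
        ultimately have "card {x. poly (critical_poly_I k l) x = 0} = degree (critical_poly_I k l)" by (simp add: degree_monic_of)
        then show ?thesis using card_roots_eq_degree_iff_pderiv[OF Q0] x by blast
      qed
      \<comment> \<open>Follow the critical point \<open>x\<close> along the curve \<open>\<gamma>\<close> of parameters with tangent \<open>h\<close>. The velocity \<open>x'\<close> solves the linearized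
        equation, and the constant term of \<open>P\<close> absorbs the remaining error \<open>e\<close>, which is of second order.\<close>
      have stat: "x * poly \<delta> x = 2 * a * h k" if x: "poly (critical_poly_I k l) x = 0" for x
      proof -
        define Q where "Q = smult (of_nat (2 * k + 1)) (critical_poly_I k l)"
        define p p' where "p = ?P l x" and "p' = ?P' l x"
        have Q: "poly Q y = y * ?P l y + 2 * y^2 * ?P' l y + a^2" for y
          unfolding Q_def critical_poly_I_eq a_def by (simp add: mult_ac)
        have Qx: "x * p + 2 * x^2 * p' + a^2 = 0" using x unfolding critical_poly_I_root_iff p_def p'_def a_def .
        have Fx: "- x * (p + x * p')^2 \<noteq> 0" using F0[OF x] unfolding F p_def p'_def .
        then have x0: "x \<noteq> 0" and y0: "p + x * p' \<noteq> 0" by auto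
        have Q': "poly (pderiv Q) x \<noteq> 0"
        proof -
          have "(of_nat (2 * k + 1) :: complex) \<noteq> 0" by (simp only: of_nat_eq_0_iff)
          then show ?thesis using simple[OF x] by (simp add: Q_def pderiv_smult del: of_nat_add of_nat_mult)
        qed
        define x' where "x' = - (x * poly \<delta> x + 2 * x^2 * poly (pderiv \<delta>) x + 2 * a * h k) / poly (pderiv Q) x"
        define \<xi> where "\<xi> s = x + s * x'" for s
        define e where "e s = poly Q (\<xi> s) + s * (\<xi> s * poly \<delta> (\<xi> s) + 2 * \<xi> s ^ 2 * poly (pderiv \<delta>) (\<xi> s) + 2 * a * h k)
            + s^2 * (h k)^2" for s
        define \<gamma> where "\<gamma> s i = l i + s * h i - (if i = 0 then e s / \<xi> s else 0)" for s i
        have \<xi>0: "\<xi> 0 = x" by (simp add: \<xi>_def)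
        have d\<xi>: "(\<xi> has_field_derivative x') (at 0)" unfolding \<xi>_def[abs_def] by (auto intro!: derivative_eq_intros)
        have dpoly: "((\<lambda>s. poly r (\<xi> s)) has_field_derivative poly (pderiv r) x * x') (at 0)" for r
          using DERIV_chain2[OF poly_DERIV d\<xi>, of r] by (simp add: \<xi>0)
        have e0: "e 0 = 0" using Qx unfolding e_def \<xi>0 Q p_def p'_def by simp
        have de: "(e has_field_derivative 0) (at 0)"
        proof -
          have "((\<lambda>s. \<xi> s * poly \<delta> (\<xi> s) + 2 * \<xi> s ^ 2 * poly (pderiv \<delta>) (\<xi> s) + 2 * a * h k) has_field_derivative
             (x * (poly (pderiv \<delta>) x * x') + x' * poly \<delta> x + (2 * x^2 * (poly (pderiv (pderiv \<delta>)) x * x')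
               + 2 * (of_nat 2 * (x' * x ^ (2 - Suc 0))) * poly (pderiv \<delta>) x) + 0)) (at 0)"
            using DERIV_add[OF DERIV_add[OF DERIV_mult'[OF d\<xi> dpoly[of \<delta>]]
                DERIV_mult'[OF DERIV_cmult[OF DERIV_power[OF d\<xi>, of 2], of 2] dpoly[of "pderiv \<delta>"]]] DERIV_const[of "2 * a * h k"]]
            by (simp add: \<xi>0)
          note d = DERIV_mult'[OF DERIV_ident this]
          have d2: "((\<lambda>s::complex. s^2 * (h k)^2) has_field_derivative 0) (at 0)"
            by (auto intro!: derivative_eq_intros)
          have "poly (pderiv Q) x * x' = - (x * poly \<delta> x + 2 * x^2 * poly (pderiv \<delta>) x + 2 * a * h k)"
            using Q' by (simp add: x'_def)
          then show ?thesis unfolding e_def[abs_def]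
            by (intro DERIV_cong[OF DERIV_add[OF DERIV_add[OF dpoly d] d2]]) (simp add: \<xi>0)
        qed
        have d\<epsilon>: "((\<lambda>s. e s / \<xi> s) has_field_derivative 0) (at 0)"
          by (rule DERIV_cong[OF DERIV_divide[OF de d\<xi>]]) (use x0 in \<open>simp_all add: \<xi>0 e0\<close>)
        have \<gamma>0: "\<gamma> 0 = l" by (simp add: \<gamma>_def e0 fun_eq_iff)
        have d\<gamma>: "((\<lambda>s. \<gamma> s i) has_field_derivative h i) (at 0)" for i
        proof -
          have "((\<lambda>s. l i + s * h i) has_field_derivative h i) (at 0)" by (auto intro!: derivative_eq_intros)
          moreover have "((\<lambda>s. if i = 0 then e s / \<xi> s else 0) has_field_derivative 0) (at 0)"
            using d\<epsilon> by (cases "i = 0") simp_all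
          ultimately show ?thesis unfolding \<gamma>_def using DERIV_diff by fastforce
        qed
        have P\<gamma>: "monic_of k (\<gamma> s) = monic_of k l + smult s \<delta> - [:e s / \<xi> s:]" for s
        proof -
          have "monic_of k (\<gamma> s) = monic_of k (\<lambda>i. (l i + s * h i) + (- (e s / \<xi> s)) * (if i = 0 then 1 else 0))"
            unfolding \<gamma>_def by (rule arg_cong[of _ _ "monic_of k"]) auto
          also have "\<dots> = monic_of k l + smult s \<delta> + smult (- (e s / \<xi> s)) (\<Sum>i<k. monom (if i = 0 then 1 else 0) i)"
            unfolding monic_of_add[of k "\<lambda>i. l i + s * h i"] monic_of_add[of k l] \<delta>_def ..
          also have "(\<Sum>i<k. monom (if i = 0 then 1 else 0) i) = (1 :: complex poly)"
          proof -
            have "(\<Sum>i<k. monom (if i = 0 then 1 else 0) i) = (\<Sum>i<k. if i = 0 then (1 :: complex poly) else 0)"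
              by (intro sum.cong) (auto simp: monom_0 one_pCons)
            then show ?thesis using k by simp
          qed
          finally show ?thesis by (simp add: one_pCons)
        qed
        have \<gamma>k: "\<gamma> s k = a + s * h k" for s using k by (simp add: \<gamma>_def a_def)
        have crit: "\<xi> s * ?P (\<gamma> s) (\<xi> s) + 2 * (\<xi> s)^2 * ?P' (\<gamma> s) (\<xi> s) + (\<gamma> s k)^2 = 0" if "\<xi> s \<noteq> 0" for s
        proof -
          have P1: "?P (\<gamma> s) (\<xi> s) = ?P l (\<xi> s) + s * poly \<delta> (\<xi> s) - e s / \<xi> s"
            and P2: "?P' (\<gamma> s) (\<xi> s) = ?P' l (\<xi> s) + s * poly (pderiv \<delta>) (\<xi> s)"
            unfolding P\<gamma> by (simp_all add: pderiv_add pderiv_diff pderiv_smult pderiv_pCons)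
          have "\<xi> s * (e s / \<xi> s) = e s" using that by simp
          then show ?thesis unfolding P1 P2 \<gamma>k using e_def[of s] unfolding Q by algebra
        qed
        have ev: "\<forall>\<^sub>F s in nhds 0. \<xi> s \<noteq> 0"
        proof -
          have "isCont \<xi> 0" using d\<xi> by (rule DERIV_isCont)
          then have "(\<xi> \<longlongrightarrow> \<xi> 0) (nhds 0)" by (simp add: isCont_def tendsto_at_iff_tendsto_nhds)
          then show ?thesis using x0 \<xi>0 by (metis tendsto_imp_eventually_ne)
        qed
        \<comment> \<open>At a critical point \<open>M = - 2 x (P + x P')\<close>, so the critical value is \<open>- M\<^sup>2 / (4 x)\<close>; this form has no derivative of \<open>P\<close>.\<close>
        define M where "M s = (\<gamma> s k)^2 - \<xi> s * ?P (\<gamma> s) (\<xi> s)" for s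
        define v where "v s = - ((M s)^2 / (4 * \<xi> s))" for s
        have Fv: "poly (T.pol (\<gamma> s)) (v s) = 0" if "\<xi> s \<noteq> 0" for s
        proof -
          have "M s = 2 * \<xi> s * (?P (\<gamma> s) (\<xi> s) + \<xi> s * ?P' (\<gamma> s) (\<xi> s)) * (- 1)"
            using crit[OF that] unfolding M_def by algebra
          then have "v s = - \<xi> s * (?P (\<gamma> s) (\<xi> s) + \<xi> s * ?P' (\<gamma> s) (\<xi> s))^2"
            unfolding v_def using that by (simp add: power_mult_distrib power2_eq_square)
          then show ?thesis unfolding root using crit[OF that] by (intro exI[of _ "\<xi> s"]) simp
        qed
        define y where "y = - (p + x * p')"
        have "y \<noteq> 0" using y0 unfolding y_def by (metis neg_equal_0_iff_equal)
        have M0: "M 0 = 2 * x * y" using Qx unfolding M_def \<gamma>0 \<xi>0 y_def p_def[symmetric] a_def[symmetric] by algebra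
        have dM: "(M has_field_derivative 2 * a * h k - x * poly \<delta> x + x' * y) (at 0)"
        proof -
          have "((\<lambda>s. ?P (\<gamma> s) (\<xi> s)) has_field_derivative p' * x' + poly \<delta> x) (at 0)"
          proof -
            have ds: "((\<lambda>s. s * poly \<delta> (\<xi> s)) has_field_derivative poly \<delta> x) (at 0)"
              by (rule DERIV_cong[OF DERIV_mult'[OF DERIV_ident dpoly]]) (simp add: \<xi>0)
            show ?thesis unfolding P\<gamma>
              using DERIV_diff[OF DERIV_add[OF dpoly[of "monic_of k l"] ds] d\<epsilon>] by (simp add: p'_def)
          qed
          from DERIV_mult'[OF d\<xi> this]
          have 1: "((\<lambda>s. \<xi> s * ?P (\<gamma> s) (\<xi> s)) has_field_derivative x * (p' * x' + poly \<delta> x) + x' * p) (at 0)"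
            by (simp add: \<xi>0 \<gamma>0 p_def)
          have 2: "((\<lambda>s. (\<gamma> s k)^2) has_field_derivative 2 * a * h k) (at 0)"
            by (rule DERIV_cong[OF DERIV_power[OF d\<gamma>]]) (simp add: \<gamma>k)
          show ?thesis unfolding M_def[abs_def]
            by (rule DERIV_cong[OF DERIV_diff[OF 2 1]]) (simp add: y_def algebra_simps)
        qed
        have dv: "(v has_field_derivative - (y * (2 * a * h k - x * poly \<delta> x))) (at 0)"
        proof -
          have "((\<lambda>s. (M s)^2 / (4 * \<xi> s)) has_field_derivative
             ((of_nat 2 * ((2 * a * h k - x * poly \<delta> x + x' * y) * M 0 ^ (2 - Suc 0))) * (4 * \<xi> 0) - (M 0)^2 * (4 * x')) / ((4 * \<xi> 0) * (4 * \<xi> 0))) (at 0)"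
            by (rule DERIV_divide[OF DERIV_power[OF dM] DERIV_cmult[OF d\<xi>]]) (use x0 in \<open>simp add: \<xi>0\<close>)
          moreover have "((of_nat 2 * ((2 * a * h k - x * poly \<delta> x + x' * y) * M 0 ^ (2 - Suc 0))) * (4 * \<xi> 0) - (M 0)^2 * (4 * x')) / ((4 * \<xi> 0) * (4 * \<xi> 0))
             = y * (2 * a * h k - x * poly \<delta> x)"
            unfolding M0 \<xi>0 using x0 by (simp add: field_simps power2_eq_square)
          ultimately show ?thesis unfolding v_def[abs_def] using DERIV_minus by fastforce
        qed
        have "- (y * (2 * a * h k - x * poly \<delta> x)) = 0"
        proof (rule T.critical_value_stationary[where \<gamma> = \<gamma> and h = h and v = v])
          show "\<forall>\<^sub>F s in nhds 0. poly (T.pol (\<gamma> s)) (v s) = 0" using ev by eventually_elim (rule Fv)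
        qed (use g D \<gamma>0 d\<gamma> dv in simp_all)
        then show ?thesis using \<open>y \<noteq> 0\<close> by simp
      qed
      have "a \<noteq> 0"
      proof
        assume "a = 0"
        then have "poly (critical_poly_I k l) 0 = 0" unfolding critical_poly_I_root_iff by (simp add: a_def)
        from F0[OF this] show False by (simp add: F)
      qed
      \<comment> \<open>The stationarity condition is a linear relation between the basis monomials \<open>1, x, \<dots>, x ^ k\<close>.\<close>
      define c where "c j = (if j = 0 then - (2 * a * h k) else h (j - 1))" for j
      have c: "c j = 0" if "j < Suc k" for j
      proof (rule T.points_separate_basis[OF g _ that])
        fix w z :: complex assume "z = 0 \<and> poly (critical_poly_I k l) w = 0"
        then have "w * poly \<delta> w = 2 * a * h k" using stat by blast
        moreover have "(\<Sum>j<Suc k. c j * w ^ j) = - (2 * a * h k) + w * poly \<delta> w"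
          unfolding sum.lessThan_Suc_shift
          by (simp add: c_def \<delta>_def poly_sum poly_monom sum_distrib_left mult_ac)
        ultimately show "(\<Sum>j<Suc k. c j * (w ^ j * z ^ 0)) = 0" by (simp del: sum.lessThan_Suc)
      qed
      show "h i = 0"
      proof (cases "i = k")
        case True
        then show ?thesis using c[of 0] \<open>a \<noteq> 0\<close> by (simp add: c_def)
      next
        case False
        then show ?thesis using c[of "Suc i"] i by (simp add: c_def)
      qed
    qed
    show "polyfun_coeffs (Suc k) T.pol" by (rule T.polyfun_pol)
    show "degree (T.pol l) = Suc k" "lead_coeff (T.pol l) = 1" for l by (fact T.monic_pol)+
    show "4 * k + 2 > 0" by simp
  qed
  show ?thesis
  proof (rule C.LL_is_covering)
    fix t
    have "c \<in> nonzero_critical_values (TypeI k) ix t \<longleftrightarrow> c \<noteq> 0 \<and> poly (T.pol (\<lambda>i. t $ ix i)) c = 0" for c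
    proof (cases "c = 0")
      case False
      have "(\<exists>x. A x \<and> c = B x) = (\<exists>x. A x \<and> B x = c)" for A and B :: "complex \<Rightarrow> complex" by metis
      then show ?thesis unfolding nonzero_critical_values_def root matrix_family.simps Diff_iff critical_values_I[OF False]
        using False by simp
    qed (simp add: nonzero_critical_values_def)
    then show "nonzero_critical_values (TypeI k) ix t = {c. poly (T.pol (\<lambda>i. t $ ix i)) c = 0} - {0}" by blast
  qed simp
qed

theorem proposition6p4:
  fixes S :: sym_singularity and ix :: "nat \<Rightarrow> 'n::finite"
  assumes "S \<in> {TypeI k | k. k \<ge> 1} \<union> {TypeII4, TypeII5, TypeII6}"
    and "bij_betw ix {..<tau S} (UNIV :: 'n set)"
  shows "holomorphic_map_on (LL S ix) UNIV
       \<and> proper_map euclidean euclidean (LL S ix)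
       \<and> LL S ix ` bifurcation_diagram S ix \<subseteq> discriminant_set ix
       \<and> covering_space (- bifurcation_diagram S ix) (LL S ix) (- discriminant_set ix)
       \<and> (\<exists>N::nat. \<forall>a \<in> - discriminant_set ix.
            finite {t \<in> - bifurcation_diagram S ix. LL S ix t = a} \<and>
            card {t \<in> - bifurcation_diagram S ix. LL S ix t = a} = N)"
proof -
  consider k where "S = TypeI k" "k \<ge> 1" | "S = TypeII4" | "S = TypeII5" | "S = TypeII6"
    using assms(1) by auto
  then show ?thesis
  proof cases
    case 1
    then show ?thesis using LL_type_I[of ix k] assms(2) by simp
  next
    case 2
    then show ?thesis using LL_type_II4[of ix] assms(2) by simp
  next
    case 3
    then show ?thesis using LL_type_II5[of ix] assms(2) by simp
  next
    case 4
    then show ?thesis using LL_type_II6[of ix] assms(2) by simp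
  qed
qed

end
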